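(* Consider the control system $x_{t+1}=Ax_t+Bu^a_t+w_t$, $x_0=\overline{x}$, under the repetitive transmission protocol, i.e. with plant input over one horizon $u^a_{t:N}=\mathcal{G}\boldsymbol{\eta}_t+\mathcal{S}\bigl(\boldsymbol{\Theta}_t\mathfrak{e}(w_{t:N-1})+\boldsymbol{\Lambda}_t\nu_{t:N-1}\bigr)$. Then for every $t=0,N_r,2N_r,\ldots$, the optimization problem $$\text{minimize}\quad \mathbb{E}_{x_t}\bigl[\langle x_{t:N+1},\mathcal{Q}x_{t:N+1}\rangle+\langle u^a_{t:N},\mathcal{R}u^a_{t:N}\rangle\bigr]+\mu\,\varrho_t(\boldsymbol{\eta}_t,\boldsymbol{\Theta}_t,\boldsymbol{\Lambda}_t)$$ subject to the dynamics $x_{t:N+1}=\mathcal{A}x_t+\mathcal{B}u^a_{t:N}+\mathcal{D}w_{t:N}$ and the hard constraint that every control in $u^a_{t:N}$ lies in $\mathbb{U}=\{v\in\mathbb{R}^m : \|v\|_\infty\le U_{\max}\}$, over the class of control policies $u_{t:N}=\boldsymbol{\eta}_t+\boldsymbol{\Theta}_t\mathfrak{e}(w_{t:N-1})+\boldsymbol{\Lambda}_t\nu_{t:N-1}$ (decision variables $\boldsymbol{\eta}_t,\boldsymbol{\Theta}_t,\boldsymbol{\Lambda}_t$), is convex, feasible, and can be rewritten as the following convex quadratic program: $$\begin{aligned}\underset{\boldsymbol{\eta}_t,\boldsymbol{\Theta}_t,\boldsymbol{\Lambda}_t}{\text{minimize}}\quad & \langle\Xi_t,\mathcal{L}\Xi_t\rangle+\langle\mathcal{M}\mathcal{A}x_t,\Xi_t\rangle+\langle\mathcal{A}x_t,\mathcal{Q}\mathcal{A}x_t\rangle+2\,\mathrm{tr}\bigl(\boldsymbol{\Theta}_t^\top\mu_{\mathcal{S}}^\top\mathcal{B}^\top\mathcal{Q}\mathcal{D}\Sigma_{\mathfrak{e}}'\bigr)\\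 &+\mathrm{tr}\bigl(\mathcal{D}^\top\mathcal{Q}\mathcal{D}\Sigma_W\bigr)+\mathrm{tr}\bigl(\boldsymbol{\Theta}_t^\top\Sigma_{\mathcal{S}}\boldsymbol{\Theta}_t\Sigma_{\mathfrak{e}}\bigr)+\mu\,\varrho_t(\boldsymbol{\eta}_t,\boldsymbol{\Theta}_t,\boldsymbol{\Lambda}_t)\end{aligned}$$ subject to $$\Bigl|\boldsymbol{\eta}_t^{(i)}+\tfrac12\boldsymbol{\Lambda}_t^{(i,:)}\mathbf{1}_{N-1}\Bigr|+\tfrac12\bigl\|\boldsymbol{\Lambda}_t^{(i,:)}\bigr\|_1+\bigl\|\boldsymbol{\Theta}_t^{(i,:)}\bigr\|_1\varphi_{\max}\le U_{\max},\qquad i=1,\ldots,mN.$$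
   Context: **Plant and channel.** $A\in\mathbb{R}^{d\times d}$, $B\in\mathbb{R}^{d\times m}$, $\overline{x}\in\mathbb{R}^d$ are given. $(\nu_t)_{t\ge0}$ (channel successes) are i.i.d. Bernoulli $\{0,1\}$ random variables with $\mathbb{E}[\nu_t]=p$, $0<p\le1$. $(w_t)_{t\ge0}$ are i.i.d. zero-mean random vectors in $\mathbb{R}^d$, symmetrically distributed around the origin, with finite second moments, independent of $(\nu_t)$. The state is measured perfectly, and $\nu_t$ (via acknowledgements) is causally available at the controller. $U_{\max}>0$. **Notation.** For a sequence $(s_n)$, $s_{n:k}=[s_n^\top\ s_{n+1}^\top\cdots s_{n+k-1}^\top]^\top$. $\mathbb{E}_{x_t}$ is conditional expectation given $x_t$. $V^{(i)}$ is the $i$th component of a vector; $M^{(i,:)}$, $M^{(:,i)}$ are the $i$th row and column of a matrix. $\mathbf{1}_k$ is the all-ones vector of length $k$; $\langle v,w\rangle=v^\top w$. **Horizon and cost.** $N\ge1$ is the optimization horizon, $N_r\in\{1,\ldots,N\}$ the recalculation interval. $Q,Q_f\in\mathbb{R}^{d\times d}$ are symmetric non-negative definite, $R\in\mathbb{R}^{m\times m}$ is symmetric positive definite, $\mathcal{Q}=\mathrm{blkdiag}(Q,\ldots,Q,Q_f)$ ($N$ copies of $Q$), $\mathcal{R}=\mathrm{blkdiag}(R,\ldots,R)$ ($N$ copies), $\mu\ge0$. $\mathcal{A},\mathcal{B},\mathcal{D}$ are the matrices obtained by stacking the dynamics over the horizon: block row $k\in\{0,\ldots,N\}$ of $\mathcal{A}$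 is $A^k$, and the $(k,j)$ blocks ($0\le j\le N-1$) of $\mathcal{B}$ and $\mathcal{D}$ are $A^{k-1-j}B$ and $A^{k-1-j}$ for $j<k$, and $0$ otherwise. **Policy class.** $\boldsymbol{\eta}_t\in\mathbb{R}^{mN}$; $\boldsymbol{\Theta}_t\in\mathbb{R}^{mN\times d(N-1)}$ and $\boldsymbol{\Lambda}_t\in\mathbb{R}^{mN\times(N-1)}$ are strictly lower block triangular, with blocks $\theta_{\ell,t+i}\in\mathbb{R}^{m\times d}$, respectively $\lambda_{\ell,t+i}\in\mathbb{R}^m$, in block row $\ell\in\{0,\ldots,N-1\}$ and block column $i\in\{0,\ldots,N-2\}$, zero unless $i<\ell$. $\mathfrak{e}(w_{t:N-1})=[\mathfrak{e}_1(w_t)^\top\cdots\mathfrak{e}_{N-1}(w_{t+N-2})^\top]^\top$, where each $\mathfrak{e}_i:\mathbb{R}^d\to\mathbb{R}^d$ is a component-wise saturation function symmetric about the origin (odd), and $\|\mathfrak{e}(w_{t:N-1})\|_\infty\le\varphi_{\max}$. The hard control constraint is required for all values $\nu_{t:N}\in\{0,1\}^{N}$ and all values of the vector $\mathfrak{e}(w_{t:N-1})$ with $\|\cdot\|_\infty\le\varphi_{\max}$. **Regularizer.** Let $F_t=[\boldsymbol{\eta}_t\ \boldsymbol{\Theta}_t\ \boldsymbol{\Lambda}_t]$, and let $\hat F_t$ be the matrix with $N$ rows obtained from $F_t$ by replacing each $m\times1$ block by its transpose (so $\hat F_t=F_t$ if $m=1$; the $i$th row of $\hat F_t$ lists all entries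 of the $i$th $m$-row block of $F_t$). Then $\varrho_t(\boldsymbol{\eta}_t,\boldsymbol{\Theta}_t,\boldsymbol{\Lambda}_t)=\sum_{i=1}^N\|\hat F_t^{(i,:)}\|_\infty$. **Repetitive transmission protocol.** The control value $u_{t+\ell}$ is transmitted at each instant $t+\ell$, $\ell\in\{0,\ldots,N_r-1\}$, and in addition the remaining blocks of $\boldsymbol{\eta}_t$ are transmitted at each step until the first successful transmission, received packets being stored in a buffer at the actuator; in case of a later dropout the corresponding stored offset block is applied (zero is applied if nothing has been received). Correspondingly $\mathcal{S}=\mathrm{blkdiag}(I_m\nu_t,\ldots,I_m\nu_{t+N_r-1},I_{m(N-N_r)})$, and $\mathcal{G}$ is the $N\times N$ block matrix with $m\times m$ blocks $\mathcal{G}_b^{(i,j)}=\rho_{t+i-1}I_m$ if $i=j\le N_r$, $I_m$ if $i=j>N_r$, and $0$ otherwise, where $\rho_t=\nu_t$ and $\rho_{t+\ell}=\rho_{t+\ell-1}+\bigl(\prod_{s=0}^{\ell-1}(1-\nu_{t+s})\bigr)\nu_{t+\ell}$. **Matrices of the program.** For $\ell=1,\ldots,N-1$ let $\mathfrak{C}_\ell=\begin{bmatrix}0_{m\ell\times m(N-\ell)}\\ I_{m(N-\ell)}\end{bmatrix}$, $\bar{\boldsymbol{\Lambda}}_t^{(:,\ell)}=\mathfrak{C}_\ell^\top\boldsymbol{\Lambda}_t^{(:,\ell)}$, $\tilde{\boldsymbol{\Lambda}}_t=[(\bar{\boldsymbol{\Lambda}}_t^{(:,1)})^\top\cdots(\bar{\boldsymbol{\Lambda}}_t^{(:,N-1)})^\top]^\top$,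 $\Xi_t=\begin{bmatrix}\boldsymbol{\eta}_t\\ \tilde{\boldsymbol{\Lambda}}_t\end{bmatrix}$, $\mathcal{S}_\ell=\nu_{t+\ell-1}\mathcal{S}$, $\alpha=\mathcal{B}^\top\mathcal{Q}\mathcal{B}+\mathcal{R}$. Then $$\mathcal{L}=\begin{bmatrix}\Sigma_{\mathcal{G}}&\tilde\Sigma_{\mathcal{S}\mathcal{G}_\ell}\\ \tilde\Sigma_{\mathcal{S}\mathcal{G}_\ell}^\top&\tilde\Sigma_{\mathcal{S}_{n\ell}}\end{bmatrix},\qquad \mathcal{M}=2\begin{bmatrix}\mathcal{Q}\mathcal{B}\mu_{\mathcal{G}}&\mathcal{Q}\mathcal{B}\tilde\mu_{\mathcal{S}_\ell}\end{bmatrix}^\top,$$ with $\Sigma_{\mathcal{G}}=\mathbb{E}[\mathcal{G}^\top\alpha\mathcal{G}]$; $\tilde\Sigma_{\mathcal{S}\mathcal{G}_\ell}$ the block row with blocks $\mathbb{E}[\mathcal{G}^\top\alpha\mathcal{S}_\ell]\mathfrak{C}_\ell$, $\ell=1,\ldots,N-1$; $\tilde\Sigma_{\mathcal{S}_{n\ell}}$ the block matrix with $(n,\ell)$ block $\mathfrak{C}_n^\top\mathbb{E}[\mathcal{S}_n^\top\alpha\mathcal{S}_\ell]\mathfrak{C}_\ell$, $n,\ell=1,\ldots,N-1$; $\mu_{\mathcal{G}}=\mathbb{E}[\mathcal{G}]$; $\tilde\mu_{\mathcal{S}_\ell}$ the block row with blocks $\mathbb{E}[\mathcal{S}_\ell]\mathfrak{C}_\ell$,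 $\ell=1,\ldots,N-1$. Further $\mu_{\mathcal{S}}=\mathbb{E}[\mathcal{S}]$, $\Sigma_{\mathcal{S}}=\mathbb{E}[\mathcal{S}^\top\alpha\mathcal{S}]$, $\Sigma_{\mathfrak{e}}'=\mathbb{E}[w_{t:N}\,\mathfrak{e}(w_{t:N-1})^\top]$, $\Sigma_W=\mathbb{E}[w_{t:N}w_{t:N}^\top]$, $\Sigma_{\mathfrak{e}}=\mathbb{E}[\mathfrak{e}(w_{t:N-1})\mathfrak{e}(w_{t:N-1})^\top]$. "Convex quadratic program" is understood in the paper's sense: a convex quadratic objective plus the (convex, piecewise linear) $\ell_1/\ell_\infty$ regularizer, with convex piecewise linear constraints. *)

theory Defs
  imports
    "HOL-Probability.Probability"
    "Jordan_Normal_Form.Matrix"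
begin

no_notation inner (infix "\<bullet>" 70)
no_notation vec_nth (infixl "$" 90)

definition linf :: "real vec \<Rightarrow> real" where
  \<comment> \<open>The inserted 0 only matters for the vector of length 0.\<close>
  "linf v = Max (insert 0 ((\<lambda>i. \<bar>v $ i\<bar>) ` {..<dim_vec v}))"

definition l1 :: "real vec \<Rightarrow> real" where
  "l1 v = (\<Sum>i<dim_vec v. \<bar>v $ i\<bar>)"

definition tr_mat :: "real mat \<Rightarrow> real" where
  "tr_mat X = (\<Sum>i<dim_row X. X $$ (i, i))"

definition outer :: "real vec \<Rightarrow> real vec \<Rightarrow> real mat" where
  "outer v u = mat (dim_vec v) (dim_vec u) (\<lambda>(i, j). v $ i * u $ j)"

definition sym_nonneg_def :: "nat \<Rightarrow> real mat \<Rightarrow> bool" where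
  "sym_nonneg_def n X \<longleftrightarrow> X \<in> carrier_mat n n \<and> X\<^sup>T = X
     \<and> (\<forall>v\<in>carrier_vec n. 0 \<le> v \<bullet> (X *\<^sub>v v))"

definition sym_pos_def :: "nat \<Rightarrow> real mat \<Rightarrow> bool" where
  "sym_pos_def n X \<longleftrightarrow> X \<in> carrier_mat n n \<and> X\<^sup>T = X
     \<and> (\<forall>v\<in>carrier_vec n. v \<noteq> 0\<^sub>v n \<longrightarrow> 0 < v \<bullet> (X *\<^sub>v v))"

text \<open>Blocks are counted from 0. In \<open>block_mat p q r c X\<close> there are \<open>p\<close> times \<open>q\<close> blocks,
  each of size \<open>r\<close> times \<open>c\<close>.\<close>

definition block_vec :: "nat \<Rightarrow> nat \<Rightarrow> (nat \<Rightarrow> real vec) \<Rightarrow> real vec" where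
  "block_vec p r v = vec (p * r) (\<lambda>i. v (i div r) $ (i mod r))"

definition block_mat :: "nat \<Rightarrow> nat \<Rightarrow> nat \<Rightarrow> nat \<Rightarrow> (nat \<Rightarrow> nat \<Rightarrow> real mat) \<Rightarrow> real mat" where
  "block_mat p q r c X =
     mat (p * r) (q * c) (\<lambda>(i, j). X (i div r) (j div c) $$ (i mod r, j mod c))"

definition vblock :: "nat \<Rightarrow> real vec \<Rightarrow> nat \<Rightarrow> real vec" where
  "vblock r v k = vec r (\<lambda>i. v $ (k * r + i))"

definition append_cols :: "real mat \<Rightarrow> real mat \<Rightarrow> real mat" where
  "append_cols X Y = four_block_mat X Y (0\<^sub>m 0 (dim_col X)) (0\<^sub>m 0 (dim_col Y))"

definition hcat :: "nat \<Rightarrow> real mat list \<Rightarrow> real mat" where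
  "hcat nr Xs = foldr append_cols Xs (0\<^sub>m nr 0)"

definition vcat :: "nat \<Rightarrow> real mat list \<Rightarrow> real mat" where
  "vcat nc Xs = foldr append_rows Xs (0\<^sub>m 0 nc)"

text \<open>The Borel structure on vectors of length \<open>n\<close>, transported from the product space.\<close>

definition borel_vec :: "nat \<Rightarrow> real vec measure" where
  "borel_vec n = vimage_algebra (carrier_vec n) (\<lambda>v. \<lambda>i\<in>{..<n}. v $ i) (\<Pi>\<^sub>M i\<in>{..<n}. borel)"

text \<open>The saturation \<open>sat P i\<close> with \<open>i \<ge> 1\<close> acts componentwise, its \<open>j\<close>-th
  component being the scalar function \<open>sat P i j\<close>. The channel variables \<open>ack P t\<close>
  take the values 0 and 1.\<close>

record 'a system =
  xdim :: nat
  udim :: nat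
  horizon :: nat
  recalc :: nat
  sysA :: "real mat"
  sysB :: "real mat"
  xinit :: "real vec"
  wgtQ :: "real mat"
  wgtQf :: "real mat"
  wgtR :: "real mat"
  regmu :: real
  Umax :: real
  phimax :: real
  sat :: "nat \<Rightarrow> nat \<Rightarrow> real \<Rightarrow> real"
  prob :: "'a measure"
  noise :: "nat \<Rightarrow> 'a \<Rightarrow> real vec"
  ack :: "nat \<Rightarrow> 'a \<Rightarrow> real"

definition calA :: "'a system \<Rightarrow> real mat" where
  "calA P = block_mat (horizon P + 1) 1 (xdim P) (xdim P) (\<lambda>k _. sysA P ^\<^sub>m k)"

definition calB :: "'a system \<Rightarrow> real mat" where
  "calB P = block_mat (horizon P + 1) (horizon P) (xdim P) (udim P)
     (\<lambda>k j. if j < k then sysA P ^\<^sub>m (k - 1 - j) * sysB P else 0\<^sub>m (xdim P) (udim P))"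

definition calD :: "'a system \<Rightarrow> real mat" where
  "calD P = block_mat (horizon P + 1) (horizon P) (xdim P) (xdim P)
     (\<lambda>k j. if j < k then sysA P ^\<^sub>m (k - 1 - j) else 0\<^sub>m (xdim P) (xdim P))"

definition calQ :: "'a system \<Rightarrow> real mat" where
  "calQ P = diag_block_mat (replicate (horizon P) (wgtQ P) @ [wgtQf P])"

definition calR :: "'a system \<Rightarrow> real mat" where
  "calR P = diag_block_mat (replicate (horizon P) (wgtR P))"

text \<open>Below, \<open>n\<close> and \<open>ws\<close> stand for the channel values and the noise vectors seen from the
  beginning of a horizon: \<open>n l\<close> is the channel value and \<open>ws l\<close> the noise at the \<open>l\<close>-th step.\<close>

definition acks :: "'a system \<Rightarrow> nat \<Rightarrow> 'a \<Rightarrow> nat \<Rightarrow> real" where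
  "acks P t \<omega> = (\<lambda>l. ack P (t + l) \<omega>)"

definition noises :: "'a system \<Rightarrow> nat \<Rightarrow> 'a \<Rightarrow> nat \<Rightarrow> real vec" where
  "noises P t \<omega> = (\<lambda>l. noise P (t + l) \<omega>)"

definition wvec :: "'a system \<Rightarrow> (nat \<Rightarrow> real vec) \<Rightarrow> real vec" where
  "wvec P ws = block_vec (horizon P) (xdim P) ws"

definition evec :: "'a system \<Rightarrow> (nat \<Rightarrow> real vec) \<Rightarrow> real vec" where
  "evec P ws = block_vec (horizon P - 1) (xdim P)
     (\<lambda>i. vec (xdim P) (\<lambda>j. sat P (i + 1) j (ws i $ j)))"

fun received :: "(nat \<Rightarrow> real) \<Rightarrow> nat \<Rightarrow> real" where
  "received n 0 = n 0"
| "received n (Suc l) = received n l + (\<Prod>s<Suc l. 1 - n s) * n (Suc l)"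

definition Gmat :: "'a system \<Rightarrow> (nat \<Rightarrow> real) \<Rightarrow> real mat" where
  "Gmat P n = block_mat (horizon P) (horizon P) (udim P) (udim P)
     (\<lambda>i j. if i = j then (if i < recalc P then received n i \<cdot>\<^sub>m 1\<^sub>m (udim P) else 1\<^sub>m (udim P))
            else 0\<^sub>m (udim P) (udim P))"

definition Smat :: "'a system \<Rightarrow> (nat \<Rightarrow> real) \<Rightarrow> real mat" where
  "Smat P n = diag_block_mat (map (\<lambda>l. n l \<cdot>\<^sub>m 1\<^sub>m (udim P)) [0..<recalc P]
     @ [1\<^sub>m (udim P * (horizon P - recalc P))])"

record decision =
  eta :: "real vec"
  Theta :: "real mat"
  Lam :: "real mat"

definition policy_class :: "'a system \<Rightarrow> decision set" where
  "policy_class P = {F.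
     eta F \<in> carrier_vec (udim P * horizon P)
   \<and> Theta F \<in> carrier_mat (udim P * horizon P) (xdim P * (horizon P - 1))
   \<and> Lam F \<in> carrier_mat (udim P * horizon P) (horizon P - 1)
   \<and> (\<forall>r<udim P * horizon P. \<forall>c<xdim P * (horizon P - 1).
        \<not> c div xdim P < r div udim P \<longrightarrow> Theta F $$ (r, c) = 0)
   \<and> (\<forall>r<udim P * horizon P. \<forall>c<horizon P - 1.
        \<not> c < r div udim P \<longrightarrow> Lam F $$ (r, c) = 0)}"

text \<open>The plant input over one horizon; \<open>\<xi>\<close> is the stacked saturated noise.\<close>

definition applied :: "'a system \<Rightarrow> decision \<Rightarrow> (nat \<Rightarrow> real) \<Rightarrow> real vec \<Rightarrow> real vec" where
  "applied P F n \<xi> = Gmat P n *\<^sub>v eta F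
     + Smat P n *\<^sub>v (Theta F *\<^sub>v \<xi> + Lam F *\<^sub>v vec (horizon P - 1) n)"

definition feasible_set :: "'a system \<Rightarrow> decision set" where
  "feasible_set P = {F \<in> policy_class P.
     \<forall>n \<xi>. (\<forall>l<horizon P. n l \<in> {0, 1}) \<longrightarrow> \<xi> \<in> carrier_vec (xdim P * (horizon P - 1)) \<longrightarrow>
       linf \<xi> \<le> phimax P \<longrightarrow>
       (\<forall>l<horizon P. linf (vblock (udim P) (applied P F n \<xi>) l) \<le> Umax P)}"

text \<open>A decision is taken with knowledge of the current state. Constant rules represent
  the fixed decisions.\<close>

definition decision_rule :: "'a system \<Rightarrow> (real vec \<Rightarrow> decision) \<Rightarrow> bool" where
  "decision_rule P \<kappa> \<longleftrightarrow>
     (\<forall>v\<in>carrier_vec (xdim P). \<kappa> v \<in> policy_class P)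
   \<and> (\<forall>i<udim P * horizon P.
        (\<lambda>v. eta (\<kappa> v) $ i) \<in> borel_measurable (borel_vec (xdim P)))
   \<and> (\<forall>i<udim P * horizon P. \<forall>j<xdim P * (horizon P - 1).
        (\<lambda>v. Theta (\<kappa> v) $$ (i, j)) \<in> borel_measurable (borel_vec (xdim P)))
   \<and> (\<forall>i<udim P * horizon P. \<forall>j<horizon P - 1.
        (\<lambda>v. Lam (\<kappa> v) $$ (i, j)) \<in> borel_measurable (borel_vec (xdim P)))"

text \<open>Receding horizon operation: at time \<open>s\<close> the current horizon began at the largest multiple
  of the recalculation interval not exceeding \<open>s\<close>; \<open>\<pi> k\<close> is the rule used at time \<open>k\<close>.\<close>

definition closed_loop ::
  "'a system \<Rightarrow> (nat \<Rightarrow> real vec \<Rightarrow> decision) \<Rightarrow> (nat \<Rightarrow> 'a \<Rightarrow> real vec) \<Rightarrow> bool" where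
  "closed_loop P \<pi> x \<longleftrightarrow>
     (\<forall>\<omega>\<in>space (prob P). x 0 \<omega> = xinit P \<and>
       (\<forall>s. let s0 = s - s mod recalc P;
                ua = applied P (\<pi> s0 (x s0 \<omega>)) (acks P s0 \<omega>) (evec P (noises P s0 \<omega>))
            in x (Suc s) \<omega> = sysA P *\<^sub>v x s \<omega>
                 + sysB P *\<^sub>v vblock (udim P) ua (s mod recalc P) + noise P s \<omega>))"

text \<open>\<open>Fhat\<close> replaces each block of \<open>udim P\<close> consecutive entries in a column of
  \<open>[\<eta> \<Theta> \<Lambda>]\<close> by its transpose.\<close>

definition Fhat :: "'a system \<Rightarrow> decision \<Rightarrow> real mat" where
  "Fhat P F =
     (let m = udim P; N = horizon P; X = hcat (m * N) [mat_of_cols (m * N) [eta F], Theta F, Lam F]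
      in mat N (m * dim_col X) (\<lambda>(i, j). X $$ (i * m + j mod m, j div m)))"

definition regularizer :: "'a system \<Rightarrow> decision \<Rightarrow> real" where
  "regularizer P F = (\<Sum>i<horizon P. linf (row (Fhat P F) i))"

definition horizon_cost ::
  "'a system \<Rightarrow> real vec \<Rightarrow> decision \<Rightarrow> (nat \<Rightarrow> real) \<Rightarrow> (nat \<Rightarrow> real vec) \<Rightarrow> real" where
  "horizon_cost P v F n ws =
     (let ua = applied P F n (evec P ws);
          X = calA P *\<^sub>v v + calB P *\<^sub>v ua + calD P *\<^sub>v wvec P ws
      in X \<bullet> (calQ P *\<^sub>v X) + ua \<bullet> (calR P *\<^sub>v ua))"

text \<open>The objective is a conditional expectation given the current state, hence a random variable
  that is determined up to a null set. As the cost is nonnegative, the conditional expectation is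
  meaningful without an integrability assumption.\<close>

definition objective ::
  "'a system \<Rightarrow> (nat \<Rightarrow> 'a \<Rightarrow> real vec) \<Rightarrow> nat \<Rightarrow> (real vec \<Rightarrow> decision) \<Rightarrow> 'a \<Rightarrow> real" where
  "objective P x t \<kappa> \<omega> =
     real_cond_exp (prob P) (vimage_algebra (space (prob P)) (x t) (borel_vec (xdim P)))
       (\<lambda>\<omega>. horizon_cost P (x t \<omega>) (\<kappa> (x t \<omega>)) (acks P t \<omega>) (noises P t \<omega>)) \<omega>
     + regmu P * regularizer P (\<kappa> (x t \<omega>))"

definition expect_mat :: "'a system \<Rightarrow> nat \<Rightarrow> nat \<Rightarrow> ('a \<Rightarrow> real mat) \<Rightarrow> real mat" where
  "expect_mat P r c X = mat r c (\<lambda>(i, j). \<integral>\<omega>. X \<omega> $$ (i, j) \<partial>prob P)"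

abbreviation usize :: "'a system \<Rightarrow> nat" where
  "usize P \<equiv> udim P * horizon P"

definition alpha :: "'a system \<Rightarrow> real mat" where
  "alpha P = (calB P)\<^sup>T * calQ P * calB P + calR P"

definition Cl :: "'a system \<Rightarrow> nat \<Rightarrow> real mat" where
  "Cl P l = 0\<^sub>m (udim P * l) (udim P * (horizon P - l)) @\<^sub>r 1\<^sub>m (udim P * (horizon P - l))"

definition Sl :: "'a system \<Rightarrow> nat \<Rightarrow> (nat \<Rightarrow> real) \<Rightarrow> real mat" where
  "Sl P l n = n (l - 1) \<cdot>\<^sub>m Smat P n"

definition Lam_tilde :: "'a system \<Rightarrow> decision \<Rightarrow> real vec" where
  "Lam_tilde P F =
     foldr append_vec (map (\<lambda>l. (Cl P l)\<^sup>T *\<^sub>v col (Lam F) (l - 1)) [1..<horizon P]) (0\<^sub>v 0)"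

definition Xi :: "'a system \<Rightarrow> decision \<Rightarrow> real vec" where
  "Xi P F = eta F @\<^sub>v Lam_tilde P F"

definition mu_G :: "'a system \<Rightarrow> nat \<Rightarrow> real mat" where
  "mu_G P t = expect_mat P (usize P) (usize P) (\<lambda>\<omega>. Gmat P (acks P t \<omega>))"

definition mu_S :: "'a system \<Rightarrow> nat \<Rightarrow> real mat" where
  "mu_S P t = expect_mat P (usize P) (usize P) (\<lambda>\<omega>. Smat P (acks P t \<omega>))"

definition mu_Sl :: "'a system \<Rightarrow> nat \<Rightarrow> real mat" where
  "mu_Sl P t = hcat (usize P)
     (map (\<lambda>l. expect_mat P (usize P) (usize P) (\<lambda>\<omega>. Sl P l (acks P t \<omega>)) * Cl P l) [1..<horizon P])"

definition Sigma_G :: "'a system \<Rightarrow> nat \<Rightarrow> real mat" where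
  "Sigma_G P t = expect_mat P (usize P) (usize P)
     (\<lambda>\<omega>. (Gmat P (acks P t \<omega>))\<^sup>T * alpha P * Gmat P (acks P t \<omega>))"

definition Sigma_S :: "'a system \<Rightarrow> nat \<Rightarrow> real mat" where
  "Sigma_S P t = expect_mat P (usize P) (usize P)
     (\<lambda>\<omega>. (Smat P (acks P t \<omega>))\<^sup>T * alpha P * Smat P (acks P t \<omega>))"

definition Sigma_SGl :: "'a system \<Rightarrow> nat \<Rightarrow> real mat" where
  "Sigma_SGl P t = hcat (usize P)
     (map (\<lambda>l. expect_mat P (usize P) (usize P)
                 (\<lambda>\<omega>. (Gmat P (acks P t \<omega>))\<^sup>T * alpha P * Sl P l (acks P t \<omega>)) * Cl P l)
       [1..<horizon P])"

definition Sigma_Snl :: "'a system \<Rightarrow> nat \<Rightarrow> real mat" where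
  "Sigma_Snl P t = vcat (\<Sum>l\<leftarrow>[1..<horizon P]. udim P * (horizon P - l))
     (map (\<lambda>n. hcat (udim P * (horizon P - n))
        (map (\<lambda>l. (Cl P n)\<^sup>T
            * expect_mat P (usize P) (usize P)
                (\<lambda>\<omega>. (Sl P n (acks P t \<omega>))\<^sup>T * alpha P * Sl P l (acks P t \<omega>))
            * Cl P l)
          [1..<horizon P]))
       [1..<horizon P])"

definition calL :: "'a system \<Rightarrow> nat \<Rightarrow> real mat" where
  "calL P t = four_block_mat (Sigma_G P t) (Sigma_SGl P t) ((Sigma_SGl P t)\<^sup>T) (Sigma_Snl P t)"

definition calM :: "'a system \<Rightarrow> nat \<Rightarrow> real mat" where
  "calM P t = 2 \<cdot>\<^sub>m (append_cols (calQ P * calB P * mu_G P t) (calQ P * calB P * mu_Sl P t))\<^sup>T"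

definition Sigma_e' :: "'a system \<Rightarrow> nat \<Rightarrow> real mat" where
  "Sigma_e' P t = expect_mat P (xdim P * horizon P) (xdim P * (horizon P - 1))
     (\<lambda>\<omega>. outer (wvec P (noises P t \<omega>)) (evec P (noises P t \<omega>)))"

definition Sigma_W :: "'a system \<Rightarrow> nat \<Rightarrow> real mat" where
  "Sigma_W P t = expect_mat P (xdim P * horizon P) (xdim P * horizon P)
     (\<lambda>\<omega>. outer (wvec P (noises P t \<omega>)) (wvec P (noises P t \<omega>)))"

definition Sigma_e :: "'a system \<Rightarrow> nat \<Rightarrow> real mat" where
  "Sigma_e P t = expect_mat P (xdim P * (horizon P - 1)) (xdim P * (horizon P - 1))
     (\<lambda>\<omega>. outer (evec P (noises P t \<omega>)) (evec P (noises P t \<omega>)))"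

definition qp_quadratic :: "'a system \<Rightarrow> nat \<Rightarrow> real vec \<Rightarrow> decision \<Rightarrow> real" where
  "qp_quadratic P t v F =
     Xi P F \<bullet> (calL P t *\<^sub>v Xi P F)
   + (calM P t *\<^sub>v (calA P *\<^sub>v v)) \<bullet> Xi P F
   + (calA P *\<^sub>v v) \<bullet> (calQ P *\<^sub>v (calA P *\<^sub>v v))
   + 2 * tr_mat ((Theta F)\<^sup>T * (mu_S P t)\<^sup>T * (calB P)\<^sup>T * calQ P * calD P * Sigma_e' P t)
   + tr_mat ((calD P)\<^sup>T * calQ P * calD P * Sigma_W P t)
   + tr_mat ((Theta F)\<^sup>T * Sigma_S P t * Theta F * Sigma_e P t)"

definition qp_constraint :: "'a system \<Rightarrow> nat \<Rightarrow> decision \<Rightarrow> real" where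
  "qp_constraint P i F =
     \<bar>eta F $ i + 1/2 * (row (Lam F) i \<bullet> vec (horizon P - 1) (\<lambda>_. 1))\<bar>
     + 1/2 * l1 (row (Lam F) i) + l1 (row (Theta F) i) * phimax P"

definition dec_comb :: "real \<Rightarrow> decision \<Rightarrow> real \<Rightarrow> decision \<Rightarrow> decision" where
  "dec_comb a F b G = \<lparr>eta = a \<cdot>\<^sub>v eta F + b \<cdot>\<^sub>v eta G,
     Theta = a \<cdot>\<^sub>m Theta F + b \<cdot>\<^sub>m Theta G, Lam = a \<cdot>\<^sub>m Lam F + b \<cdot>\<^sub>m Lam G\<rparr>"

definition dec_convex_set :: "decision set \<Rightarrow> bool" where
  "dec_convex_set C \<longleftrightarrow> (\<forall>F\<in>C. \<forall>G\<in>C. \<forall>s. 0 \<le> s \<and> s \<le> 1 \<longrightarrow> dec_comb s F (1 - s) G \<in> C)"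

definition dec_convex_fun :: "decision set \<Rightarrow> (decision \<Rightarrow> real) \<Rightarrow> bool" where
  "dec_convex_fun D f \<longleftrightarrow> (\<forall>F\<in>D. \<forall>G\<in>D. \<forall>s. 0 \<le> s \<and> s \<le> 1 \<longrightarrow>
     f (dec_comb s F (1 - s) G) \<le> s * f F + (1 - s) * f G)"

definition dec_linear :: "decision set \<Rightarrow> (decision \<Rightarrow> real) \<Rightarrow> bool" where
  "dec_linear D f \<longleftrightarrow> (\<forall>F\<in>D. \<forall>G\<in>D. \<forall>a b. f (dec_comb a F b G) = a * f F + b * f G)"

definition dec_quadratic :: "decision set \<Rightarrow> (decision \<Rightarrow> real) \<Rightarrow> bool" where
  "dec_quadratic D f \<longleftrightarrow> (\<exists>b l c.
     (\<forall>G\<in>D. dec_linear D (\<lambda>F. b F G)) \<and> (\<forall>F\<in>D. dec_linear D (b F)) \<and> dec_linear D l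
     \<and> (\<forall>F\<in>D. f F = b F F + l F + c))"

definition dec_convex_pwl :: "decision set \<Rightarrow> (decision \<Rightarrow> real) \<Rightarrow> bool" where
  \<comment> \<open>pointwise maxima of finitely many affine functions\<close>
  "dec_convex_pwl D f \<longleftrightarrow> (\<exists>L. finite L \<and> L \<noteq> {} \<and> (\<forall>(l, c)\<in>L. dec_linear D l)
     \<and> (\<forall>F\<in>D. f F = Max ((\<lambda>(l, c). l F + c) ` L)))"

text \<open>Minimize \<open>q + r\<close> over the linear space \<open>D\<close> subject to constraints that bound each
  \<open>g i\<close> with \<open>i \<in> I\<close> from above by a constant. The term \<open>r\<close> allows for a piecewise linear
  regularizer in addition to the quadratic objective \<open>q\<close>.\<close>

definition convex_quadratic_program ::
  "decision set \<Rightarrow> (decision \<Rightarrow> real) \<Rightarrow> (decision \<Rightarrow> real) \<Rightarrow> 'i set \<Rightarrow> ('i \<Rightarrow> decision \<Rightarrow> real) \<Rightarrow> bool"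
  where
  "convex_quadratic_program D q r I g \<longleftrightarrow>
     D \<noteq> {} \<and> (\<forall>F\<in>D. \<forall>G\<in>D. \<forall>a b. dec_comb a F b G \<in> D)
   \<and> dec_quadratic D q \<and> dec_convex_fun D q \<and> dec_convex_pwl D r
   \<and> finite I \<and> (\<forall>i\<in>I. dec_convex_pwl D (g i))"

end

theory Submission
  imports Defs
begin

text \<open>
Over one horizon the applied input is \<open>h + s\<close>, where \<open>h = \<G> \<eta> + \<S> \<Lambda> \<nu>\<close> depends on the channel only and
\<open>s = \<S> \<Theta> \<ee>(w)\<close> is linear in the saturated noise, with a coefficient that depends on the channel.
Expanding the cost accordingly (\<open>cost_split\<close>) leaves terms of three kinds.

Terms with a single factor \<open>w\<close> or \<open>\<ee>(w)\<close> have expectation zero (\<open>noise_form_mean_zero\<close>): both vectors are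
independent of the channel, the noise has mean zero, and so has the saturated noise because an odd
function of a symmetric vector has mean zero (\<open>evec_mean\<close>). Terms with two such factors are forms
\<open>y \<bullet> X z\<close> whose matrix is independent of \<open>y\<close> and \<open>z\<close>; their expectations are the traces in the program
(\<open>noise_form_trace\<close>). The remaining terms contain \<open>h\<close> only. As \<open>\<Lambda> \<nu>\<close> is the sum of the columns of \<open>\<Lambda>\<close>
weighted with channel values, \<open>h\<close> is linear in \<open>\<Xi>\<close>, and the expectations of its form and of its cross
term with the state are \<open>\<langle>\<Xi>, \<L> \<Xi>\<rangle>\<close> and \<open>\<langle>\<M> \<A> x, \<Xi>\<rangle>\<close> (\<open>ack_part_form_mean\<close>, \<open>ack_part_linear_mean\<close>).
Together this is \<open>expected_cost\<close> for a fixed state and a fixed decision.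

The objective is a conditional expectation given the state \<open>x\<^sub>t\<close>. Block \<open>l\<close> of an input refers only to
what has happened before step \<open>l\<close>, with the exception of the channel at step \<open>l\<close> itself, because \<open>\<Theta>\<close> and \<open>\<Lambda>\<close>
are strictly lower triangular. Hence \<open>x\<^sub>t\<close> is a function of noise and channel before \<open>t\<close>
(\<open>state_measurable\<close>) and independent of everything else that enters the cost of the horizon. The cost is a
finite sum of products \<open>a\<^sub>k(x\<^sub>t) b\<^sub>k\<close> with \<open>b\<^sub>k\<close> integrable and independent of \<open>x\<^sub>t\<close>, so that the state can be
held fixed (\<open>cond_exp_freeze\<close>, \<open>conditional_cost\<close>). The coefficients \<open>a\<^sub>k(x\<^sub>t)\<close> contain an arbitrary
measurable decision rule and need not be integrable; the argument is therefore carried out on the events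
where they are bounded, which exhaust the space.

For fixed channel and noise the cost is a nonnegative quadratic form in quantities that are affine in the
decision. It is convex, and its expectation, the quadratic objective of the program, is convex as well
(\<open>qp_quadratic_convex\<close>); the regularizer is a sum of maxima of linear functions.

The hard constraint on a row of the input is a maximum over signs. If the transmission of the block
succeeds, the row is an affine function of the earlier channel values, which are \<open>1/2 \<plusminus> 1/2\<close>, and of the
saturated noise, which ranges over a box; the maximal modulus is the left-hand side of the constraint of
the program (\<open>feasible_set_eq\<close>). If the transmission fails, the modulus is not larger.
\<close>

section \<open>The plant input by components\<close>

text \<open>The lengths of the stacked state, noise and saturated noise vectors are definitions, so that the
  simplifier does not multiply them out.\<close>

definition "xsize P = xdim P * (horizon P + 1)"
definition "wsize P = xdim P * horizon P"
definition "esize P = xdim P * (horizon P - 1)"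

lemma linf_nonneg: "0 \<le> linf v"
  unfolding linf_def by (rule Max_ge) auto

lemma linf_le_iff: "0 \<le> c \<Longrightarrow> linf v \<le> c \<longleftrightarrow> (\<forall>i<dim_vec v. \<bar>v $ i\<bar> \<le> c)"
  unfolding linf_def by (subst Max_le_iff) auto

text \<open>A packet with the offsets has arrived by step \<open>l\<close> unless all transmissions up to \<open>l\<close> failed.\<close>

lemma received_eq: "received n l = 1 - (\<Prod>s<Suc l. 1 - n s)"
proof (induction l)
  case 0 show ?case by simp
next
  case (Suc l) 
  have "received n (Suc l) = 1 - (\<Prod>s<Suc l. 1 - n s) * (1 - n (Suc l))"
    using Suc by (simp only: received.simps) (simp add: algebra_simps)
  then show ?case by (simp only: prod.lessThan_Suc[of _ "Suc l"])
qed

text \<open>For a row index \<open>i\<close> the block number is \<open>i div udim P\<close>. The two gains are the factors with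
  which the row of the offset and the row of the feedback term reach the plant; they are the diagonals
  of \<open>\<G>\<close> and \<open>\<S>\<close>.\<close>

definition offset_gain :: "'a system \<Rightarrow> (nat \<Rightarrow> real) \<Rightarrow> nat \<Rightarrow> real" where
  "offset_gain P n i = (if i div udim P < recalc P then received n (i div udim P) else 1)"

definition feedback_gain :: "'a system \<Rightarrow> (nat \<Rightarrow> real) \<Rightarrow> nat \<Rightarrow> real" where
  "feedback_gain P n i = (if i div udim P < recalc P then n (i div udim P) else 1)"

lemma prod_complement_01: "(\<And>s. s < (k :: nat) \<Longrightarrow> n s \<in> {0, 1}) \<Longrightarrow> (\<Prod>s<k. 1 - n s) \<in> {0, 1 :: real}"
  by (induction k) (fastforce simp: less_Suc_eq)+

lemma block_index_less:
  assumes "l < horizon P" "j < udim P" shows "l * udim P + j < usize P"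
proof -
  have "l * udim P + j < Suc l * udim P" using assms(2) by simp
  also have "\<dots> \<le> usize P" using assms(1) by (metis Suc_leI mult.commute mult_le_mono1)
  finally show ?thesis .
qed

definition diagonal :: "nat \<Rightarrow> (nat \<Rightarrow> real) \<Rightarrow> real mat" where
  "diagonal k f = mat k k (\<lambda>(i, j). if i = j then f i else 0)"

lemma diagonal_carrier [simp]: "diagonal k f \<in> carrier_mat k k"
  by (simp add: diagonal_def)

lemma diagonal_mult_vec:
  assumes "v \<in> carrier_vec k" "i < k"
  shows "(diagonal k f *\<^sub>v v) $ i = f i * v $ i"
proof -
  have "(diagonal k f *\<^sub>v v) $ i = (\<Sum>j\<in>{0..<k}. if i = j then f i * v $ i else 0)"
    using assms by (simp add: diagonal_def scalar_prod_def del: sum.delta sum.delta') (rule sum.cong, auto)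
  also have "\<dots> = f i * v $ i" using assms by simp
  finally show ?thesis .
qed

lemma diagonal_dim [simp]: "dim_row (diagonal k f) = k" "dim_col (diagonal k f) = k"
  by (simp_all add: diagonal_def)

lemma Gmat_diagonal: 
  assumes "0 < udim P"
  shows "Gmat P n = diagonal (usize P) (offset_gain P n)"
proof (rule eq_matI)
  fix i j assume "i < dim_row (diagonal (usize P) (offset_gain P n))" "j < dim_col (diagonal (usize P) (offset_gain P n))"
  then have *: "i < horizon P * udim P" "j < horizon P * udim P" by (simp_all add: diagonal_def mult.commute)
  have "i = j \<longleftrightarrow> i div udim P = j div udim P \<and> i mod udim P = j mod udim P"
    by (metis div_mult_mod_eq)
  with * assms show "Gmat P n $$ (i, j) = diagonal (usize P) (offset_gain P n) $$ (i, j)"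
    by (auto simp: Gmat_def block_mat_def diagonal_def offset_gain_def mult.commute)
qed (auto simp: Gmat_def block_mat_def diagonal_def)

lemma diag_block_scalars: 
  assumes "0 < m"
  shows "diag_block_mat (map (\<lambda>l. c l \<cdot>\<^sub>m 1\<^sub>m m) [0..<k]) = diagonal (m * k) (\<lambda>i. c (i div m))"
proof (induction k)
  case 0 show ?case by (rule eq_matI) auto
next
  case (Suc k)
  have *: "i div m = k" if "\<not> i < m * k" "i < m + m * k" for i 
    using that assms by (intro div_nat_eqI) (auto simp: algebra_simps)
  have "diag_block_mat (map (\<lambda>l. c l \<cdot>\<^sub>m 1\<^sub>m m) [0..<Suc k])
      = four_block_mat (diagonal (m * k) (\<lambda>i. c (i div m))) (0\<^sub>m (m * k) m) (0\<^sub>m m (m * k)) (c k \<cdot>\<^sub>m 1\<^sub>m m)"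
    by (simp only: upt_Suc_append[OF le0] map_append list.map diag_block_mat_last Suc) 
       (simp add: diagonal_def)
  also have "\<dots> = diagonal (m * Suc k) (\<lambda>i. c (i div m))"
    by (rule eq_matI) (auto simp: diagonal_def *)
  finally show ?case .
qed

lemma Smat_diagonal: 
  assumes "0 < udim P" "recalc P \<le> horizon P"
  shows "Smat P n = diagonal (usize P) (feedback_gain P n)"
proof -
  let ?m = "udim P" let ?k = "recalc P" let ?r = "udim P * (horizon P - recalc P)"
  have u: "usize P = ?m * ?k + ?r" using assms by (simp add: algebra_simps flip: distrib_left)
  have *: "i div ?m < ?k \<longleftrightarrow> i < ?m * ?k" for i 
    using assms by (simp add: div_less_iff_less_mult mult.commute)
  have "Smat P n = four_block_mat (diagonal (?m * ?k) (\<lambda>i. n (i div ?m))) (0\<^sub>m (?m * ?k) ?r) (0\<^sub>m ?r (?m * ?k)) (1\<^sub>m ?r)"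
    unfolding Smat_def diag_block_mat_last diag_block_scalars[OF assms(1)] by (simp add: diagonal_def)
  also have "\<dots> = diagonal (?m * ?k + ?r) (feedback_gain P n)"
    by (rule eq_matI) (auto simp: diagonal_def feedback_gain_def *)
  finally show ?thesis by (simp only: u)
qed

lemma policy_classD:
  assumes "F \<in> policy_class P"
  shows "eta F \<in> carrier_vec (usize P)"
    "Theta F \<in> carrier_mat (usize P) (esize P)"
    "Lam F \<in> carrier_mat (usize P) (horizon P - 1)"
  using assms by (auto simp: policy_class_def esize_def)

lemma applied_index:
  assumes F: "F \<in> policy_class P" and P: "recalc P \<le> horizon P" "0 < udim P" 
    and \<xi>: "\<xi> \<in> carrier_vec (esize P)" and i: "i < usize P"
  shows "applied P F n \<xi> $ i = offset_gain P n i * eta F $ i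
    + feedback_gain P n i * ((\<Sum>c<esize P. Theta F $$ (i, c) * \<xi> $ c)
                    + (\<Sum>c<horizon P - 1. Lam F $$ (i, c) * n c))"
proof -
  note c = policy_classD[OF F]
  have "applied P F n \<xi> $ i = offset_gain P n i * eta F $ i + feedback_gain P n i * ((Theta F *\<^sub>v \<xi> + Lam F *\<^sub>v vec (horizon P - 1) n) $ i)"
    unfolding applied_def Gmat_diagonal[OF P(2)] Smat_diagonal[OF P(2,1)]
    using c i \<xi> by (subst index_add_vec) (auto simp: diagonal_mult_vec simp del: index_mult_mat_vec)
  also have "(Theta F *\<^sub>v \<xi> + Lam F *\<^sub>v vec (horizon P - 1) n) $ i = (Theta F *\<^sub>v \<xi>) $ i + (Lam F *\<^sub>v vec (horizon P - 1) n) $ i"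
    using c i by (intro index_add_vec) auto
  also have "\<dots> = (\<Sum>c<esize P. Theta F $$ (i, c) * \<xi> $ c)
                    + (\<Sum>c<horizon P - 1. Lam F $$ (i, c) * n c)"
    using c i \<xi> by (auto simp: scalar_prod_def lessThan_atLeast0)
  finally show ?thesis .
qed

text \<open>Block \<open>l\<close> of the input refers to the noise before step \<open>l\<close> and to the channel up to step
  \<open>l\<close> only, because the feedback matrices are strictly lower triangular.\<close>

lemma applied_causal_index:
  assumes F: "F \<in> policy_class P" and P: "recalc P \<le> horizon P" "0 < udim P" 
    and \<xi>: "\<xi> \<in> carrier_vec (esize P)" and i: "i < usize P"
  shows "applied P F n \<xi> $ i = offset_gain P n i * eta F $ i
    + feedback_gain P n i * ((\<Sum>c | c < esize P \<and> c div xdim P < i div udim P. Theta F $$ (i, c) * \<xi> $ c)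
                    + (\<Sum>c | c < horizon P - 1 \<and> c < i div udim P. Lam F $$ (i, c) * n c))"
proof -
  have "Theta F $$ (i, c) = 0" if "c < esize P" "\<not> c div xdim P < i div udim P" for c
    using F i that by (auto simp: policy_class_def esize_def)
  moreover have "Lam F $$ (i, c) = 0" if "c < horizon P - 1" "\<not> c < i div udim P" for c
    using F i that by (auto simp: policy_class_def)
  ultimately show ?thesis unfolding applied_index[OF assms]
    by (intro arg_cong2[where f="(+)"] arg_cong2[where f="(*)"] refl sum.mono_neutral_right) auto
qed

lemma vblock_index: "i < m \<Longrightarrow> vblock m v l $ i = v $ (l * m + i)" "dim_vec (vblock m v l) = m"
  by (simp_all add: vblock_def)

section \<open>Convex piecewise linear functions\<close>

lemma dec_linear_zero: "dec_linear D (\<lambda>_. 0)" by (simp add: dec_linear_def)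

lemma dec_linear_add: "dec_linear D f \<Longrightarrow> dec_linear D g \<Longrightarrow> dec_linear D (\<lambda>F. f F + g F)"
  by (simp add: dec_linear_def algebra_simps)

lemma dec_linear_cmult: "dec_linear D f \<Longrightarrow> dec_linear D (\<lambda>F. k * f F)"
  by (simp add: dec_linear_def algebra_simps)

lemma dec_linear_sum: "(\<And>i. i \<in> A \<Longrightarrow> dec_linear D (f i)) \<Longrightarrow> dec_linear D (\<lambda>F. \<Sum>i\<in>A. f i F)"
  by (induction A rule: infinite_finite_induct) (auto intro: dec_linear_zero dec_linear_add)

definition dec_affine :: "decision set \<Rightarrow> (decision \<Rightarrow> real) \<Rightarrow> bool" where
  "dec_affine D g \<longleftrightarrow> (\<exists>l c. dec_linear D l \<and> g = (\<lambda>F. l F + c))"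

lemma dec_affine_add: "dec_affine D f \<Longrightarrow> dec_affine D g \<Longrightarrow> dec_affine D (\<lambda>F. f F + g F)"
  unfolding dec_affine_def
proof (elim exE conjE)
  fix l c l' c' assume "dec_linear D l" "f = (\<lambda>F. l F + c)" "dec_linear D l'" "g = (\<lambda>F. l' F + c')"
  then show "\<exists>l c. dec_linear D l \<and> (\<lambda>F. f F + g F) = (\<lambda>F. l F + c)"
    by (intro exI[of _ "\<lambda>F. l F + l' F"] exI[of _ "c + c'"]) (auto intro: dec_linear_add)
qed

lemma dec_affine_cmult: "dec_affine D f \<Longrightarrow> dec_affine D (\<lambda>F. k * f F)"
  unfolding dec_affine_def
proof (elim exE conjE)
  fix l c assume "dec_linear D l" "f = (\<lambda>F. l F + c)"
  then show "\<exists>l c. dec_linear D l \<and> (\<lambda>F. k * f F) = (\<lambda>F. l F + c)"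
    by (intro exI[of _ "\<lambda>F. k * l F"] exI[of _ "k * c"]) (auto intro: dec_linear_cmult simp: distrib_left)
qed

text \<open>A maximum of affine functions is more convenient as a set of affine minorants, one of which is
  attained at each decision.\<close>

lemma dec_convex_pwl_iff:
  "dec_convex_pwl D f \<longleftrightarrow> (\<exists>A. finite A \<and> A \<noteq> {} \<and> (\<forall>g\<in>A. dec_affine D g)
     \<and> (\<forall>F\<in>D. (\<forall>g\<in>A. g F \<le> f F) \<and> (\<exists>g\<in>A. f F = g F)))" (is "_ \<longleftrightarrow> ?R")
proof
  assume "dec_convex_pwl D f"
  then obtain L where L: "finite L" "L \<noteq> {}" "\<forall>(l, c)\<in>L. dec_linear D l" "\<forall>F\<in>D. f F = Max ((\<lambda>(l, c). l F + c) ` L)"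
    unfolding dec_convex_pwl_def by metis
  let ?A = "(\<lambda>(l, c) F. l F + c) ` L"
  have eq: "(\<lambda>(l, c). l F + c) ` L = (\<lambda>g. g F) ` ?A" for F by (force simp: image_image)
  have fin: "finite ((\<lambda>g. g F) ` ?A)" "(\<lambda>g. g F) ` ?A \<noteq> {}" for F using L(1,2) by auto
  have "\<forall>F\<in>D. (\<forall>g\<in>?A. g F \<le> f F) \<and> (\<exists>g\<in>?A. f F = g F)"
  proof (intro ballI conjI)
    fix F assume "F \<in> D"
    then have m: "f F = Max ((\<lambda>g. g F) ` ?A)" using L(4) by (simp only: eq[symmetric])
    show "g F \<le> f F" if "g \<in> ?A" for g
      unfolding m by (rule Max_ge[OF fin(1) imageI[OF that]])
    show "\<exists>g\<in>?A. f F = g F" using Max_in[OF fin, of F] unfolding m[symmetric] by (elim imageE) blast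
  qed
  moreover have "\<forall>g\<in>?A. dec_affine D g" using L(3) by (fastforce simp: dec_affine_def)
  ultimately show ?R using L(1,2) by (intro exI[of _ ?A]) auto
next
  assume ?R
  then obtain A where A: "finite A" "A \<noteq> {}" "\<forall>g\<in>A. dec_affine D g" "\<forall>F\<in>D. (\<forall>g\<in>A. g F \<le> f F) \<and> (\<exists>g\<in>A. f F = g F)"
    by blast
  from A(3) obtain l c where lc: "\<And>g. g \<in> A \<Longrightarrow> dec_linear D (l g)" "\<And>g F. g \<in> A \<Longrightarrow> l g F + c g = g F"
    unfolding dec_affine_def by metis
  have "f F = Max ((\<lambda>(l, c). l F + c) ` (\<lambda>g. (l g, c g)) ` A)" if "F \<in> D" for F
  proof (rule Max_eqI[symmetric])
    obtain g where "g \<in> A" "f F = g F" using A(4) \<open>F \<in> D\<close> by blast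
    with lc(2)[of g F] show "f F \<in> (\<lambda>(l, c). l F + c) ` (\<lambda>g. (l g, c g)) ` A"
      by (intro image_eqI[of _ _ "(l g, c g)"]) simp_all
    fix y assume "y \<in> (\<lambda>(l, c). l F + c) ` (\<lambda>g. (l g, c g)) ` A"
    then obtain g where "g \<in> A" "y = g F" using lc(2) by fastforce
    then show "y \<le> f F" using A(4) \<open>F \<in> D\<close> by blast
  qed (use A(1) in simp)
  then show "dec_convex_pwl D f"
    unfolding dec_convex_pwl_def using A(1,2) lc(1) by (intro exI[of _ "(\<lambda>g. (l g, c g)) ` A"]) auto
qed

lemma dec_convex_pwl_linear: "dec_linear D l \<Longrightarrow> dec_convex_pwl D l"
  unfolding dec_convex_pwl_def by (intro exI[of _ "{(l, 0)}"]) auto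

lemma dec_convex_pwl_add:
  assumes "dec_convex_pwl D f" "dec_convex_pwl D g"
  shows "dec_convex_pwl D (\<lambda>F. f F + g F)"
proof -
  obtain A B where A: "finite A" "A \<noteq> {}" "\<forall>a\<in>A. dec_affine D a" "\<forall>F\<in>D. (\<forall>a\<in>A. a F \<le> f F) \<and> (\<exists>a\<in>A. f F = a F)"
    and B: "finite B" "B \<noteq> {}" "\<forall>b\<in>B. dec_affine D b" "\<forall>F\<in>D. (\<forall>b\<in>B. b F \<le> g F) \<and> (\<exists>b\<in>B. g F = b F)"
    using assms unfolding dec_convex_pwl_iff by blast
  show ?thesis unfolding dec_convex_pwl_iff
  proof (intro exI[of _ "(\<lambda>(a, b) F. a F + b F) ` (A \<times> B)"] conjI ballI)
    fix F assume F: "F \<in> D"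
    show "h F \<le> f F + g F" if "h \<in> (\<lambda>(a, b) F. a F + b F) ` (A \<times> B)" for h
      using A(4) B(4) F that by (auto intro: add_mono)
    show "\<exists>h\<in>(\<lambda>(a, b) F. a F + b F) ` (A \<times> B). f F + g F = h F"
      using A(4) B(4) F by fastforce
  qed (use A(1-3) B(1-3) in \<open>auto intro: dec_affine_add\<close>)
qed

lemma dec_convex_pwl_cmult:
  assumes "dec_convex_pwl D f" "0 \<le> a"
  shows "dec_convex_pwl D (\<lambda>F. a * f F)"
proof -
  obtain A where A: "finite A" "A \<noteq> {}" "\<forall>g\<in>A. dec_affine D g" "\<forall>F\<in>D. (\<forall>g\<in>A. g F \<le> f F) \<and> (\<exists>g\<in>A. f F = g F)"
    using assms unfolding dec_convex_pwl_iff by blast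
  show ?thesis unfolding dec_convex_pwl_iff
    by (intro exI[of _ "(\<lambda>g F. a * g F) ` A"])
      (use A assms(2) in \<open>auto intro: dec_affine_cmult mult_left_mono\<close>)
qed

lemma dec_convex_pwl_max:
  assumes "dec_convex_pwl D f" "dec_convex_pwl D g"
  shows "dec_convex_pwl D (\<lambda>F. max (f F) (g F))"
proof -
  obtain A B where A: "finite A" "A \<noteq> {}" "\<forall>a\<in>A. dec_affine D a" "\<forall>F\<in>D. (\<forall>a\<in>A. a F \<le> f F) \<and> (\<exists>a\<in>A. f F = a F)"
    and B: "finite B" "B \<noteq> {}" "\<forall>b\<in>B. dec_affine D b" "\<forall>F\<in>D. (\<forall>b\<in>B. b F \<le> g F) \<and> (\<exists>b\<in>B. g F = b F)"
    using assms unfolding dec_convex_pwl_iff by blast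
  have "\<exists>h\<in>A \<union> B. max (f F) (g F) = h F" if "F \<in> D" for F
    using A(4) B(4) that unfolding max_def by (cases "f F \<le> g F") auto
  then show ?thesis unfolding dec_convex_pwl_iff
    by (intro exI[of _ "A \<union> B"]) (use A B in \<open>auto simp: le_max_iff_disj\<close>)
qed

lemma dec_convex_pwl_abs:
  assumes "dec_linear D l" shows "dec_convex_pwl D (\<lambda>F. \<bar>l F\<bar>)"
proof -
  have "(\<lambda>F. \<bar>l F\<bar>) = (\<lambda>F. max (l F) (- 1 * l F))" by (auto simp: abs_if max_def)
  then show ?thesis
    using dec_convex_pwl_max[OF dec_convex_pwl_linear[OF assms] dec_convex_pwl_linear[OF dec_linear_cmult[OF assms, of "- 1"]]]
    by simp
qed

lemma dec_convex_pwl_sum: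
  "(\<And>i. i \<in> A \<Longrightarrow> dec_convex_pwl D (f i)) \<Longrightarrow> dec_convex_pwl D (\<lambda>F. \<Sum>i\<in>A. f i F)"
  by (induction A rule: infinite_finite_induct)
    (auto intro: dec_convex_pwl_add dec_convex_pwl_linear[OF dec_linear_zero])

lemma dec_convex_pwl_cong:
  "dec_convex_pwl D f \<Longrightarrow> (\<And>F. F \<in> D \<Longrightarrow> f F = g F) \<Longrightarrow> dec_convex_pwl D g"
  unfolding dec_convex_pwl_def by auto

text \<open>By induction on the length of the vector; the maximum over no entries is the default value 0.\<close>

lemma dec_convex_pwl_linf:
  assumes dim: "\<And>F. F \<in> D \<Longrightarrow> dim_vec (v F) = k"
    and lin: "\<And>j. j < k \<Longrightarrow> dec_linear D (\<lambda>F. v F $ j)"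
  shows "dec_convex_pwl D (\<lambda>F. linf (v F))"
proof -
  have "dec_convex_pwl D (\<lambda>F. Max (insert 0 ((\<lambda>j. \<bar>v F $ j\<bar>) ` {..<r})))" if "r \<le> k" for r
    using that
  proof (induction r)
    case 0 show ?case by (simp add: dec_convex_pwl_linear[OF dec_linear_zero])
  next
    case (Suc r)
    have "Max (insert 0 ((\<lambda>j. \<bar>v F $ j\<bar>) ` {..<Suc r})) =
        max (\<bar>v F $ r\<bar>) (Max (insert 0 ((\<lambda>j. \<bar>v F $ j\<bar>) ` {..<r})))" for F
      by (simp add: lessThan_Suc insert_commute[of 0])
    with Suc show ?case by (simp only:) (intro dec_convex_pwl_max dec_convex_pwl_abs lin, auto)
  qed
  from this[of k] show ?thesis
    by (rule dec_convex_pwl_cong) (auto simp: linf_def dim)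
qed

lemma dec_convex_pwl_convex:
  assumes f: "dec_convex_pwl D f" and D: "\<And>F G a b. F \<in> D \<Longrightarrow> G \<in> D \<Longrightarrow> dec_comb a F b G \<in> D"
  shows "dec_convex_fun D f"
  unfolding dec_convex_fun_def
proof (intro ballI allI impI)
  fix F G and s :: real assume F: "F \<in> D" and G: "G \<in> D" and s: "0 \<le> s \<and> s \<le> 1"
  let ?H = "dec_comb s F (1 - s) G"
  obtain A where A: "\<forall>g\<in>A. dec_affine D g" "\<forall>F\<in>D. (\<forall>g\<in>A. g F \<le> f F) \<and> (\<exists>g\<in>A. f F = g F)"
    using f unfolding dec_convex_pwl_iff by blast
  then obtain g where g: "g \<in> A" "f ?H = g ?H" using D[OF F G] by blast
  then obtain l c where lc: "dec_linear D l" "g = (\<lambda>F. l F + c)" using A(1) by (auto simp: dec_affine_def)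
  have "f ?H = s * g F + (1 - s) * g G"
    using g(2) lc F G by (simp add: dec_linear_def algebra_simps)
  also have "\<dots> \<le> s * f F + (1 - s) * f G"
    using A(2) F G g(1) s by (intro add_mono mult_left_mono) auto
  finally show "f ?H \<le> s * f F + (1 - s) * f G" .
qed

section \<open>Constraints and regularizer\<close>

lemma policy_class_comb:
  assumes "F \<in> policy_class P" "G \<in> policy_class P"
  shows "dec_comb a F b G \<in> policy_class P"
  using assms by (auto simp: policy_class_def dec_comb_def)

lemma zero_policy: "\<lparr>eta = 0\<^sub>v (usize P), Theta = 0\<^sub>m (usize P) (esize P), Lam = 0\<^sub>m (usize P) (horizon P - 1)\<rparr> \<in> policy_class P"
  by (auto simp: policy_class_def esize_def)

lemma dec_linear_eta: "i < usize P \<Longrightarrow> dec_linear (policy_class P) (\<lambda>F. eta F $ i)"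
  by (auto simp: dec_linear_def dec_comb_def policy_class_def esize_def)

lemma dec_linear_Theta:
  "i < usize P \<Longrightarrow> j < esize P \<Longrightarrow> dec_linear (policy_class P) (\<lambda>F. Theta F $$ (i, j))"
  by (auto simp: dec_linear_def dec_comb_def policy_class_def esize_def)

lemma dec_linear_Lam:
  "i < usize P \<Longrightarrow> j < horizon P - 1 \<Longrightarrow> dec_linear (policy_class P) (\<lambda>F. Lam F $$ (i, j))"
  by (auto simp: dec_linear_def dec_comb_def policy_class_def esize_def)

text \<open>The form of the constraint in terms of matrix entries, in which it is compared with \<open>applied_index\<close>.\<close>

lemma qp_constraint_eq:
  assumes F: "F \<in> policy_class P" and i: "i < usize P"
  shows "qp_constraint P i F = \<bar>eta F $ i + 1/2 * (\<Sum>c<horizon P - 1. Lam F $$ (i, c))\<bar>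
    + 1/2 * (\<Sum>c<horizon P - 1. \<bar>Lam F $$ (i, c)\<bar>)
    + phimax P * (\<Sum>c<esize P. \<bar>Theta F $$ (i, c)\<bar>)"
  using policy_classD[OF F] i
  by (auto simp: qp_constraint_def l1_def scalar_prod_def lessThan_atLeast0)

lemma qp_constraint_pwl:
  assumes "i < usize P" "0 \<le> phimax P"
  shows "dec_convex_pwl (policy_class P) (qp_constraint P i)"
proof (rule dec_convex_pwl_cong)
  show "dec_convex_pwl (policy_class P) (\<lambda>F. \<bar>eta F $ i + 1/2 * (\<Sum>c<horizon P - 1. Lam F $$ (i, c))\<bar>
    + 1/2 * (\<Sum>c<horizon P - 1. \<bar>Lam F $$ (i, c)\<bar>)
    + phimax P * (\<Sum>c<esize P. \<bar>Theta F $$ (i, c)\<bar>))"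
    using assms by (intro dec_convex_pwl_add dec_convex_pwl_cmult dec_convex_pwl_abs dec_linear_add
        dec_linear_eta dec_convex_pwl_sum dec_linear_cmult dec_linear_sum dec_linear_Lam dec_linear_Theta) auto
qed (simp add: qp_constraint_eq assms)

text \<open>Each entry of the rearranged matrix is an entry of \<open>\<eta>\<close>, \<open>\<Theta>\<close> or \<open>\<Lambda>\<close> at a position that does not
  depend on the decision.\<close>

lemma regularizer_pwl:
  assumes "0 < udim P" "0 \<le> a"
  shows "dec_convex_pwl (policy_class P) (\<lambda>F. a * regularizer P F)"
proof -
  let ?m = "udim P" let ?N = "horizon P" let ?D = "policy_class P"
  let ?q = "esize P"
  let ?X = "\<lambda>F. hcat (?m * ?N) [mat_of_cols (?m * ?N) [eta F], Theta F, Lam F]"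
  have X: "?X F \<in> carrier_mat (?m * ?N) (1 + ?q + (?N - 1))" if "F \<in> ?D" for F
    using policy_classD[OF that] by (auto simp: hcat_def append_cols_def)
  have lin: "dec_linear ?D (\<lambda>F. ?X F $$ (r, c))" if "r < ?m * ?N" "c < 1 + ?q + (?N - 1)" for r c
  proof -
    have "?X F $$ (r, c) = (if c < 1 then eta F $ r else if c < 1 + ?q then Theta F $$ (r, c - 1)
        else Lam F $$ (r, c - 1 - ?q))" if F: "F \<in> ?D" for F
    proof -
      have "c - 1 - ?q < ?N - 1" if "\<not> c < 1 + ?q" using \<open>c < 1 + ?q + _\<close> that by linarith
      then show ?thesis using policy_classD[OF F] \<open>r < _\<close> \<open>c < _\<close>
      by (auto simp: hcat_def append_cols_def mat_of_cols_def not_less)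
    qed
    moreover have "dec_linear ?D (\<lambda>F. if c < 1 then eta F $ r else if c < 1 + ?q then Theta F $$ (r, c - 1)
        else Lam F $$ (r, c - 1 - ?q))"
    proof (cases "c < 1 + ?q")
      case True
      then show ?thesis using that by (cases "c = 0") (simp_all add: dec_linear_eta dec_linear_Theta)
    next
      case False
      then have "c - 1 - ?q < ?N - 1" using that by linarith
      with False show ?thesis using dec_linear_Lam[OF that(1)] by simp
    qed
    ultimately show ?thesis by (simp add: dec_linear_def policy_class_comb)
  qed
  have "dec_convex_pwl ?D (\<lambda>F. linf (row (Fhat P F) i))" if i: "i < ?N" for i
  proof (rule dec_convex_pwl_linf)
    fix F assume "F \<in> ?D"
    from X[OF this] show "dim_vec (row (Fhat P F) i) = ?m * (1 + ?q + (?N - 1))"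
      by (simp add: Fhat_def Let_def)
  next
    fix j assume j: "j < ?m * (1 + ?q + (?N - 1))"
    have r: "i * ?m + j mod ?m < ?m * ?N" using block_index_less[OF i, of "j mod ?m"] assms(1) by simp
    have c: "j div ?m < 1 + ?q + (?N - 1)" using j assms(1) by (metis div_less_iff_less_mult mult.commute)
    have "row (Fhat P F) i $ j = ?X F $$ (i * ?m + j mod ?m, j div ?m)" if "F \<in> ?D" for F
      using X[OF that] j i by (simp add: Fhat_def Let_def)
    with lin[OF r c] show "dec_linear ?D (\<lambda>F. row (Fhat P F) i $ j)"
      by (simp add: dec_linear_def policy_class_comb)
  qed
  then show ?thesis unfolding regularizer_def
    using assms(2) by (intro dec_convex_pwl_cmult dec_convex_pwl_sum) auto
qed

text \<open>Consider row \<open>i\<close> of the input. If the transmission of its own block fails, only the offset or nothing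
  is applied, and the offset alone is bounded by the left-hand side of the constraint. If it succeeds,
  or if the block lies beyond the recalculation interval, both gains are 1, and the row equals
  \<open>\<eta>\<^sub>i + 1/2 \<Sum>\<^sub>c \<Lambda>\<^sub>i\<^sub>c + \<Sum>\<^sub>c \<Lambda>\<^sub>i\<^sub>c (\<nu>\<^sub>c - 1/2) + \<Sum>\<^sub>c \<Theta>\<^sub>i\<^sub>c \<xi>\<^sub>c\<close>. The factors \<open>\<nu>\<^sub>c - 1/2\<close> and \<open>\<xi>\<^sub>c\<close> range
  independently over \<open>{-1/2, 1/2}\<close> and \<open>[-\<phi>, \<phi>]\<close>, so that the largest modulus is the left-hand side of
  the constraint.\<close>

lemma feasible_set_eq:
  assumes P: "recalc P \<le> horizon P" "0 < udim P" "0 < Umax P" "0 \<le> phimax P"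
  shows "feasible_set P
       = {F \<in> policy_class P. \<forall>i\<in>{..<usize P}. qp_constraint P i F \<le> Umax P}"
    (is "_ = ?R")
proof (intro subset_antisym subsetI)
  fix F assume F: "F \<in> ?R"
  then have FP: "F \<in> policy_class P" by simp
  have bound: "\<bar>applied P F n \<xi> $ i\<bar> \<le> Umax P"
    if n: "\<forall>l<horizon P. n l \<in> {0, 1}" and \<xi>: "\<xi> \<in> carrier_vec (esize P)"
      and lin: "linf \<xi> \<le> phimax P" and i: "i < usize P" for n \<xi> i
  proof -
    have l: "i div udim P < horizon P" using i P(2) by (simp add: div_less_iff_less_mult mult.commute)
    let ?A = "\<Sum>c<esize P. Theta F $$ (i, c) * \<xi> $ c"
    let ?B = "\<Sum>c<horizon P - 1. Lam F $$ (i, c) * n c"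
    let ?L = "\<Sum>c<horizon P - 1. Lam F $$ (i, c)"
    let ?La = "\<Sum>c<horizon P - 1. \<bar>Lam F $$ (i, c)\<bar>"
    let ?Ta = "\<Sum>c<esize P. \<bar>Theta F $$ (i, c)\<bar>"
    have "\<bar>\<xi> $ c\<bar> \<le> phimax P" if "c < esize P" for c
      using lin \<xi> that P(4) by (auto simp: linf_le_iff)
    then have A: "\<bar>?A\<bar> \<le> phimax P * ?Ta"
      by (subst sum_distrib_left, intro order.trans[OF sum_abs] sum_mono)
         (auto simp: abs_mult mult.commute intro: mult_right_mono)
    have "?B - 1/2 * ?L = (\<Sum>c<horizon P - 1. Lam F $$ (i, c) * (n c - 1/2))"
      by (simp add: sum_subtractf sum_distrib_left algebra_simps)
    also have "\<bar>\<dots>\<bar> \<le> (\<Sum>c<horizon P - 1. 1/2 * \<bar>Lam F $$ (i, c)\<bar>)"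
    proof (intro order.trans[OF sum_abs] sum_mono)
      fix c assume "c \<in> {..<horizon P - 1}"
      then have "n c \<in> {0, 1}" using n by auto
      then show "\<bar>Lam F $$ (i, c) * (n c - 1/2)\<bar> \<le> 1/2 * \<bar>Lam F $$ (i, c)\<bar>" by (auto simp: abs_mult)
    qed
    finally have B: "\<bar>?B - 1/2 * ?L\<bar> \<le> 1/2 * ?La" by (simp add: sum_distrib_left)
    have L: "\<bar>?L\<bar> \<le> ?La" by (rule sum_abs)
    have T: "0 \<le> phimax P * ?Ta" using P(4) by (intro mult_nonneg_nonneg sum_nonneg) auto
    have C: "\<bar>eta F $ i + 1/2 * ?L\<bar> + 1/2 * ?La + phimax P * ?Ta \<le> Umax P"
      using F i unfolding qp_constraint_eq[OF FP i, symmetric] by simp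
    have prod: "(\<Prod>s<Suc (i div udim P). 1 - n s) \<in> {0, 1}"
      by (rule prod_complement_01) (use n l in auto)
    have g: "offset_gain P n i \<in> {0, 1}"
      using prod by (auto simp: offset_gain_def received_eq simp del: prod.lessThan_Suc)
    have p: "feedback_gain P n i = 0 \<or> feedback_gain P n i = 1 \<and> offset_gain P n i = 1"
      using n l by (auto simp: feedback_gain_def offset_gain_def received_eq)
    consider "feedback_gain P n i = 0" "offset_gain P n i = 0" | "feedback_gain P n i = 0" "offset_gain P n i = 1" | "feedback_gain P n i = 1" "offset_gain P n i = 1"
      using g p by blast
    then show ?thesis
    proof cases
      case 1 then show ?thesis using P(3) by (simp add: applied_index[OF FP P(1,2) \<xi> i])
    next
      case 2
      then have "applied P F n \<xi> $ i = eta F $ i" by (simp add: applied_index[OF FP P(1,2) \<xi> i])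
      then show ?thesis using L T C by linarith
    next
      case 3
      then have "applied P F n \<xi> $ i = eta F $ i + (?A + ?B)" by (simp add: applied_index[OF FP P(1,2) \<xi> i])
      then show ?thesis using A B C by linarith
    qed
  qed
  have "linf (vblock (udim P) (applied P F n \<xi>) l) \<le> Umax P"
    if "\<forall>l<horizon P. n l \<in> {0, 1}" "\<xi> \<in> carrier_vec (esize P)"
      "linf \<xi> \<le> phimax P" "l < horizon P" for n \<xi> l
  proof -
    note block_index_less[OF that(4)]
    then show ?thesis using P(3) bound[OF that(1-3)] by (subst linf_le_iff) (auto simp: vblock_index)
  qed
  with FP show "F \<in> feasible_set P" by (auto simp: feasible_set_def esize_def)
next
  fix F assume F: "F \<in> feasible_set P"
  then have FP: "F \<in> policy_class P" by (simp add: feasible_set_def)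
  have "qp_constraint P i F \<le> Umax P" if i: "i < usize P" for i
  proof -
    define l where "l = i div udim P"
    have l: "l < horizon P" unfolding l_def using i P(2) by (simp add: div_less_iff_less_mult mult.commute)
    let ?L = "\<Sum>c<horizon P - 1. Lam F $$ (i, c)"
    let ?La = "\<Sum>c<horizon P - 1. \<bar>Lam F $$ (i, c)\<bar>"
    let ?Ta = "\<Sum>c<esize P. \<bar>Theta F $$ (i, c)\<bar>"
    (* The worst case for row i: the signs of the noise and of the earlier channel values all push the
       entry in the direction sigma of its midpoint. The values from block l on are successes, so that
       both gains are 1; the entries of Lambda that would multiply them vanish. *)
    define \<sigma> :: real where "\<sigma> = (if 0 \<le> eta F $ i + 1/2 * ?L then 1 else - 1)"
    define n :: "nat \<Rightarrow> real" where "n c = (if c < l \<and> \<sigma> * Lam F $$ (i, c) < 0 then 0 else 1)" for c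
    define \<xi> where "\<xi> = vec (esize P) (\<lambda>c. phimax P * \<sigma> * sgn (Theta F $$ (i, c)))"
    have \<xi>: "\<xi> \<in> carrier_vec (esize P)" by (simp add: \<xi>_def)
    have lin: "linf \<xi> \<le> phimax P" using P(4) by (subst linf_le_iff) (auto simp: \<xi>_def \<sigma>_def abs_mult sgn_if)
    have n: "\<forall>l<horizon P. n l \<in> {0, 1}" by (simp add: n_def)
    have "linf (vblock (udim P) (applied P F n \<xi>) l) \<le> Umax P"
      using F n \<xi> lin l unfolding feasible_set_def esize_def by blast
    then have "\<bar>vblock (udim P) (applied P F n \<xi>) l $ (i mod udim P)\<bar> \<le> Umax P"
      using P(2,3) by (simp add: linf_le_iff vblock_index)
    then have U: "\<bar>applied P F n \<xi> $ i\<bar> \<le> Umax P"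
      using P(2) by (simp add: vblock_index l_def)
    have gp: "offset_gain P n i = 1" "feedback_gain P n i = 1"
      by (auto simp: offset_gain_def feedback_gain_def received_eq n_def l_def)
    have A: "(\<Sum>c<esize P. Theta F $$ (i, c) * \<xi> $ c) = \<sigma> * (phimax P * ?Ta)"
      unfolding sum_distrib_left by (intro sum.cong) (auto simp: \<xi>_def sgn_if)
    have "Lam F $$ (i, c) * n c = 1/2 * Lam F $$ (i, c) + \<sigma> * (1/2 * \<bar>Lam F $$ (i, c)\<bar>)" if "c < horizon P - 1" for c
    proof (cases "c < l")
      case True then show ?thesis by (auto simp: n_def \<sigma>_def)
    next
      case False
      then have "Lam F $$ (i, c) = 0" using FP i that by (auto simp: policy_class_def l_def)
      then show ?thesis by simp
    qed
    then have B: "(\<Sum>c<horizon P - 1. Lam F $$ (i, c) * n c) = 1/2 * ?L + \<sigma> * (1/2 * ?La)"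
      unfolding sum_distrib_left sum.distrib[symmetric] by (intro sum.cong) auto
    have "applied P F n \<xi> $ i = (eta F $ i + 1/2 * ?L) + \<sigma> * (1/2 * ?La) + \<sigma> * (phimax P * ?Ta)"
      unfolding applied_index[OF FP P(1,2) \<xi> i] gp A B by simp
    also have "\<dots> = \<sigma> * qp_constraint P i F"
      unfolding qp_constraint_eq[OF FP i] by (auto simp: \<sigma>_def)
    finally have "\<bar>applied P F n \<xi> $ i\<bar> = \<bar>qp_constraint P i F\<bar>" by (auto simp: abs_mult \<sigma>_def)
    with U show ?thesis by simp
  qed
  with FP show "F \<in> ?R" by simp
qed

lemma feasible_nonempty:
  assumes P: "recalc P \<le> horizon P" "0 < udim P" "0 < Umax P" "0 \<le> phimax P"
  shows "feasible_set P \<noteq> {}"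
proof -
  let ?Z = "\<lparr>eta = 0\<^sub>v (usize P), Theta = 0\<^sub>m (usize P) (esize P), Lam = 0\<^sub>m (usize P) (horizon P - 1)\<rparr>"
  have "qp_constraint P i ?Z = 0" if "i < usize P" for i
    using that unfolding qp_constraint_eq[OF zero_policy that] by simp
  then show ?thesis unfolding feasible_set_eq[OF assms] using zero_policy[of P] assms(3) by force
qed

lemma feasible_convex:
  assumes P: "recalc P \<le> horizon P" "0 < udim P" "0 < Umax P" "0 \<le> phimax P"
  shows "dec_convex_set (feasible_set P)"
  unfolding dec_convex_set_def
proof (intro ballI allI impI)
  fix F G and s :: real assume F: "F \<in> feasible_set P" and G: "G \<in> feasible_set P" and s: "0 \<le> s \<and> s \<le> 1"
  have "qp_constraint P i (dec_comb s F (1 - s) G) \<le> Umax P" if i: "i < usize P" for i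
  proof -
    have "qp_constraint P i (dec_comb s F (1 - s) G) \<le> s * qp_constraint P i F + (1 - s) * qp_constraint P i G"
      using dec_convex_pwl_convex[OF qp_constraint_pwl[OF i P(4)] policy_class_comb] F G s
      by (auto simp: dec_convex_fun_def feasible_set_eq[OF P])
    also have "\<dots> \<le> s * Umax P + (1 - s) * Umax P"
      using F G s i by (intro add_mono mult_left_mono) (auto simp: feasible_set_eq[OF P])
    finally show ?thesis by (simp add: algebra_simps)
  qed
  then show "dec_comb s F (1 - s) G \<in> feasible_set P"
    using F G by (auto simp: feasible_set_eq[OF P] policy_class_comb)
qed

section \<open>Concatenated blocks\<close>

lemma append_cols_carrier:
  "X \<in> carrier_mat r c \<Longrightarrow> Y \<in> carrier_mat r c' \<Longrightarrow> append_cols X Y \<in> carrier_mat r (c + c')"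
  unfolding append_cols_def by (intro carrier_matI) auto

lemma append_cols_mult_vec:
  assumes "X \<in> carrier_mat r c" "Y \<in> carrier_mat r c'" "v \<in> carrier_vec c" "v' \<in> carrier_vec c'"
  shows "append_cols X Y *\<^sub>v (v @\<^sub>v v') = X *\<^sub>v v + Y *\<^sub>v v'"
proof -
  have "append_cols X Y *\<^sub>v (v @\<^sub>v v') = (X *\<^sub>v v + Y *\<^sub>v v') @\<^sub>v (0\<^sub>m 0 c *\<^sub>v v + 0\<^sub>m 0 c' *\<^sub>v v')"
    unfolding append_cols_def using assms by (subst four_block_mat_mult_vec[of X r c Y c' _ 0]) auto
  also have "\<dots> = X *\<^sub>v v + Y *\<^sub>v v'" by (rule eq_vecI) auto
  finally show ?thesis .
qed

abbreviation stack :: "real vec list \<Rightarrow> real vec" where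
  "stack vs \<equiv> foldr append_vec vs (0\<^sub>v 0)"

lemma stack_carrier:
  "(\<And>l. l \<in> set ls \<Longrightarrow> v l \<in> carrier_vec (c l)) \<Longrightarrow> stack (map v ls) \<in> carrier_vec (\<Sum>l\<leftarrow>ls. c l)"
  by (induction ls) auto

lemma hcat_carrier:
  "(\<And>l. l \<in> set ls \<Longrightarrow> M l \<in> carrier_mat r (c l)) \<Longrightarrow> hcat r (map M ls) \<in> carrier_mat r (\<Sum>l\<leftarrow>ls. c l)"
  by (induction ls) (auto simp: hcat_def intro: append_cols_carrier)

lemma vcat_carrier:
  "(\<And>l. l \<in> set ls \<Longrightarrow> M l \<in> carrier_mat (c l) k) \<Longrightarrow> vcat k (map M ls) \<in> carrier_mat (\<Sum>l\<leftarrow>ls. c l) k"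
  by (induction ls) (auto simp: vcat_def)

text \<open>The product of a block row and a stacked vector, tested against a vector \<open>u\<close>. Only scalar products
  of this kind occur below, and they avoid sums of vectors.\<close>

lemma scalar_prod_hcat:
  assumes "\<And>l. l \<in> set ls \<Longrightarrow> M l \<in> carrier_mat r (c l)"
    "\<And>l. l \<in> set ls \<Longrightarrow> v l \<in> carrier_vec (c l)" "u \<in> carrier_vec r"
  shows "u \<bullet> (hcat r (map M ls) *\<^sub>v stack (map v ls)) = (\<Sum>l\<leftarrow>ls. u \<bullet> (M l *\<^sub>v v l))"
  using assms(1,2)
proof (induction ls)
  case Nil
  have "(0\<^sub>m r 0 :: real mat) *\<^sub>v 0\<^sub>v 0 = 0\<^sub>v r" by (rule eq_vecI) auto
  then show ?case using assms(3) by (simp add: hcat_def)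
next
  case (Cons a ls)
  have H: "hcat r (map M ls) \<in> carrier_mat r (\<Sum>l\<leftarrow>ls. c l)" by (rule hcat_carrier) (use Cons in auto)
  have V: "stack (map v ls) \<in> carrier_vec (\<Sum>l\<leftarrow>ls. c l)" by (rule stack_carrier) (use Cons in auto)
  have "hcat r (map M (a # ls)) *\<^sub>v stack (map v (a # ls)) = M a *\<^sub>v v a + hcat r (map M ls) *\<^sub>v stack (map v ls)"
    using append_cols_mult_vec[OF _ H _ V, of "M a" "c a" "v a"] Cons.prems by (simp add: hcat_def)
  then have "u \<bullet> (hcat r (map M (a # ls)) *\<^sub>v stack (map v (a # ls))) = u \<bullet> (M a *\<^sub>v v a) + u \<bullet> (hcat r (map M ls) *\<^sub>v stack (map v ls))"
    using H Cons.prems(1)[of a] by (simp add: scalar_prod_def sum.distrib distrib_left)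
  then show ?case using Cons by simp
qed

lemma scalar_prod_vcat:
  assumes "\<And>l. l \<in> set ls \<Longrightarrow> M l \<in> carrier_mat (c l) k"
    "\<And>l. l \<in> set ls \<Longrightarrow> v l \<in> carrier_vec (c l)" "u \<in> carrier_vec k"
  shows "stack (map v ls) \<bullet> (vcat k (map M ls) *\<^sub>v u) = (\<Sum>l\<leftarrow>ls. v l \<bullet> (M l *\<^sub>v u))"
  using assms(1,2)
proof (induction ls)
  case Nil
  show ?case by (simp add: vcat_def scalar_prod_def)
next
  case (Cons a ls)
  have H: "vcat k (map M ls) \<in> carrier_mat (\<Sum>l\<leftarrow>ls. c l) k" by (rule vcat_carrier) (use Cons in auto)
  have V: "stack (map v ls) \<in> carrier_vec (\<Sum>l\<leftarrow>ls. c l)" by (rule stack_carrier) (use Cons in auto)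
  have "vcat k (map M (a # ls)) *\<^sub>v u = M a *\<^sub>v u @\<^sub>v vcat k (map M ls) *\<^sub>v u"
    using mat_mult_append[OF _ H assms(3), of "M a" "c a"] Cons by (simp add: vcat_def)
  then show ?case
    using scalar_prod_append[OF _ V _ mult_mat_vec_carrier[OF H assms(3)], of "v a" "c a" "M a *\<^sub>v u"]
      Cons mult_mat_vec_carrier[of "M a" "c a" k u] assms(3) by simp
qed

section \<open>Bilinear forms\<close>

text \<open>The conditions of the laws below are equations between dimensions rather than memberships in
  carriers. The simplifier discharges them by itself, so that long products can be rearranged without
  listing the size of every partial product.\<close>

lemma mat_vec_assoc:
  fixes X :: "real mat"
  assumes "dim_col X = dim_row Y" "dim_col Y = dim_vec v"
  shows "(X * Y) *\<^sub>v v = X *\<^sub>v (Y *\<^sub>v v)"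
  by (rule assoc_mult_mat_vec[of X "dim_row X" "dim_row Y" Y "dim_vec v"])
    (use assms in \<open>auto intro: carrier_matI\<close>)

lemma mat_assoc:
  fixes X :: "real mat"
  assumes "dim_col X = dim_row Y" "dim_col Y = dim_row Z"
  shows "(X * Y) * Z = X * (Y * Z)"
  by (rule assoc_mult_mat[of X "dim_row X" "dim_row Y" Y "dim_row Z" Z "dim_col Z"])
    (use assms in \<open>auto intro: carrier_matI\<close>)

lemma mat_vec_add:
  fixes X :: "real mat"
  assumes "dim_row X = dim_row Y" "dim_col X = dim_col Y" "dim_vec v = dim_col Y"
  shows "(X + Y) *\<^sub>v v = X *\<^sub>v v + Y *\<^sub>v v"
  by (rule add_mult_distrib_mat_vec[of X "dim_row X" "dim_col X"])
    (use assms in \<open>auto intro: carrier_matI carrier_vecI\<close>)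

lemma scalar_prod_add_right:
  "dim_vec v = dim_vec w \<Longrightarrow> u \<bullet> (v + w) = u \<bullet> v + u \<bullet> (w :: real vec)"
  by (simp add: scalar_prod_def sum.distrib distrib_left)

lemma scalar_prod_commute: "dim_vec u = dim_vec v \<Longrightarrow> u \<bullet> v = v \<bullet> (u :: real vec)"
  by (simp add: scalar_prod_def mult.commute)

lemma form_adjoint:
  fixes X :: "real mat"
  assumes "dim_col X = dim_vec u" "dim_row X = dim_vec v"
  shows "(X *\<^sub>v u) \<bullet> v = u \<bullet> (X\<^sup>T *\<^sub>v v)"
proof -
  have "(X *\<^sub>v u) \<bullet> v = v \<bullet> (X *\<^sub>v u)" using assms by (simp add: scalar_prod_commute)
  also have "\<dots> = (X\<^sup>T *\<^sub>v v) \<bullet> u"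
    by (rule transpose_vec_mult_scalar[of X "dim_row X" "dim_col X", symmetric])
      (use assms in \<open>auto intro: carrier_matI carrier_vecI\<close>)
  finally show ?thesis using assms by (simp add: scalar_prod_commute)
qed

lemma form_add_left: "dim_vec w = dim_row X \<Longrightarrow> (u + w) \<bullet> (X *\<^sub>v v) = u \<bullet> (X *\<^sub>v v) + w \<bullet> (X *\<^sub>v (v :: real vec))"
  by (simp add: scalar_prod_def sum.distrib distrib_right)

lemma form_add_right: "dim_vec v = dim_vec w \<Longrightarrow> u \<bullet> (X *\<^sub>v (v + w)) = u \<bullet> (X *\<^sub>v v) + u \<bullet> (X *\<^sub>v (w :: real vec))"
  by (simp add: scalar_prod_def sum.distrib distrib_left)

lemma form_smult:
  fixes a :: real
  shows "dim_vec u = dim_row X \<Longrightarrow> (a \<cdot>\<^sub>v u) \<bullet> (X *\<^sub>v v) = a * (u \<bullet> (X *\<^sub>v v))"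
    and "u \<bullet> (X *\<^sub>v (a \<cdot>\<^sub>v v)) = a * (u \<bullet> (X *\<^sub>v v))"
  by (simp_all add: scalar_prod_def sum_distrib_left mult_ac)

lemma form_commute:
  assumes "X\<^sup>T = X" "dim_vec u = dim_row X" "dim_vec v = dim_row X"
  shows "u \<bullet> (X *\<^sub>v v) = v \<bullet> (X *\<^sub>v (u :: real vec))"
proof -
  have X: "dim_col X = dim_row X" using assms(1) index_transpose_mat(2)[of X] by simp
  have "u \<bullet> (X *\<^sub>v v) = (X *\<^sub>v v) \<bullet> u" using assms(2) by (intro scalar_prod_commute) simp
  also have "\<dots> = v \<bullet> (X\<^sup>T *\<^sub>v u)" using assms X by (intro form_adjoint) simp_all
  finally show ?thesis unfolding assms(1) .
qed

lemma form_square_add: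
  assumes "X\<^sup>T = X" "dim_vec u = dim_row X" "dim_vec v = dim_row X"
  shows "(u + v) \<bullet> (X *\<^sub>v (u + v)) = u \<bullet> (X *\<^sub>v u) + 2 * (u \<bullet> (X *\<^sub>v v)) + v \<bullet> (X *\<^sub>v (v :: real vec))"
  using assms form_commute[OF assms] by (simp add: form_add_left form_add_right)

lemma form_double_sum:
  assumes "X \<in> carrier_mat k k'" "u \<in> carrier_vec k" "v \<in> carrier_vec k'"
  shows "u \<bullet> (X *\<^sub>v v) = (\<Sum>i<k. \<Sum>j<k'. u $ i * X $$ (i, j) * v $ j)"
  using assms by (auto simp: scalar_prod_def lessThan_atLeast0 sum_distrib_left mult.assoc intro!: sum.cong)

text \<open>The defect in the convexity inequality is \<open>s (1 - s)\<close> times the form at \<open>u - v\<close>.\<close>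

lemma nonneg_form_convex:
  assumes X: "sym_nonneg_def k X" and u: "u \<in> carrier_vec k" and v: "v \<in> carrier_vec k"
    and s: "0 \<le> s" "s \<le> 1"
  shows "(s \<cdot>\<^sub>v u + (1 - s) \<cdot>\<^sub>v v) \<bullet> (X *\<^sub>v (s \<cdot>\<^sub>v u + (1 - s) \<cdot>\<^sub>v v)) \<le> s * (u \<bullet> (X *\<^sub>v u)) + (1 - s) * (v \<bullet> (X *\<^sub>v v))"
proof -
  have X': "X\<^sup>T = X" "dim_row X = k" using X by (auto simp: sym_nonneg_def_def)
  have q: "(a \<cdot>\<^sub>v u + b \<cdot>\<^sub>v v) \<bullet> (X *\<^sub>v (a \<cdot>\<^sub>v u + b \<cdot>\<^sub>v v)) =
      a\<^sup>2 * (u \<bullet> (X *\<^sub>v u)) + 2 * a * b * (u \<bullet> (X *\<^sub>v v)) + b\<^sup>2 * (v \<bullet> (X *\<^sub>v v))" for a b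
    using form_square_add[OF X'(1), of "a \<cdot>\<^sub>v u" "b \<cdot>\<^sub>v v"] X' u v
    by (simp add: form_smult power2_eq_square mult_ac)
  have "0 \<le> (1 \<cdot>\<^sub>v u + (- 1) \<cdot>\<^sub>v v) \<bullet> (X *\<^sub>v (1 \<cdot>\<^sub>v u + (- 1) \<cdot>\<^sub>v v))"
    using X u v by (auto simp: sym_nonneg_def_def)
  then have "0 \<le> s * (1 - s) * (u \<bullet> (X *\<^sub>v u) - 2 * (u \<bullet> (X *\<^sub>v v)) + v \<bullet> (X *\<^sub>v v))"
    unfolding q using s by (intro mult_nonneg_nonneg) auto
  then show ?thesis unfolding q by (simp add: algebra_simps power2_eq_square)
qed

lemma sym_pos_imp_nonneg: "sym_pos_def n X \<Longrightarrow> sym_nonneg_def n X"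
  unfolding sym_pos_def_def sym_nonneg_def_def
proof (intro conjI ballI)
  assume *: "X \<in> carrier_mat n n \<and> X\<^sup>T = X \<and> (\<forall>v\<in>carrier_vec n. v \<noteq> 0\<^sub>v n \<longrightarrow> 0 < v \<bullet> (X *\<^sub>v v))"
  then show "X \<in> carrier_mat n n" "X\<^sup>T = X" by auto
  fix v :: "real vec" assume v: "v \<in> carrier_vec n"
  show "0 \<le> v \<bullet> (X *\<^sub>v v)"
  proof (cases "v = 0\<^sub>v n")
    case True
    have "X *\<^sub>v v \<in> carrier_vec n" using * v by auto
    then show ?thesis using True by simp
  qed (use * v in \<open>force simp: less_imp_le\<close>)
qed

text \<open>A form with a block diagonal matrix is the sum of the forms of the blocks.\<close>

lemma diag_block_nonneg:
  "(\<And>X. X \<in> set Xs \<Longrightarrow> sym_nonneg_def (dim_row X) X) \<Longrightarrow>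
    sym_nonneg_def (\<Sum>X\<leftarrow>Xs. dim_row X) (diag_block_mat Xs)"
proof (induction Xs)
  case Nil
  show ?case by (auto simp: sym_nonneg_def_def scalar_prod_def)
next
  case (Cons A Xs)
  define n where "n = dim_row A"
  define k where "k = (\<Sum>X\<leftarrow>Xs. dim_row X)"
  define B where "B = diag_block_mat Xs"
  have A: "A \<in> carrier_mat n n" "A\<^sup>T = A" "\<And>v. v \<in> carrier_vec n \<Longrightarrow> 0 \<le> v \<bullet> (A *\<^sub>v v)"
    using Cons.prems[of A] by (auto simp: sym_nonneg_def_def n_def)
  have B: "B \<in> carrier_mat k k" "B\<^sup>T = B" "\<And>v. v \<in> carrier_vec k \<Longrightarrow> 0 \<le> v \<bullet> (B *\<^sub>v v)"
    using Cons by (auto simp: sym_nonneg_def_def k_def B_def)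
  have D: "diag_block_mat (A # Xs) = four_block_mat A (0\<^sub>m n k) (0\<^sub>m k n) B"
    using A B by (simp add: Let_def B_def[symmetric])
  have "0 \<le> v \<bullet> (four_block_mat A (0\<^sub>m n k) (0\<^sub>m k n) B *\<^sub>v v)" if "v \<in> carrier_vec (n + k)" for v
  proof -
    let ?a = "vec_first v n" and ?b = "vec_last v k"
    have v: "v = ?a @\<^sub>v ?b" using that by simp
    have "four_block_mat A (0\<^sub>m n k) (0\<^sub>m k n) B *\<^sub>v (?a @\<^sub>v ?b) = A *\<^sub>v ?a @\<^sub>v B *\<^sub>v ?b"
      by (rule mult_mat_vec_split) (use A B in auto)
    moreover have "(?a @\<^sub>v ?b) \<bullet> (A *\<^sub>v ?a @\<^sub>v B *\<^sub>v ?b) = ?a \<bullet> (A *\<^sub>v ?a) + ?b \<bullet> (B *\<^sub>v ?b)"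
      by (rule scalar_prod_append[of _ n _ k]) (use A B in auto)
    ultimately show ?thesis using v A(3)[of ?a] B(3)[of ?b] by simp
  qed
  then show ?case
    unfolding D using A B transpose_four_block_mat[of A n n "0\<^sub>m n k" k "0\<^sub>m k n" k B]
    by (simp add: sym_nonneg_def_def n_def[symmetric] k_def[symmetric])
qed

section \<open>The plant over one horizon\<close>

locale plant =
  fixes P :: "'a system"
  assumes dims: "0 < xdim P" "0 < udim P"
    and horizon: "1 \<le> horizon P" "1 \<le> recalc P" "recalc P \<le> horizon P"
    and plant: "sysA P \<in> carrier_mat (xdim P) (xdim P)" "sysB P \<in> carrier_mat (xdim P) (udim P)"
      "xinit P \<in> carrier_vec (xdim P)" "0 < Umax P"
    and weights: "sym_nonneg_def (xdim P) (wgtQ P)" "sym_nonneg_def (xdim P) (wgtQf P)"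
      "sym_pos_def (udim P) (wgtR P)" "0 \<le> regmu P"
begin

lemma carriers [simp]:
  "calA P \<in> carrier_mat (xsize P) (xdim P)"
  "calB P \<in> carrier_mat (xsize P) (usize P)"
  "calD P \<in> carrier_mat (xsize P) (wsize P)"
  "wvec P ws \<in> carrier_vec (wsize P)"
  "evec P ws \<in> carrier_vec (esize P)"
  "Gmat P n \<in> carrier_mat (usize P) (usize P)"
  "Smat P n \<in> carrier_mat (usize P) (usize P)"
  "Sl P l n \<in> carrier_mat (usize P) (usize P)"
  using dims horizon
  by (simp_all add: calA_def calB_def calD_def block_mat_def xsize_def wsize_def esize_def wvec_def evec_def
      block_vec_def mult.commute Gmat_diagonal Smat_diagonal Sl_def)

lemma calQ_nonneg: "sym_nonneg_def (xsize P) (calQ P)"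
proof -
  have "dim_row (wgtQ P) = xdim P" "dim_row (wgtQf P) = xdim P" 
    using weights by (auto simp: sym_nonneg_def_def)
  moreover have "sym_nonneg_def (\<Sum>X\<leftarrow>replicate (horizon P) (wgtQ P) @ [wgtQf P]. dim_row X)
      (diag_block_mat (replicate (horizon P) (wgtQ P) @ [wgtQf P]))"
    by (rule diag_block_nonneg) (use calculation weights in auto)
  ultimately show ?thesis
    by (simp add: calQ_def xsize_def sum_list_replicate algebra_simps)
qed

lemma calR_nonneg: "sym_nonneg_def (usize P) (calR P)"
proof -
  have R: "sym_nonneg_def (udim P) (wgtR P)" using weights sym_pos_imp_nonneg by blast
  then have "dim_row (wgtR P) = udim P" by (auto simp: sym_nonneg_def_def)
  then show ?thesis
    using diag_block_nonneg[of "replicate (horizon P) (wgtR P)"] R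
    by (auto simp: calR_def sum_list_replicate mult.commute)
qed

lemma weight_carriers [simp]:
  "calQ P \<in> carrier_mat (xsize P) (xsize P)" "(calQ P)\<^sup>T = calQ P"
  "calR P \<in> carrier_mat (usize P) (usize P)" "(calR P)\<^sup>T = calR P"
  using calQ_nonneg calR_nonneg by (auto simp: sym_nonneg_def_def)

lemma alpha_carrier [simp]: "alpha P \<in> carrier_mat (usize P) (usize P)"
  unfolding alpha_def by (intro add_carrier_mat weight_carriers)

lemmas matrix_dims [simp] =
  carriers(1,2,3,6,7,8)[THEN carrier_matD(1)] carriers(1,2,3,6,7,8)[THEN carrier_matD(2)]
  carriers(4,5)[THEN carrier_vecD] weight_carriers(1,3)[THEN carrier_matD(1)]
  weight_carriers(1,3)[THEN carrier_matD(2)] alpha_carrier[THEN carrier_matD(1)]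
  alpha_carrier[THEN carrier_matD(2)]

lemma applied_dim [simp]: "dim_vec (applied P F n \<xi>) = usize P"
  by (simp add: applied_def)

text \<open>The matrix \<open>\<alpha>\<close> collects both ways in which an input is paid for, through the states that it
  causes and directly.\<close>

lemma alpha_form:
  assumes "dim_vec u = usize P" "dim_vec v = usize P"
  shows "u \<bullet> (alpha P *\<^sub>v v) = (calB P *\<^sub>v u) \<bullet> (calQ P *\<^sub>v (calB P *\<^sub>v v)) + u \<bullet> (calR P *\<^sub>v v)"
  using assms by (simp add: alpha_def mat_vec_add scalar_prod_add_right mat_vec_assoc form_adjoint)

lemma alpha_commute:
  assumes "dim_vec u = usize P" "dim_vec v = usize P"
  shows "u \<bullet> (alpha P *\<^sub>v v) = v \<bullet> (alpha P *\<^sub>v u)"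
  using assms form_commute[of "calQ P" "calB P *\<^sub>v u" "calB P *\<^sub>v v"] form_commute[of "calR P" u v]
  by (simp add: alpha_form)

lemma decision_dims [simp]:
  assumes "F \<in> policy_class P"
  shows "dim_vec (eta F) = usize P" "dim_row (Theta F) = usize P" "dim_col (Theta F) = esize P"
    "dim_row (Lam F) = usize P" "dim_col (Lam F) = horizon P - 1"
  using policy_classD[OF assms] by auto

lemma applied_linear:
  assumes F: "F \<in> policy_class P" and G: "G \<in> policy_class P" and H: "dec_comb a F b G \<in> policy_class P"
    and \<xi>: "\<xi> \<in> carrier_vec (esize P)"
  shows "applied P (dec_comb a F b G) n \<xi> = a \<cdot>\<^sub>v applied P F n \<xi> + b \<cdot>\<^sub>v applied P G n \<xi>"
proof (rule eq_vecI)
  show "dim_vec (applied P (dec_comb a F b G) n \<xi>) = dim_vec (a \<cdot>\<^sub>v applied P F n \<xi> + b \<cdot>\<^sub>v applied P G n \<xi>)"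
    by simp
  fix i assume "i < dim_vec (a \<cdot>\<^sub>v applied P F n \<xi> + b \<cdot>\<^sub>v applied P G n \<xi>)"
  then have i: "i < usize P" by simp
  note ix = applied_index[OF _ horizon(3) dims(2) \<xi> i]
  have "Theta (dec_comb a F b G) $$ (i, c) = a * Theta F $$ (i, c) + b * Theta G $$ (i, c)" if "c < esize P" for c
    using that i policy_classD[OF F] policy_classD[OF G] by (auto simp: dec_comb_def)
  then have T: "(\<Sum>c<esize P. Theta (dec_comb a F b G) $$ (i, c) * \<xi> $ c) =
     a * (\<Sum>c<esize P. Theta F $$ (i, c) * \<xi> $ c) + b * (\<Sum>c<esize P. Theta G $$ (i, c) * \<xi> $ c)"
    by (simp add: sum_distrib_left algebra_simps flip: sum.distrib)
  have "Lam (dec_comb a F b G) $$ (i, c) = a * Lam F $$ (i, c) + b * Lam G $$ (i, c)" if "c < horizon P - 1" for c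
    using that i policy_classD[OF F] policy_classD[OF G] by (auto simp: dec_comb_def)
  then have L: "(\<Sum>c<horizon P - 1. Lam (dec_comb a F b G) $$ (i, c) * n c) =
     a * (\<Sum>c<horizon P - 1. Lam F $$ (i, c) * n c) + b * (\<Sum>c<horizon P - 1. Lam G $$ (i, c) * n c)"
    by (simp add: sum_distrib_left algebra_simps flip: sum.distrib)
  have E: "eta (dec_comb a F b G) $ i = a * eta F $ i + b * eta G $ i"
    using i policy_classD[OF F] policy_classD[OF G] by (auto simp: dec_comb_def)
  have "(a \<cdot>\<^sub>v applied P F n \<xi> + b \<cdot>\<^sub>v applied P G n \<xi>) $ i = a * applied P F n \<xi> $ i + b * applied P G n \<xi> $ i"
    using i by simp
  then show "applied P (dec_comb a F b G) n \<xi> $ i = (a \<cdot>\<^sub>v applied P F n \<xi> + b \<cdot>\<^sub>v applied P G n \<xi>) $ i"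
    by (simp only: ix[OF F] ix[OF G] ix[OF H] T L E) (simp add: distrib_left distrib_right mult.assoc mult.left_commute)
qed

definition trajectory :: "real vec \<Rightarrow> real vec \<Rightarrow> (nat \<Rightarrow> real vec) \<Rightarrow> real vec" where
  "trajectory v ua ws = calA P *\<^sub>v v + calB P *\<^sub>v ua + calD P *\<^sub>v wvec P ws"

lemma trajectory_carrier [simp]: "trajectory v u ws \<in> carrier_vec (xsize P)"
  by (rule carrier_vecI) (simp add: trajectory_def)

lemma horizon_cost_trajectory:
  "horizon_cost P v F n ws = (let ua = applied P F n (evec P ws) in
     trajectory v ua ws \<bullet> (calQ P *\<^sub>v trajectory v ua ws) + ua \<bullet> (calR P *\<^sub>v ua))"
  by (simp add: horizon_cost_def trajectory_def Let_def)

text \<open>For fixed channel and noise values the trajectory and the input depend affinely on the decision,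
  and the cost is a nonnegative form in them.\<close>

lemma horizon_cost_convex:
  assumes F: "F \<in> policy_class P" and G: "G \<in> policy_class P" and s: "0 \<le> s" "s \<le> 1"
  shows "horizon_cost P v (dec_comb s F (1 - s) G) n ws \<le> s * horizon_cost P v F n ws + (1 - s) * horizon_cost P v G n ws"
proof -
  let ?f = "applied P F n (evec P ws)" and ?g = "applied P G n (evec P ws)"
  have fg: "?f \<in> carrier_vec (usize P)" "?g \<in> carrier_vec (usize P)" by (auto intro: carrier_vecI)
  have a: "applied P (dec_comb s F (1 - s) G) n (evec P ws) = s \<cdot>\<^sub>v ?f + (1 - s) \<cdot>\<^sub>v ?g"
    by (rule applied_linear[OF F G policy_class_comb[OF F G]]) simp
  have "calB P *\<^sub>v (s \<cdot>\<^sub>v ?f + (1 - s) \<cdot>\<^sub>v ?g) = s \<cdot>\<^sub>v (calB P *\<^sub>v ?f) + (1 - s) \<cdot>\<^sub>v (calB P *\<^sub>v ?g)"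
    using mult_add_distrib_mat_vec[OF carriers(2), of "s \<cdot>\<^sub>v ?f" "(1 - s) \<cdot>\<^sub>v ?g"]
      mult_mat_vec[OF carriers(2) fg(1)] mult_mat_vec[OF carriers(2) fg(2)] fg by auto
  then have t: "trajectory v (s \<cdot>\<^sub>v ?f + (1 - s) \<cdot>\<^sub>v ?g) ws = s \<cdot>\<^sub>v trajectory v ?f ws + (1 - s) \<cdot>\<^sub>v trajectory v ?g ws"
    unfolding trajectory_def by (intro eq_vecI) (simp_all add: algebra_simps del: index_mult_mat_vec)
  show ?thesis
    unfolding horizon_cost_trajectory Let_def a t
    using nonneg_form_convex[OF calQ_nonneg trajectory_carrier trajectory_carrier s, of v ?f ws v ?g ws] nonneg_form_convex[OF calR_nonneg fg s]
    by (simp add: algebra_simps)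
qed

end

lemma Cl_eq: 
  assumes "l \<le> horizon P"
  shows "Cl P l = mat (usize P) (udim P * (horizon P - l)) (\<lambda>(i, j). if i = udim P * l + j then 1 else 0)"
proof -
  have "udim P * l + udim P * (horizon P - l) = usize P" 
    using assms by (metis add_mult_distrib2 le_add_diff_inverse)
  then show ?thesis unfolding Cl_def append_rows_def
    by (intro eq_matI) auto
qed

lemma Cl_carrier [simp]: "l \<le> horizon P \<Longrightarrow> Cl P l \<in> carrier_mat (usize P) (udim P * (horizon P - l))"
  by (simp add: Cl_eq)

text \<open>The matrix \<open>\<CC>\<^sub>l\<close> embeds the last blocks of a vector, and its transpose cuts off the first \<open>l\<close>
  blocks, which costs nothing if these vanish. The program stores column \<open>l\<close> of \<open>\<Lambda>\<close> in the cut form.\<close>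

lemma Cl_restore:
  assumes l: "l \<le> horizon P" and v: "v \<in> carrier_vec (usize P)" and z: "\<And>i. i < udim P * l \<Longrightarrow> v $ i = 0"
  shows "Cl P l *\<^sub>v ((Cl P l)\<^sup>T *\<^sub>v v) = v"
proof (rule eq_vecI)
  let ?k = "udim P * (horizon P - l)"
  have u: "usize P = udim P * l + ?k" using l by (metis add_mult_distrib2 le_add_diff_inverse)
  have T: "((Cl P l)\<^sup>T *\<^sub>v v) $ j = v $ (udim P * l + j)" if "j < ?k" for j
  proof -
    have "((Cl P l)\<^sup>T *\<^sub>v v) $ j = (\<Sum>i\<in>{0..<usize P}. if i = udim P * l + j then v $ (udim P * l + j) else 0)"
      using that v unfolding Cl_eq[OF l]
      by (simp add: scalar_prod_def del: sum.delta sum.delta') (rule sum.cong, auto)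
    also have "\<dots> = v $ (udim P * l + j)" using that by (simp add: u)
    finally show ?thesis .
  qed
  fix i assume "i < dim_vec v"
  then have i: "i < usize P" using v by simp
  have "(Cl P l *\<^sub>v ((Cl P l)\<^sup>T *\<^sub>v v)) $ i = (\<Sum>j\<in>{0..<?k}. (if i = udim P * l + j then 1 else 0) * ((Cl P l)\<^sup>T *\<^sub>v v) $ j)"
    using i by (simp add: scalar_prod_def Cl_eq[OF l] del: sum.delta sum.delta')
  also have "\<dots> = (\<Sum>j\<in>{0..<?k}. if j = i - udim P * l then (if udim P * l \<le> i then v $ i else 0) else 0)"
    by (rule sum.cong) (auto simp: T simp del: index_mult_mat_vec)
  also have "\<dots> = v $ i" using i z[of i] by (auto simp: u)
  finally show "(Cl P l *\<^sub>v ((Cl P l)\<^sup>T *\<^sub>v v)) $ i = v $ i" .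
qed (use v in \<open>simp add: Cl_eq[OF l]\<close>)

lemma mat_vec_add_right: "dim_vec v = dim_vec w \<Longrightarrow> X *\<^sub>v (v + w) = X *\<^sub>v v + X *\<^sub>v (w :: real vec)"
  by (rule eq_vecI) (simp_all add: scalar_prod_add_right)

context plant begin

definition "Lam_col F l = col (Lam F) (l - 1)"

text \<open>The plant input splits into a part that depends on the channel only and a part that is linear in
  the saturated noise.\<close>

definition "ack_part F n = Gmat P n *\<^sub>v eta F + Smat P n *\<^sub>v (Lam F *\<^sub>v vec (horizon P - 1) n)"

definition "noise_part F n \<xi> = Smat P n *\<^sub>v (Theta F *\<^sub>v \<xi>)"

lemma part_dims [simp]:
  "F \<in> policy_class P \<Longrightarrow> dim_vec (Lam_col F l) = usize P"
  "dim_vec (ack_part F n) = usize P" "dim_vec (noise_part F n \<xi>) = usize P"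
  by (simp_all add: Lam_col_def ack_part_def noise_part_def)

lemma Lam_col_carrier: "F \<in> policy_class P \<Longrightarrow> Lam_col F l \<in> carrier_vec (usize P)"
  by (simp add: carrier_vecI)

lemma applied_split:
  assumes F: "F \<in> policy_class P"
  shows "applied P F n \<xi> = ack_part F n + noise_part F n \<xi>"
  by (rule eq_vecI) (use F in \<open>simp_all add: applied_def ack_part_def noise_part_def mat_vec_add_right del: index_mult_mat_vec\<close>)

text \<open>Column \<open>l\<close> of \<open>\<Lambda>\<close> is multiplied by the channel value \<open>\<nu>\<^bsub>l-1\<^esub>\<close>; moving this factor to \<open>\<S>\<close> gives
  the matrices \<open>\<S>\<^sub>l\<close> of the program.\<close>

lemma ack_part_linear:
  assumes F: "F \<in> policy_class P"
  shows "u \<bullet> ack_part F n = u \<bullet> (Gmat P n *\<^sub>v eta F) + (\<Sum>l=1..<horizon P. u \<bullet> (Sl P l n *\<^sub>v Lam_col F l))"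
proof -
  let ?k = "horizon P - 1" and ?Ln = "Lam F *\<^sub>v vec (horizon P - 1) n" and ?SLn = "Smat P n *\<^sub>v (Lam F *\<^sub>v vec (horizon P - 1) n)"
  have L: "Lam F \<in> carrier_mat (usize P) (horizon P - 1)" by (rule policy_classD(3)[OF F])
  have Ln: "?Ln \<in> carrier_vec (usize P)" using F by (intro carrier_vecI) simp
  have 1: "u \<bullet> (?SLn) = (\<Sum>i<usize P. \<Sum>c<?k. u $ i * feedback_gain P n i * Lam F $$ (i, c) * n c)"
  proof -
    have "u \<bullet> (?SLn) = (\<Sum>i\<in>{0..<usize P}. u $ i * (feedback_gain P n i * ?Ln $ i))"
      unfolding scalar_prod_def Smat_diagonal[OF dims(2) horizon(3)]
      by (intro sum.cong) (simp_all add: diagonal_mult_vec[OF Ln, unfolded One_nat_def] del: index_mult_mat_vec)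
    also have "\<dots> = (\<Sum>i\<in>{0..<usize P}. u $ i * (feedback_gain P n i * (\<Sum>c<?k. Lam F $$ (i, c) * n c)))"
      using L by (intro sum.cong) (auto simp: scalar_prod_def lessThan_atLeast0)
    finally show ?thesis by (simp add: lessThan_atLeast0 sum_distrib_left mult.assoc)
  qed
  have 2: "u \<bullet> (Sl P (Suc c) n *\<^sub>v Lam_col F (Suc c)) = (\<Sum>i<usize P. u $ i * feedback_gain P n i * Lam F $$ (i, c) * n c)" if "c < ?k" for c
  proof -
    have S: "Sl P (Suc c) n = diagonal (usize P) (\<lambda>i. n c * feedback_gain P n i)"
      unfolding Sl_def using dims horizon by (intro eq_matI) (auto simp: Smat_diagonal diagonal_def)
    have "u \<bullet> (Sl P (Suc c) n *\<^sub>v Lam_col F (Suc c)) = (\<Sum>i\<in>{0..<usize P}. u $ i * (n c * feedback_gain P n i * Lam_col F (Suc c) $ i))"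
      unfolding scalar_prod_def S by (intro sum.cong) (simp_all add: diagonal_mult_vec[OF Lam_col_carrier[OF F]] del: index_mult_mat_vec)
    also have "\<dots> = (\<Sum>i\<in>{0..<usize P}. u $ i * feedback_gain P n i * Lam F $$ (i, c) * n c)"
      using L that by (intro sum.cong) (auto simp: Lam_col_def)
    finally show ?thesis by (simp add: lessThan_atLeast0)
  qed
  have "(\<Sum>l=1..<horizon P. u \<bullet> (Sl P l n *\<^sub>v Lam_col F l)) = (\<Sum>c<?k. u \<bullet> (Sl P (Suc c) n *\<^sub>v Lam_col F (Suc c)))"
    using horizon(1) sum.shift_bounds_Suc_ivl[of "\<lambda>l. u \<bullet> (Sl P l n *\<^sub>v Lam_col F l)" 0 "horizon P - 1"]
    by (simp add: lessThan_atLeast0)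
  also have "\<dots> = (\<Sum>c<?k. \<Sum>i<usize P. u $ i * feedback_gain P n i * Lam F $$ (i, c) * n c)"
    by (rule sum.cong) (auto simp: 2)
  also have "\<dots> = u \<bullet> (?SLn)"
    unfolding 1 by (rule sum.swap)
  finally show ?thesis unfolding ack_part_def by (simp add: scalar_prod_add_right)
qed

text \<open>Expanding \<open>h\<close> on both sides of the form gives the entries of the block matrix \<open>\<L>\<close> before
  expectations are taken.\<close>

lemma ack_part_form:
  assumes F: "F \<in> policy_class P"
  shows "ack_part F n \<bullet> (alpha P *\<^sub>v ack_part F n) =
    eta F \<bullet> (((Gmat P n)\<^sup>T * alpha P * Gmat P n) *\<^sub>v eta F)
    + 2 * (\<Sum>l=1..<horizon P. eta F \<bullet> (((Gmat P n)\<^sup>T * alpha P * Sl P l n) *\<^sub>v Lam_col F l))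
    + (\<Sum>k=1..<horizon P. \<Sum>l=1..<horizon P. Lam_col F k \<bullet> (((Sl P k n)\<^sup>T * alpha P * Sl P l n) *\<^sub>v Lam_col F l))"
proof -
  let ?A = "alpha P" and ?h = "ack_part F n" and ?g = "Gmat P n *\<^sub>v eta F" and ?s = "\<lambda>l. Sl P l n *\<^sub>v Lam_col F l"
  have split: "?h \<bullet> (?A *\<^sub>v z) = ?g \<bullet> (?A *\<^sub>v z) + (\<Sum>l=1..<horizon P. ?s l \<bullet> (?A *\<^sub>v z))" for z
  proof -
    have "?h \<bullet> (?A *\<^sub>v z) = (?A *\<^sub>v z) \<bullet> ?h" by (rule scalar_prod_commute) simp
    also have "\<dots> = (?A *\<^sub>v z) \<bullet> ?g + (\<Sum>l=1..<horizon P. (?A *\<^sub>v z) \<bullet> ?s l)" by (rule ack_part_linear[OF F])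
    also have "\<dots> = ?g \<bullet> (?A *\<^sub>v z) + (\<Sum>l=1..<horizon P. ?s l \<bullet> (?A *\<^sub>v z))"
      by (intro arg_cong2[where f = "(+)"] sum.cong scalar_prod_commute refl) simp_all
    finally show ?thesis .
  qed
  have right: "z \<bullet> (?A *\<^sub>v ?h) = z \<bullet> (?A *\<^sub>v ?g) + (\<Sum>l=1..<horizon P. z \<bullet> (?A *\<^sub>v ?s l))" if z: "dim_vec z = usize P" for z
    unfolding alpha_commute[OF z part_dims(2)] split by (simp add: alpha_commute[of z] z)
  have "?h \<bullet> (?A *\<^sub>v ?h) = ?g \<bullet> (?A *\<^sub>v ?g) + (\<Sum>l=1..<horizon P. ?g \<bullet> (?A *\<^sub>v ?s l))
      + ((\<Sum>k=1..<horizon P. ?s k \<bullet> (?A *\<^sub>v ?g)) + (\<Sum>k=1..<horizon P. \<Sum>l=1..<horizon P. ?s k \<bullet> (?A *\<^sub>v ?s l)))"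
    by (subst split) (simp add: right sum.distrib)
  also have "(\<Sum>k=1..<horizon P. ?s k \<bullet> (?A *\<^sub>v ?g)) = (\<Sum>l=1..<horizon P. ?g \<bullet> (?A *\<^sub>v ?s l))"
    by (intro sum.cong alpha_commute) simp_all
  finally show ?thesis using F by (simp add: form_adjoint mat_vec_assoc)
qed

text \<open>The last group of four terms is linear in the noise or in the saturated noise and has
  expectation zero; the other terms give the objective of the program one by one.\<close>

lemma cost_split:
  assumes F: "F \<in> policy_class P" and v: "v \<in> carrier_vec (xdim P)"
  defines "a \<equiv> calA P *\<^sub>v v"
  shows "horizon_cost P v F n ws =
      a \<bullet> (calQ P *\<^sub>v a)
    + 2 * (a \<bullet> (calQ P *\<^sub>v (calB P *\<^sub>v ack_part F n)))
    + ack_part F n \<bullet> (alpha P *\<^sub>v ack_part F n)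
    + 2 * (evec P ws \<bullet> (((Theta F)\<^sup>T * (Smat P n)\<^sup>T * (calB P)\<^sup>T * calQ P * calD P) *\<^sub>v wvec P ws))
    + wvec P ws \<bullet> (((calD P)\<^sup>T * calQ P * calD P) *\<^sub>v wvec P ws)
    + evec P ws \<bullet> (((Theta F)\<^sup>T * ((Smat P n)\<^sup>T * alpha P * Smat P n) * Theta F) *\<^sub>v evec P ws)
    + (2 * (a \<bullet> ((calQ P * calB P * Smat P n * Theta F) *\<^sub>v evec P ws))
     + 2 * (a \<bullet> ((calQ P * calD P) *\<^sub>v wvec P ws))
     + 2 * (ack_part F n \<bullet> ((alpha P * Smat P n * Theta F) *\<^sub>v evec P ws))
     + 2 * (ack_part F n \<bullet> (((calB P)\<^sup>T * calQ P * calD P) *\<^sub>v wvec P ws)))"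
proof -
  let ?Q = "calQ P" and ?R = "calR P" and ?h = "ack_part F n" and ?s = "noise_part F n (evec P ws)"
  let ?Bh = "calB P *\<^sub>v ?h" and ?Bs = "calB P *\<^sub>v ?s" and ?Dw = "calD P *\<^sub>v wvec P ws"
  have a: "dim_vec a = xsize P" by (simp add: a_def)
  have "horizon_cost P v F n ws = (a + (?Bh + ?Bs) + ?Dw) \<bullet> (?Q *\<^sub>v (a + (?Bh + ?Bs) + ?Dw)) + (?h + ?s) \<bullet> (?R *\<^sub>v (?h + ?s))"
    unfolding horizon_cost_def Let_def applied_split[OF F] a_def by (simp add: mat_vec_add_right)
  also have "\<dots> = a \<bullet> (?Q *\<^sub>v a) + 2 * (a \<bullet> (?Q *\<^sub>v ?Bh) + a \<bullet> (?Q *\<^sub>v ?Bs))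
      + (?Bh \<bullet> (?Q *\<^sub>v ?Bh) + 2 * (?Bh \<bullet> (?Q *\<^sub>v ?Bs)) + ?Bs \<bullet> (?Q *\<^sub>v ?Bs))
      + 2 * (a \<bullet> (?Q *\<^sub>v ?Dw) + (?Bh \<bullet> (?Q *\<^sub>v ?Dw) + ?Bs \<bullet> (?Q *\<^sub>v ?Dw))) + ?Dw \<bullet> (?Q *\<^sub>v ?Dw)
      + (?h \<bullet> (?R *\<^sub>v ?h) + 2 * (?h \<bullet> (?R *\<^sub>v ?s)) + ?s \<bullet> (?R *\<^sub>v ?s))"
    by (simp add: form_square_add a) (simp add: form_add_left form_add_right a)
  also have "\<dots> = a \<bullet> (?Q *\<^sub>v a) + 2 * (a \<bullet> (?Q *\<^sub>v ?Bh)) + ?h \<bullet> (alpha P *\<^sub>v ?h)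
      + 2 * (?Bs \<bullet> (?Q *\<^sub>v ?Dw)) + ?Dw \<bullet> (?Q *\<^sub>v ?Dw) + ?s \<bullet> (alpha P *\<^sub>v ?s)
      + (2 * (a \<bullet> (?Q *\<^sub>v ?Bs)) + 2 * (a \<bullet> (?Q *\<^sub>v ?Dw)) + 2 * (?h \<bullet> (alpha P *\<^sub>v ?s)) + 2 * (?Bh \<bullet> (?Q *\<^sub>v ?Dw)))"
    by (simp add: alpha_form algebra_simps)
  also have "?Bs \<bullet> (?Q *\<^sub>v ?Dw) = evec P ws \<bullet> (((Theta F)\<^sup>T * (Smat P n)\<^sup>T * (calB P)\<^sup>T * ?Q * calD P) *\<^sub>v wvec P ws)"
    using F by (simp add: noise_part_def mat_vec_assoc form_adjoint)
  also have "?Dw \<bullet> (?Q *\<^sub>v ?Dw) = wvec P ws \<bullet> (((calD P)\<^sup>T * ?Q * calD P) *\<^sub>v wvec P ws)"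
    by (simp add: mat_vec_assoc form_adjoint)
  also have "?s \<bullet> (alpha P *\<^sub>v ?s) = evec P ws \<bullet> (((Theta F)\<^sup>T * ((Smat P n)\<^sup>T * alpha P * Smat P n) * Theta F) *\<^sub>v evec P ws)"
    using F by (simp add: noise_part_def mat_vec_assoc form_adjoint)
  also have "a \<bullet> (?Q *\<^sub>v ?Bs) = a \<bullet> ((?Q * calB P * Smat P n * Theta F) *\<^sub>v evec P ws)"
    using F by (simp add: noise_part_def mat_vec_assoc)
  also have "a \<bullet> (?Q *\<^sub>v ?Dw) = a \<bullet> ((?Q * calD P) *\<^sub>v wvec P ws)"
    by (simp add: mat_vec_assoc)
  also have "?h \<bullet> (alpha P *\<^sub>v ?s) = ?h \<bullet> ((alpha P * Smat P n * Theta F) *\<^sub>v evec P ws)"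
    using F by (simp add: noise_part_def mat_vec_assoc)
  also have "?Bh \<bullet> (?Q *\<^sub>v ?Dw) = ?h \<bullet> (((calB P)\<^sup>T * ?Q * calD P) *\<^sub>v wvec P ws)"
    by (simp add: mat_vec_assoc form_adjoint)
  finally show ?thesis .
qed

section \<open>The matrices of the program\<close>

lemma Lam_tilde_stack: "Lam_tilde P F = stack (map (\<lambda>l. (Cl P l)\<^sup>T *\<^sub>v Lam_col F l) [1..<horizon P])"
  by (simp add: Lam_tilde_def Lam_col_def)

lemma Cl_Lam_col:
  assumes F: "F \<in> policy_class P" and l: "l \<in> {1..<horizon P}"
  shows "Cl P l *\<^sub>v ((Cl P l)\<^sup>T *\<^sub>v Lam_col F l) = Lam_col F l"
proof (rule Cl_restore)
  fix i assume i: "i < udim P * l"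
  have *: "udim P * l \<le> usize P" using l by simp
  with i have "i < usize P" by linarith
  moreover have "\<not> l - 1 < i div udim P" using i l dims(2) 
    by (metis One_nat_def Suc_pred atLeastLessThan_iff div_less_iff_less_mult less_Suc_eq_le mult.commute not_less not_one_le_zero zero_less_iff_neq_zero)
  ultimately show "Lam_col F l $ i = 0" using F l policy_classD(3)[OF F] by (auto simp: Lam_col_def policy_class_def)
qed (use F l in \<open>auto simp: Lam_col_carrier\<close>)

abbreviation "tsize \<equiv> (\<Sum>l\<leftarrow>[1..<horizon P]. udim P * (horizon P - l))"

lemma Lam_tilde_carrier: "F \<in> policy_class P \<Longrightarrow> Lam_tilde P F \<in> carrier_vec tsize"
  unfolding Lam_tilde_stack by (rule stack_carrier) (auto intro!: carrier_vecI simp: Cl_eq)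

lemma expect_mat_carrier [simp]:
  "expect_mat P r c X \<in> carrier_mat r c" "dim_row (expect_mat P r c X) = r" "dim_col (expect_mat P r c X) = c"
  by (simp_all add: expect_mat_def)

text \<open>The common pattern of the block rows in \<open>\<L>\<close> and \<open>\<M>\<close>: the factors \<open>\<CC>\<^sub>l\<close> restore the columns of \<open>\<Lambda>\<close>.\<close>

lemma scalar_prod_Lam_tilde:
  assumes F: "F \<in> policy_class P" and u: "u \<in> carrier_vec r"
    and E: "\<And>l. E l \<in> carrier_mat r (usize P)"
  shows "u \<bullet> (hcat r (map (\<lambda>l. E l * Cl P l) [1..<horizon P]) *\<^sub>v Lam_tilde P F) = (\<Sum>l=1..<horizon P. u \<bullet> (E l *\<^sub>v Lam_col F l))"
    "hcat r (map (\<lambda>l. E l * Cl P l) [1..<horizon P]) \<in> carrier_mat r tsize"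
proof -
  have c: "E l * Cl P l \<in> carrier_mat r (udim P * (horizon P - l))" if "l \<in> set [1..<horizon P]" for l
    by (rule mult_carrier_mat[OF E]) (use that in auto)
  have d: "(Cl P l)\<^sup>T *\<^sub>v Lam_col F l \<in> carrier_vec (udim P * (horizon P - l))" if "l \<in> set [1..<horizon P]" for l
    using that by (intro carrier_vecI) (simp add: Cl_eq)
  have "u \<bullet> (hcat r (map (\<lambda>l. E l * Cl P l) [1..<horizon P]) *\<^sub>v Lam_tilde P F)
      = (\<Sum>l\<leftarrow>[1..<horizon P]. u \<bullet> ((E l * Cl P l) *\<^sub>v ((Cl P l)\<^sup>T *\<^sub>v Lam_col F l)))"
    unfolding Lam_tilde_stack by (rule scalar_prod_hcat[OF c d u])
  also have "\<dots> = (\<Sum>l=1..<horizon P. u \<bullet> ((E l * Cl P l) *\<^sub>v ((Cl P l)\<^sup>T *\<^sub>v Lam_col F l)))"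
    by (subst interv_sum_list_conv_sum_set_nat) simp
  also have "\<dots> = (\<Sum>l=1..<horizon P. u \<bullet> (E l *\<^sub>v Lam_col F l))"
  proof (rule sum.cong)
    fix l assume l: "l \<in> {1..<horizon P}"
    then have "(E l * Cl P l) *\<^sub>v ((Cl P l)\<^sup>T *\<^sub>v Lam_col F l) = E l *\<^sub>v (Cl P l *\<^sub>v ((Cl P l)\<^sup>T *\<^sub>v Lam_col F l))"
      by (intro assoc_mult_mat_vec[OF E Cl_carrier d]) auto
    then show "u \<bullet> ((E l * Cl P l) *\<^sub>v ((Cl P l)\<^sup>T *\<^sub>v Lam_col F l)) = u \<bullet> (E l *\<^sub>v Lam_col F l)"
      by (simp add: Cl_Lam_col[OF F l])
  qed simp
  finally show "u \<bullet> (hcat r (map (\<lambda>l. E l * Cl P l) [1..<horizon P]) *\<^sub>v Lam_tilde P F) = (\<Sum>l=1..<horizon P. u \<bullet> (E l *\<^sub>v Lam_col F l))" .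
  show "hcat r (map (\<lambda>l. E l * Cl P l) [1..<horizon P]) \<in> carrier_mat r tsize"
    by (rule hcat_carrier[OF c])
qed

abbreviation "mean_GS t l \<equiv> expect_mat P (usize P) (usize P) (\<lambda>\<omega>. (Gmat P (acks P t \<omega>))\<^sup>T * alpha P * Sl P l (acks P t \<omega>))"
abbreviation "mean_SS t n l \<equiv> expect_mat P (usize P) (usize P) (\<lambda>\<omega>. (Sl P n (acks P t \<omega>))\<^sup>T * alpha P * Sl P l (acks P t \<omega>))"
abbreviation "mean_S t l \<equiv> expect_mat P (usize P) (usize P) (\<lambda>\<omega>. Sl P l (acks P t \<omega>))"

lemma Sigma_Snl_form:
  assumes F: "F \<in> policy_class P"
  shows "Lam_tilde P F \<bullet> (Sigma_Snl P t *\<^sub>v Lam_tilde P F) = (\<Sum>n=1..<horizon P. \<Sum>l=1..<horizon P. Lam_col F n \<bullet> (mean_SS t n l *\<^sub>v Lam_col F l))"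
    "Sigma_Snl P t \<in> carrier_mat tsize tsize"
proof -
  let ?r = "\<lambda>n. udim P * (horizon P - n)"
  let ?H = "\<lambda>n. hcat (?r n) (map (\<lambda>l. (Cl P n)\<^sup>T * mean_SS t n l * Cl P l) [1..<horizon P])"
  have e: "(Cl P n)\<^sup>T * mean_SS t n l \<in> carrier_mat (?r n) (usize P)" if "n \<in> set [1..<horizon P]" for n l
    by (rule mult_carrier_mat[of _ _ "usize P"]) (use that in auto)
  have d: "(Cl P l)\<^sup>T *\<^sub>v Lam_col F l \<in> carrier_vec (?r l)" if "l \<in> set [1..<horizon P]" for l
    using that by (intro carrier_vecI) (simp add: Cl_eq)
  have c: "?H n \<in> carrier_mat (?r n) tsize" if "n \<in> set [1..<horizon P]" for n
    using scalar_prod_Lam_tilde(2)[OF F d[OF that] e[OF that]] .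
  show "Sigma_Snl P t \<in> carrier_mat tsize tsize"
    unfolding Sigma_Snl_def by (rule vcat_carrier[OF c])
  have "Lam_tilde P F \<bullet> (Sigma_Snl P t *\<^sub>v Lam_tilde P F) = (\<Sum>n\<leftarrow>[1..<horizon P]. ((Cl P n)\<^sup>T *\<^sub>v Lam_col F n) \<bullet> (?H n *\<^sub>v Lam_tilde P F))"
    unfolding Sigma_Snl_def using scalar_prod_vcat[OF c d Lam_tilde_carrier[OF F]] unfolding Lam_tilde_stack .
  also have "\<dots> = (\<Sum>n=1..<horizon P. ((Cl P n)\<^sup>T *\<^sub>v Lam_col F n) \<bullet> (?H n *\<^sub>v Lam_tilde P F))"
    by (subst interv_sum_list_conv_sum_set_nat) simp
  also have "\<dots> = (\<Sum>n=1..<horizon P. \<Sum>l=1..<horizon P. Lam_col F n \<bullet> (mean_SS t n l *\<^sub>v Lam_col F l))"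
  proof (rule sum.cong)
    fix n assume n: "n \<in> {1..<horizon P}"
    then have n': "n \<in> set [1..<horizon P]" by simp
    have "((Cl P n)\<^sup>T *\<^sub>v Lam_col F n) \<bullet> (((Cl P n)\<^sup>T * mean_SS t n l) *\<^sub>v Lam_col F l) = Lam_col F n \<bullet> (mean_SS t n l *\<^sub>v Lam_col F l)" for l
    proof -
      have "((Cl P n)\<^sup>T *\<^sub>v Lam_col F n) \<bullet> ((Cl P n)\<^sup>T *\<^sub>v (mean_SS t n l *\<^sub>v Lam_col F l))
          = (Cl P n *\<^sub>v ((Cl P n)\<^sup>T *\<^sub>v Lam_col F n)) \<bullet> (mean_SS t n l *\<^sub>v Lam_col F l)"
        using n by (intro form_adjoint[symmetric]) (simp_all add: Cl_eq)
      then show ?thesis using n F by (simp add: mat_vec_assoc Cl_eq Cl_Lam_col[OF F n, unfolded Cl_eq[OF less_imp_le, of n]])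
    qed
    then show "((Cl P n)\<^sup>T *\<^sub>v Lam_col F n) \<bullet> (?H n *\<^sub>v Lam_tilde P F) = (\<Sum>l=1..<horizon P. Lam_col F n \<bullet> (mean_SS t n l *\<^sub>v Lam_col F l))"
      unfolding scalar_prod_Lam_tilde(1)[OF F d[OF n'] e[OF n']] by (intro sum.cong) auto
  qed simp
  finally show "Lam_tilde P F \<bullet> (Sigma_Snl P t *\<^sub>v Lam_tilde P F) = (\<Sum>n=1..<horizon P. \<Sum>l=1..<horizon P. Lam_col F n \<bullet> (mean_SS t n l *\<^sub>v Lam_col F l))" .
qed

lemma calL_carrier: "calL P t \<in> carrier_mat (usize P + tsize) (usize P + tsize)"
  unfolding calL_def by (rule four_block_carrier_mat[OF _ Sigma_Snl_form(2)[OF zero_policy]]) (simp add: Sigma_G_def)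

lemma Xi_carrier: "F \<in> policy_class P \<Longrightarrow> Xi P F \<in> carrier_vec (usize P + tsize)"
  unfolding Xi_def using policy_classD(1) Lam_tilde_carrier by (intro append_carrier_vec) auto

lemma calL_form:
  assumes F: "F \<in> policy_class P"
  shows "Xi P F \<bullet> (calL P t *\<^sub>v Xi P F) = eta F \<bullet> (Sigma_G P t *\<^sub>v eta F)
    + 2 * (\<Sum>l=1..<horizon P. eta F \<bullet> (mean_GS t l *\<^sub>v Lam_col F l))
    + (\<Sum>n=1..<horizon P. \<Sum>l=1..<horizon P. Lam_col F n \<bullet> (mean_SS t n l *\<^sub>v Lam_col F l))"
proof -
  let ?e = "eta F" and ?l = "Lam_tilde P F" and ?G = "Sigma_G P t" and ?X = "Sigma_SGl P t" and ?S = "Sigma_Snl P t"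
  note e = policy_classD(1)[OF F] and l = Lam_tilde_carrier[OF F] and S = Sigma_Snl_form(2)[OF F, of t]
  have G: "?G \<in> carrier_mat (usize P) (usize P)" by (simp add: Sigma_G_def)
  have X: "?X \<in> carrier_mat (usize P) tsize" unfolding Sigma_SGl_def by (rule scalar_prod_Lam_tilde(2)[OF F e]) simp
  have XT: "?X\<^sup>T \<in> carrier_mat tsize (usize P)" using X by simp
  have "Xi P F \<bullet> (calL P t *\<^sub>v Xi P F) = (?e @\<^sub>v ?l) \<bullet> ((?G *\<^sub>v ?e + ?X *\<^sub>v ?l) @\<^sub>v (?X\<^sup>T *\<^sub>v ?e + ?S *\<^sub>v ?l))"
    unfolding Xi_def calL_def four_block_mat_mult_vec[OF G X XT S e l] ..
  also have "\<dots> = ?e \<bullet> (?G *\<^sub>v ?e + ?X *\<^sub>v ?l) + ?l \<bullet> (?X\<^sup>T *\<^sub>v ?e + ?S *\<^sub>v ?l)"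
    by (rule scalar_prod_append[OF e l]) (use G X S in \<open>auto intro: carrier_vecI\<close>)
  also have "\<dots> = ?e \<bullet> (?G *\<^sub>v ?e) + ?e \<bullet> (?X *\<^sub>v ?l) + (?l \<bullet> (?X\<^sup>T *\<^sub>v ?e) + ?l \<bullet> (?S *\<^sub>v ?l))"
    using G X S by (simp add: scalar_prod_add_right)
  also have "?l \<bullet> (?X\<^sup>T *\<^sub>v ?e) = ?e \<bullet> (?X *\<^sub>v ?l)"
    using X F l form_adjoint[of ?X ?l ?e] scalar_prod_commute[of ?e "?X *\<^sub>v ?l"] by simp
  also have "?e \<bullet> (?X *\<^sub>v ?l) = (\<Sum>l=1..<horizon P. ?e \<bullet> (mean_GS t l *\<^sub>v Lam_col F l))"
    unfolding Sigma_SGl_def by (rule scalar_prod_Lam_tilde(1)[OF F e]) simp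
  finally show ?thesis unfolding Sigma_Snl_form(1)[OF F] by simp
qed

lemma calM_form:
  assumes F: "F \<in> policy_class P" and a: "a \<in> carrier_vec (xsize P)"
  shows "(calM P t *\<^sub>v a) \<bullet> Xi P F = 2 * (((calB P)\<^sup>T *\<^sub>v (calQ P *\<^sub>v a)) \<bullet> (mu_G P t *\<^sub>v eta F)
    + (\<Sum>l=1..<horizon P. ((calB P)\<^sup>T *\<^sub>v (calQ P *\<^sub>v a)) \<bullet> (mean_S t l *\<^sub>v Lam_col F l)))"
    "calM P t \<in> carrier_mat (usize P + tsize) (xsize P)"
proof -
  let ?e = "eta F" and ?l = "Lam_tilde P F" and ?G = "mu_G P t" and ?X = "mu_Sl P t" and ?B = "calB P" and ?Q = "calQ P"
  let ?y = "?B\<^sup>T *\<^sub>v (?Q *\<^sub>v a)"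
  note e = policy_classD(1)[OF F] and l = Lam_tilde_carrier[OF F]
  have G: "?G \<in> carrier_mat (usize P) (usize P)" by (simp add: mu_G_def)
  have X: "?X \<in> carrier_mat (usize P) tsize" unfolding mu_Sl_def by (rule scalar_prod_Lam_tilde(2)[OF F e]) simp
  have QBG: "?Q * ?B * ?G \<in> carrier_mat (xsize P) (usize P)" and QBX: "?Q * ?B * ?X \<in> carrier_mat (xsize P) tsize"
    using G X by (auto intro!: carrier_matI)
  let ?K = "append_cols (?Q * ?B * ?G) (?Q * ?B * ?X)"
  have K: "?K \<in> carrier_mat (xsize P) (usize P + tsize)" by (rule append_cols_carrier[OF QBG QBX])
  show "calM P t \<in> carrier_mat (usize P + tsize) (xsize P)"
    unfolding calM_def using K by simp
  have *: "a \<bullet> ((?Q * ?B * Y) *\<^sub>v z) = ?y \<bullet> (Y *\<^sub>v z)" if "dim_row Y = usize P" "dim_col Y = dim_vec z" for Y z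
    using form_adjoint[of "?B\<^sup>T" "?Q *\<^sub>v a" "Y *\<^sub>v z"] form_adjoint[of ?Q a "?B *\<^sub>v (Y *\<^sub>v z)"] a that
    by (simp add: mat_vec_assoc)
  have "calM P t *\<^sub>v a = 2 \<cdot>\<^sub>v (?K\<^sup>T *\<^sub>v a)"
    unfolding calM_def using K a by (intro eq_vecI) auto
  then have "(calM P t *\<^sub>v a) \<bullet> Xi P F = 2 * ((?K\<^sup>T *\<^sub>v a) \<bullet> Xi P F)"
    using Xi_carrier[OF F] K a by simp
  also have "(?K\<^sup>T *\<^sub>v a) \<bullet> Xi P F = a \<bullet> (?K *\<^sub>v Xi P F)"
    by (rule transpose_vec_mult_scalar[OF K Xi_carrier[OF F] a])
  also have "\<dots> = a \<bullet> ((?Q * ?B * ?G) *\<^sub>v ?e) + a \<bullet> ((?Q * ?B * ?X) *\<^sub>v ?l)"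
    unfolding Xi_def append_cols_mult_vec[OF QBG QBX e l] by (rule scalar_prod_add_right) simp
  also have "\<dots> = ?y \<bullet> (?G *\<^sub>v ?e) + ?y \<bullet> (?X *\<^sub>v ?l)" using G X e l by (simp add: *)
  also have "?y \<bullet> (?X *\<^sub>v ?l) = (\<Sum>l=1..<horizon P. ?y \<bullet> (mean_S t l *\<^sub>v Lam_col F l))"
    unfolding mu_Sl_def by (rule scalar_prod_Lam_tilde(1)[OF F]) (simp_all add: carrier_vecI)
  finally show "(calM P t *\<^sub>v a) \<bullet> Xi P F = 2 * (?y \<bullet> (?G *\<^sub>v ?e) + (\<Sum>l=1..<horizon P. ?y \<bullet> (mean_S t l *\<^sub>v Lam_col F l)))" .
qed

end

section \<open>Measurability, independence and integrability\<close>

lemma measurable_borel_vec_index [measurable]: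
  assumes "i < n" shows "(\<lambda>v. v $ i) \<in> borel_measurable (borel_vec n)"
proof -
  have 1: "(\<lambda>v. \<lambda>i\<in>{..<n}. v $ i) \<in> borel_vec n \<rightarrow>\<^sub>M (\<Pi>\<^sub>M i\<in>{..<n}. (borel :: real measure))"
    unfolding borel_vec_def by (rule measurable_vimage_algebra1) (auto simp: space_PiM)
  have "(\<lambda>f. f i) \<in> (\<Pi>\<^sub>M i\<in>{..<n}. (borel :: real measure)) \<rightarrow>\<^sub>M borel"
    using assms by (intro measurable_component_singleton) simp
  from measurable_compose[OF 1 this] assms show ?thesis by simp
qed

lemma space_borel_vec [simp]: "space (borel_vec n) = carrier_vec n"
  by (simp add: borel_vec_def)

lemma measurable_borel_vecI:
  assumes "\<And>\<omega>. \<omega> \<in> space N \<Longrightarrow> f \<omega> \<in> carrier_vec n" "\<And>i. i < n \<Longrightarrow> (\<lambda>\<omega>. f \<omega> $ i) \<in> borel_measurable N"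
  shows "f \<in> N \<rightarrow>\<^sub>M borel_vec n"
  unfolding borel_vec_def
proof (rule measurable_vimage_algebra2)
  show "f \<in> space N \<rightarrow> carrier_vec n" using assms(1) by auto
  show "(\<lambda>x. \<lambda>i\<in>{..<n}. f x $ i) \<in> N \<rightarrow>\<^sub>M (\<Pi>\<^sub>M i\<in>{..<n}. borel)"
    using assms(2) by (intro measurable_restrict) auto
qed

text \<open>Independence of sigma-algebras, rather than of variables, is the form in which it is assumed for
  noise and channel and derived for past and future.\<close>

lemma (in prob_space) indep_set_integral_mult:
  fixes f g :: "'a \<Rightarrow> real"
  assumes ind: "indep_set (sets N) (sets A)" and space: "space N = space M" "space A = space M"
    and f: "f \<in> borel_measurable N" "integrable M f" and g: "g \<in> borel_measurable A" "integrable M g"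
  shows "integrable M (\<lambda>\<omega>. f \<omega> * g \<omega>)" "expectation (\<lambda>\<omega>. f \<omega> * g \<omega>) = expectation f * expectation g"
proof -
  have N: "sigma_sets (space M) {f -` B \<inter> space M | B. B \<in> sets borel} \<subseteq> sets N"
    using f(1) unfolding space(1)[symmetric] by (intro sets.sigma_sets_subset) (auto dest: measurable_sets)
  have A: "sigma_sets (space M) {g -` B \<inter> space M | B. B \<in> sets borel} \<subseteq> sets A"
    using g(1) unfolding space(2)[symmetric] by (intro sets.sigma_sets_subset) (auto dest: measurable_sets)
  have "indep_var borel f borel g"
    unfolding indep_var_eq
  proof (intro conjI)
    show "f \<in> borel_measurable M" "g \<in> borel_measurable M" using f g by auto
    show "indep_set (sigma_sets (space M) {f -` B \<inter> space M | B. B \<in> sets borel})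
        (sigma_sets (space M) {g -` B \<inter> space M | B. B \<in> sets borel})"
      using ind N A unfolding indep_sets2_eq by blast
  qed
  then show "integrable M (\<lambda>\<omega>. f \<omega> * g \<omega>)" "expectation (\<lambda>\<omega>. f \<omega> * g \<omega>) = expectation f * expectation g"
    using f(2) g(2) by (auto intro: indep_var_integrable indep_var_lebesgue_integral)
qed

lemma (in finite_measure) square_integrable_mult:
  fixes f g :: "'a \<Rightarrow> real"
  assumes "f \<in> borel_measurable M" "g \<in> borel_measurable M" "integrable M (\<lambda>x. (f x)\<^sup>2)" "integrable M (\<lambda>x. (g x)\<^sup>2)"
  shows "integrable M (\<lambda>x. f x * g x)"
proof (rule Bochner_Integration.integrable_bound)
  show "integrable M (\<lambda>x. (f x)\<^sup>2 + (g x)\<^sup>2)" using assms by simp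
  show "AE x in M. norm (f x * g x) \<le> norm ((f x)\<^sup>2 + (g x)\<^sup>2)"
  proof (intro AE_I2)
    fix x
    have "0 \<le> (\<bar>f x\<bar> - \<bar>g x\<bar>)\<^sup>2" by simp
    then have "2 * (\<bar>f x\<bar> * \<bar>g x\<bar>) \<le> (f x)\<^sup>2 + (g x)\<^sup>2" by (simp add: power2_diff)
    moreover have "0 \<le> \<bar>f x\<bar> * \<bar>g x\<bar>" by simp
    ultimately have "\<bar>f x\<bar> * \<bar>g x\<bar> \<le> (f x)\<^sup>2 + (g x)\<^sup>2" by linarith
    then show "norm (f x * g x) \<le> norm ((f x)\<^sup>2 + (g x)\<^sup>2)" by (simp add: abs_mult)
  qed
qed (use assms in measurable)

text \<open>Functions that depend on the channel values of the horizon only. As these are zeros and ones, such a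
  function takes finitely many values, which makes it measurable and bounded whatever its form. The
  integrability of everything built from \<open>\<G>\<close>, \<open>\<S>\<close> and \<open>\<S>\<^sub>l\<close> comes from here.\<close>

definition ack_local :: "'a system \<Rightarrow> ((nat \<Rightarrow> real) \<Rightarrow> 'b) \<Rightarrow> bool" where
  "ack_local P \<Phi> \<longleftrightarrow> (\<forall>n n'. (\<forall>l<horizon P. n l = n' l) \<longrightarrow> \<Phi> n = \<Phi> n')"

text \<open>The probabilistic hypotheses from which the expectations are computed.\<close>

locale stochastic_plant = plant P + prob_space "system.prob P" for P :: "'a system" +
  assumes ack_indep: "indep_vars (\<lambda>_. borel) (ack P) UNIV"
    and ack_01: "\<And>s \<omega>. \<omega> \<in> space (system.prob P) \<Longrightarrow> ack P s \<omega> \<in> {0, 1}"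
    and noise_indep: "indep_vars (\<lambda>_. borel_vec (xdim P)) (noise P) UNIV"
    and noise_sym: "\<And>s. distr (system.prob P) (borel_vec (xdim P)) (\<lambda>\<omega>. - noise P s \<omega>)
             = distr (system.prob P) (borel_vec (xdim P)) (noise P s)"
    and noise_L2: "\<And>s i. i < xdim P \<Longrightarrow> integrable (system.prob P) (\<lambda>\<omega>. (noise P s \<omega> $ i)\<^sup>2)"
    and noise_mean: "\<And>s i. i < xdim P \<Longrightarrow> expectation (\<lambda>\<omega>. noise P s \<omega> $ i) = 0"
    and noise_ack: "indep_set
      (sets (vimage_algebra (space (system.prob P)) (\<lambda>\<omega> s. noise P s \<omega>) (\<Pi>\<^sub>M s\<in>UNIV. borel_vec (xdim P))))
      (sets (vimage_algebra (space (system.prob P)) (\<lambda>\<omega> s. ack P s \<omega>) (\<Pi>\<^sub>M s\<in>UNIV. borel)))"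
    and sat_meas: "\<And>i j. sat P i j \<in> borel_measurable borel"
    and sat_odd: "\<And>i j r. sat P i j (- r) = - sat P i j r"
    and sat_bound: "\<And>s \<omega>. \<omega> \<in> space (system.prob P) \<Longrightarrow> linf (evec P (noises P s \<omega>)) \<le> phimax P"
begin

abbreviation "M \<equiv> system.prob P"

abbreviation has_mean :: "('a \<Rightarrow> real) \<Rightarrow> real \<Rightarrow> bool" where
  "has_mean \<equiv> has_bochner_integral M"

definition "noise_algebra = vimage_algebra (space M) (\<lambda>\<omega> s. noise P s \<omega>) (\<Pi>\<^sub>M s\<in>UNIV. borel_vec (xdim P))"
definition "ack_algebra = vimage_algebra (space M) (\<lambda>\<omega> s. ack P s \<omega>) (\<Pi>\<^sub>M s\<in>UNIV. (borel :: real measure))"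

lemma noise_ack_algebras: "indep_set (sets noise_algebra) (sets ack_algebra)" "space noise_algebra = space M" "space ack_algebra = space M"
  using noise_ack by (simp_all add: noise_algebra_def ack_algebra_def)

lemma ack_measurable [measurable]: "ack P s \<in> borel_measurable M"
  using ack_indep by (auto simp: indep_vars_def)

lemma noise_measurable [measurable]: "noise P s \<in> M \<rightarrow>\<^sub>M borel_vec (xdim P)"
  using noise_indep by (auto simp: indep_vars_def)

lemma noise_carrier: "\<omega> \<in> space M \<Longrightarrow> noise P s \<omega> \<in> carrier_vec (xdim P)"
  using measurable_space[OF noise_measurable] by simp

lemma noise_algebra_measurable: "noise P s \<in> noise_algebra \<rightarrow>\<^sub>M borel_vec (xdim P)"
proof -
  have 1: "(\<lambda>\<omega> s. noise P s \<omega>) \<in> noise_algebra \<rightarrow>\<^sub>M (\<Pi>\<^sub>M s\<in>UNIV. borel_vec (xdim P))"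
    unfolding noise_algebra_def by (rule measurable_vimage_algebra1) (auto simp: space_PiM noise_carrier)
  show ?thesis using measurable_compose[OF 1 measurable_component_singleton[of s]] by simp
qed

lemma ack_algebra_measurable: "ack P s \<in> borel_measurable ack_algebra"
proof -
  have 1: "(\<lambda>\<omega> s. ack P s \<omega>) \<in> ack_algebra \<rightarrow>\<^sub>M (\<Pi>\<^sub>M s\<in>UNIV. borel)"
    unfolding ack_algebra_def by (rule measurable_vimage_algebra1) (auto simp: space_PiM)
  show ?thesis using measurable_compose[OF 1 measurable_component_singleton[of s]] by simp
qed

lemma phimax_nonneg: "0 \<le> phimax P"
proof -
  obtain \<omega> where "\<omega> \<in> space M" using not_empty by blast
  from sat_bound[OF this, of 0] show ?thesis using linf_nonneg order_trans by blast
qed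

section \<open>Functions of the channel\<close>

definition pattern :: "nat \<Rightarrow> (nat \<Rightarrow> real) \<Rightarrow> 'a \<Rightarrow> real" where
  "pattern t n \<omega> = (\<Prod>l<horizon P. if ack P (t + l) \<omega> = n l then 1 else 0)"

text \<open>A sum over the finitely many channel patterns \<open>n\<close>, in which \<open>pattern\<close> is the indicator of the event
  that the pattern occurs.\<close>

lemma ack_local_expand:
  fixes \<Phi> :: "(nat \<Rightarrow> real) \<Rightarrow> real"
  assumes \<Phi>: "ack_local P \<Phi>" and \<omega>: "\<omega> \<in> space M"
  shows "\<Phi> (acks P t \<omega>) = (\<Sum>n\<in>{..<horizon P} \<rightarrow>\<^sub>E {0, 1}. \<Phi> n * pattern t n \<omega>)"
proof -
  let ?A = "{..<horizon P} \<rightarrow>\<^sub>E {0, 1::real}"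
  define r where "r = restrict (acks P t \<omega>) {..<horizon P}"
  have r: "r \<in> ?A" using ack_01[OF \<omega>] by (auto simp: r_def acks_def)
  have "pattern t n \<omega> = (if n = r then 1 else 0)" if n: "n \<in> ?A" for n
  proof (cases "n = r")
    case True then show ?thesis by (auto simp: pattern_def r_def acks_def intro!: prod.neutral)
  next
    case False
    then obtain l where "l < horizon P" "n l \<noteq> r l" using n r by (metis PiE_ext lessThan_iff)
    then have "pattern t n \<omega> = 0" unfolding pattern_def
      by (intro prod_zero) (auto simp: r_def acks_def intro!: bexI[of _ l])
    with False show ?thesis by simp
  qed
  then have "(\<Sum>n\<in>?A. \<Phi> n * pattern t n \<omega>) = (\<Sum>n\<in>?A. if n = r then \<Phi> r else 0)"
    by (intro sum.cong) auto
  also have "\<dots> = \<Phi> r" using r by (simp add: finite_PiE)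
  also have "\<dots> = \<Phi> (acks P t \<omega>)" using \<Phi> by (auto simp: ack_local_def r_def)
  finally show ?thesis ..
qed

lemma ack_local_measurable:
  fixes \<Phi> :: "(nat \<Rightarrow> real) \<Rightarrow> real"
  assumes \<Phi>: "ack_local P \<Phi>" and sp: "space N = space M" and m: "\<And>l. l < horizon P \<Longrightarrow> ack P (t + l) \<in> borel_measurable N"
  shows "(\<lambda>\<omega>. \<Phi> (acks P t \<omega>)) \<in> borel_measurable N"
proof -
  have "(\<lambda>\<omega>. \<Sum>n\<in>{..<horizon P} \<rightarrow>\<^sub>E {0, 1}. \<Phi> n * pattern t n \<omega>) \<in> borel_measurable N"
    unfolding pattern_def using m by (intro borel_measurable_sum borel_measurable_times borel_measurable_prod measurable_If pred_eq_const1 borel_measurable_const) auto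
  then show ?thesis
    by (subst measurable_cong[OF ack_local_expand[OF \<Phi>]]) (simp_all add: sp)
qed

lemma ack_local_bounded:
  fixes \<Phi> :: "(nat \<Rightarrow> real) \<Rightarrow> real"
  assumes \<Phi>: "ack_local P \<Phi>"
  obtains B where "\<And>\<omega>. \<omega> \<in> space M \<Longrightarrow> \<bar>\<Phi> (acks P t \<omega>)\<bar> \<le> B"
proof
  fix \<omega> assume \<omega>: "\<omega> \<in> space M"
  have "\<bar>\<Phi> (acks P t \<omega>)\<bar> \<le> (\<Sum>n\<in>{..<horizon P} \<rightarrow>\<^sub>E {0, 1}. \<bar>\<Phi> n * pattern t n \<omega>\<bar>)"
    unfolding ack_local_expand[OF \<Phi> \<omega>] by (rule sum_abs)
  also have "\<dots> \<le> (\<Sum>n\<in>{..<horizon P} \<rightarrow>\<^sub>E {0, 1}. \<bar>\<Phi> n\<bar>)"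
  proof (rule sum_mono)
    fix n
    have "pattern t n \<omega> \<le> 1" "0 \<le> pattern t n \<omega>" unfolding pattern_def by (auto intro: prod_le_1 prod_nonneg)
    then show "\<bar>\<Phi> n * pattern t n \<omega>\<bar> \<le> \<bar>\<Phi> n\<bar>"
      by (simp only: abs_mult abs_of_nonneg) (rule mult_left_le, auto)
  qed
  finally show "\<bar>\<Phi> (acks P t \<omega>)\<bar> \<le> (\<Sum>n\<in>{..<horizon P} \<rightarrow>\<^sub>E {0, 1}. \<bar>\<Phi> n\<bar>)" .
qed

lemma ack_local_integrable:
  fixes \<Phi> :: "(nat \<Rightarrow> real) \<Rightarrow> real"
  assumes \<Phi>: "ack_local P \<Phi>"
  shows "integrable M (\<lambda>\<omega>. \<Phi> (acks P t \<omega>))"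
proof -
  obtain B where B: "\<And>\<omega>. \<omega> \<in> space M \<Longrightarrow> \<bar>\<Phi> (acks P t \<omega>)\<bar> \<le> B" using ack_local_bounded[OF \<Phi>] by blast
  show ?thesis
    by (rule integrable_const_bound[of _ B]) (auto intro!: B ack_local_measurable[OF \<Phi>])
qed

lemma received_cong: "(\<And>s. s \<le> l \<Longrightarrow> n s = n' s) \<Longrightarrow> received n l = received n' l"
  unfolding received_eq by (intro arg_cong2[where f=minus] refl prod.cong) auto

lemma gains_local: "i < usize P \<Longrightarrow> ack_local P (\<lambda>n. offset_gain P n i)" "i < usize P \<Longrightarrow> ack_local P (\<lambda>n. feedback_gain P n i)"
  using horizon by (auto simp: ack_local_def offset_gain_def feedback_gain_def intro!: received_cong)

lemma matrices_local:
  "ack_local P (Gmat P)" "ack_local P (Smat P)" "l \<in> {1..<horizon P} \<Longrightarrow> ack_local P (Sl P l)" "ack_local P (ack_part F)"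
proof -
  have G: "Gmat P n = Gmat P n'" and S: "Smat P n = Smat P n'" if "\<forall>l<horizon P. n l = n' l" for n n'
    using that gains_local unfolding Gmat_diagonal[OF dims(2)] Smat_diagonal[OF dims(2) horizon(3)]
    by (auto simp: diagonal_def ack_local_def intro!: eq_matI)
  show "ack_local P (Gmat P)" "ack_local P (Smat P)" using G S by (auto simp: ack_local_def)
  show "ack_local P (Sl P l)" if "l \<in> {1..<horizon P}" unfolding ack_local_def
  proof (intro allI impI)
    fix n n' :: "nat \<Rightarrow> real" assume n: "\<forall>l<horizon P. n l = n' l"
    then have "n (l - 1) = n' (l - 1)" using that by auto
    with S[OF n] show "Sl P l n = Sl P l n'" by (simp add: Sl_def)
  qed
  show "ack_local P (ack_part F)" unfolding ack_local_def
  proof (intro allI impI)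
    fix n n' :: "nat \<Rightarrow> real" assume n: "\<forall>l<horizon P. n l = n' l"
    then have "vec (horizon P - 1) n = vec (horizon P - 1) n'" by auto
    with G[OF n] S[OF n] show "ack_part F n = ack_part F n'" by (simp add: ack_part_def)
  qed
qed

lemma ack_local_comp: "ack_local P g \<Longrightarrow> ack_local P (\<lambda>n. f (g n))"
  unfolding ack_local_def by metis

lemma ack_local_comp2: "ack_local P g \<Longrightarrow> ack_local P h \<Longrightarrow> ack_local P (\<lambda>n. f (g n) (h n))"
  unfolding ack_local_def by metis

lemma ack_local_const: "ack_local P (\<lambda>_. c)"
  by (simp add: ack_local_def)

text \<open>Expectations of forms lead back to the expectations of matrices that define the program.\<close>

lemma expect_mat_form:
  assumes \<Phi>: "ack_local P \<Phi>" "\<And>n. \<Phi> n \<in> carrier_mat k k'" and u: "u \<in> carrier_vec k" and v: "v \<in> carrier_vec k'"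
  shows "has_mean (\<lambda>\<omega>. u \<bullet> (\<Phi> (acks P t \<omega>) *\<^sub>v v)) (u \<bullet> (expect_mat P k k' (\<lambda>\<omega>. \<Phi> (acks P t \<omega>)) *\<^sub>v v))"
proof -
  have "has_mean (\<lambda>\<omega>. \<Sum>i<k. \<Sum>j<k'. u $ i * \<Phi> (acks P t \<omega>) $$ (i, j) * v $ j)
      (\<Sum>i<k. \<Sum>j<k'. u $ i * expectation (\<lambda>\<omega>. \<Phi> (acks P t \<omega>) $$ (i, j)) * v $ j)"
    by (intro has_bochner_integral_sum has_bochner_integral_mult_left has_bochner_integral_mult_right
        has_bochner_integral_integrable ack_local_integrable[OF ack_local_comp[OF \<Phi>(1)]])
  also have "(\<Sum>i<k. \<Sum>j<k'. u $ i * expectation (\<lambda>\<omega>. \<Phi> (acks P t \<omega>) $$ (i, j)) * v $ j)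
      = u \<bullet> (expect_mat P k k' (\<lambda>\<omega>. \<Phi> (acks P t \<omega>)) *\<^sub>v v)"
    unfolding form_double_sum[OF expect_mat_carrier(1) u v] by (intro sum.cong) (auto simp: expect_mat_def)
  finally show ?thesis unfolding form_double_sum[OF \<Phi>(2) u v] .
qed

lemma expect_mat_mult_right:
  assumes \<Phi>: "ack_local P \<Phi>" "\<And>n. \<Phi> n \<in> carrier_mat r k" and K: "K \<in> carrier_mat k c"
  shows "expect_mat P r c (\<lambda>\<omega>. \<Phi> (acks P t \<omega>) * K) = expect_mat P r k (\<lambda>\<omega>. \<Phi> (acks P t \<omega>)) * K"
proof (rule eq_matI)
  fix i j assume "i < dim_row (expect_mat P r k (\<lambda>\<omega>. \<Phi> (acks P t \<omega>)) * K)" "j < dim_col (expect_mat P r k (\<lambda>\<omega>. \<Phi> (acks P t \<omega>)) * K)"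
  then have ij: "i < r" "j < c" using K by (simp_all add: expect_mat_def)
  have [simp]: "dim_row (\<Phi> n) = r" "dim_col (\<Phi> n) = k" for n using \<Phi>(2)[of n] by auto
  have i: "integrable M (\<lambda>\<omega>. \<Phi> (acks P t \<omega>) $$ (i, l))" for l
    by (rule ack_local_integrable[OF ack_local_comp[OF \<Phi>(1)]])
  have "expect_mat P r c (\<lambda>\<omega>. \<Phi> (acks P t \<omega>) * K) $$ (i, j) = expectation (\<lambda>\<omega>. \<Sum>l\<in>{0..<k}. \<Phi> (acks P t \<omega>) $$ (i, l) * K $$ (l, j))"
    using ij K by (simp add: expect_mat_def scalar_prod_def)
  also have "\<dots> = (\<Sum>l\<in>{0..<k}. expectation (\<lambda>\<omega>. \<Phi> (acks P t \<omega>) $$ (i, l)) * K $$ (l, j))"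
    using i by simp
  also have "\<dots> = (expect_mat P r k (\<lambda>\<omega>. \<Phi> (acks P t \<omega>)) * K) $$ (i, j)"
    using ij K by (simp add: expect_mat_def scalar_prod_def)
  finally show "expect_mat P r c (\<lambda>\<omega>. \<Phi> (acks P t \<omega>) * K) $$ (i, j) = (expect_mat P r k (\<lambda>\<omega>. \<Phi> (acks P t \<omega>)) * K) $$ (i, j)" .
qed (use K in \<open>simp_all add: expect_mat_def\<close>)

lemma expect_mat_transpose:
  assumes \<Phi>: "\<And>n. \<Phi> n \<in> carrier_mat r c"
  shows "expect_mat P c r (\<lambda>\<omega>. (\<Phi> (acks P t \<omega>))\<^sup>T) = (expect_mat P r c (\<lambda>\<omega>. \<Phi> (acks P t \<omega>)))\<^sup>T"
proof -
  have [simp]: "dim_row (\<Phi> n) = r" "dim_col (\<Phi> n) = c" for n using \<Phi>[of n] by auto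
  show ?thesis by (rule eq_matI) (auto simp: expect_mat_def)
qed

lemma expect_mat_mult_left:
  assumes \<Phi>: "ack_local P \<Phi>" "\<And>n. \<Phi> n \<in> carrier_mat k c" and K: "K \<in> carrier_mat r k"
  shows "expect_mat P r c (\<lambda>\<omega>. K * \<Phi> (acks P t \<omega>)) = K * expect_mat P k c (\<lambda>\<omega>. \<Phi> (acks P t \<omega>))"
proof -
  have "ack_local P (\<lambda>n. (\<Phi> n)\<^sup>T)" "(\<Phi> n)\<^sup>T \<in> carrier_mat c k" "K\<^sup>T \<in> carrier_mat k r" "K * \<Phi> n \<in> carrier_mat r c" for n
    using \<Phi> K by (auto intro: ack_local_comp)
  note right = expect_mat_mult_right[OF this(1-3), of t] and KF = this(4)
  have "(K * \<Phi> n)\<^sup>T = (\<Phi> n)\<^sup>T * K\<^sup>T" for n by (rule transpose_mult[OF K \<Phi>(2)])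
  then have "(expect_mat P r c (\<lambda>\<omega>. K * \<Phi> (acks P t \<omega>)))\<^sup>T = (expect_mat P k c (\<lambda>\<omega>. \<Phi> (acks P t \<omega>)))\<^sup>T * K\<^sup>T"
    using expect_mat_transpose[where \<Phi> = "\<lambda>n. K * \<Phi> n", OF KF, of t] expect_mat_transpose[where \<Phi> = \<Phi> and t = t, OF \<Phi>(2)] right by simp
  also have "\<dots> = (K * expect_mat P k c (\<lambda>\<omega>. \<Phi> (acks P t \<omega>)))\<^sup>T" by (rule transpose_mult[OF K expect_mat_carrier(1), symmetric])
  finally show ?thesis by (metis transpose_transpose)
qed

section \<open>The noise and the saturated noise\<close>

lemma noise_index_div: "c < k * xdim P \<Longrightarrow> c div xdim P < k" "c mod xdim P < xdim P"
  using dims by (simp_all add: div_less_iff_less_mult)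

lemma wvec_index: "c < wsize P \<Longrightarrow> wvec P ws $ c = ws (c div xdim P) $ (c mod xdim P)"
  by (simp add: wvec_def block_vec_def wsize_def mult.commute)

lemma evec_index: "c < esize P \<Longrightarrow> evec P ws $ c = sat P (Suc (c div xdim P)) (c mod xdim P) (ws (c div xdim P) $ (c mod xdim P))"
  using dims by (simp add: evec_def block_vec_def esize_def mult.commute)

lemma noise_entry_measurable:
  assumes "\<And>l. l < horizon P \<Longrightarrow> noise P (t + l) \<in> N \<rightarrow>\<^sub>M borel_vec (xdim P)"
  shows "c < wsize P \<Longrightarrow> (\<lambda>\<omega>. wvec P (noises P t \<omega>) $ c) \<in> borel_measurable N"
    "c < esize P \<Longrightarrow> (\<lambda>\<omega>. evec P (noises P t \<omega>) $ c) \<in> borel_measurable N"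
proof -
  have *: "(\<lambda>\<omega>. noise P (t + c div xdim P) \<omega> $ (c mod xdim P)) \<in> borel_measurable N" if "c div xdim P < horizon P"
    by (rule measurable_compose[OF assms[OF that] measurable_borel_vec_index]) (use dims in simp)
  show "(\<lambda>\<omega>. wvec P (noises P t \<omega>) $ c) \<in> borel_measurable N" if c: "c < wsize P"
    using * noise_index_div(1)[of c "horizon P"] c by (simp add: wvec_index noises_def wsize_def mult.commute)
  show "(\<lambda>\<omega>. evec P (noises P t \<omega>) $ c) \<in> borel_measurable N" if c: "c < esize P"
  proof -
    have "c div xdim P < horizon P - 1" using noise_index_div(1)[of c "horizon P - 1"] c by (simp add: esize_def mult.commute)
    then have "c div xdim P < horizon P" by simp
    from measurable_compose[OF *[OF this] sat_meas] show ?thesis using c by (simp add: evec_index noises_def)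
  qed
qed

lemma wvec_L2: "c < wsize P \<Longrightarrow> integrable M (\<lambda>\<omega>. (wvec P (noises P t \<omega>) $ c)\<^sup>2)"
  using noise_L2[OF noise_index_div(2)] by (simp add: wvec_index noises_def)

lemma evec_bound: "\<omega> \<in> space M \<Longrightarrow> c < esize P \<Longrightarrow> \<bar>evec P (noises P t \<omega>) $ c\<bar> \<le> phimax P"
  using sat_bound[of \<omega> t] phimax_nonneg carriers(5)[of "noises P t \<omega>"] by (simp add: linf_le_iff)

lemma noise_entries_measurable [measurable]:
  "c < wsize P \<Longrightarrow> (\<lambda>\<omega>. wvec P (noises P t \<omega>) $ c) \<in> borel_measurable M"
  "c < esize P \<Longrightarrow> (\<lambda>\<omega>. evec P (noises P t \<omega>) $ c) \<in> borel_measurable M"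
  by (rule noise_entry_measurable, auto)+

lemma evec_L2: "c < esize P \<Longrightarrow> integrable M (\<lambda>\<omega>. (evec P (noises P t \<omega>) $ c)\<^sup>2)"
proof (rule integrable_const_bound[of _ "(phimax P)\<^sup>2"])
  assume c: "c < esize P"
  show "AE x in M. norm ((evec P (noises P t x) $ c)\<^sup>2) \<le> (phimax P)\<^sup>2"
    using evec_bound[OF _ c] by (intro AE_I2) (auto simp: abs_le_square_iff[symmetric] phimax_nonneg)
qed measurable

lemma wvec_mean: "c < wsize P \<Longrightarrow> has_mean (\<lambda>\<omega>. wvec P (noises P t \<omega>) $ c) 0"
  using noise_mean[OF noise_index_div(2)] square_integrable_imp_integrable[OF noise_entries_measurable(1) wvec_L2]
  by (simp add: has_bochner_integral_iff wvec_index noises_def)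

text \<open>An odd function of a symmetrically distributed vector has mean zero.\<close>

lemma evec_mean:
  assumes c: "c < esize P" shows "has_mean (\<lambda>\<omega>. evec P (noises P t \<omega>) $ c) 0"
proof -
  let ?s = "t + c div xdim P" and ?j = "c mod xdim P"
  let ?f = "\<lambda>v. sat P (Suc (c div xdim P)) ?j (v $ ?j)"
  have j: "?j < xdim P" by (rule noise_index_div)
  have f [measurable]: "?f \<in> borel_measurable (borel_vec (xdim P))"
    by (rule measurable_compose[OF measurable_borel_vec_index[OF j] sat_meas])
  have neg: "(\<lambda>\<omega>. - noise P ?s \<omega>) \<in> M \<rightarrow>\<^sub>M borel_vec (xdim P)"
  proof (rule measurable_borel_vecI)
    fix i assume i: "i < xdim P"
    have "(\<lambda>\<omega>. noise P ?s \<omega> $ i) \<in> borel_measurable M"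
      by (rule measurable_compose[OF noise_measurable measurable_borel_vec_index[OF i]])
    then have "(\<lambda>\<omega>. - (noise P ?s \<omega> $ i)) \<in> borel_measurable M" by simp
    moreover have "(- noise P ?s \<omega>) $ i = - (noise P ?s \<omega> $ i)" if "\<omega> \<in> space M" for \<omega>
      using noise_carrier[OF that, of ?s] i by simp
    moreover have "(\<lambda>\<omega>. (- noise P ?s \<omega>) $ i) \<in> borel_measurable M \<longleftrightarrow> (\<lambda>\<omega>. - (noise P ?s \<omega> $ i)) \<in> borel_measurable M"
      by (rule measurable_cong) fact
    ultimately show "(\<lambda>\<omega>. (- noise P ?s \<omega>) $ i) \<in> borel_measurable M" by blast
  qed (use noise_carrier in auto)
  have "expectation (\<lambda>\<omega>. ?f (noise P ?s \<omega>)) = integral\<^sup>L (distr M (borel_vec (xdim P)) (noise P ?s)) ?f"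
    by (rule integral_distr[symmetric]) measurable
  also have "\<dots> = integral\<^sup>L (distr M (borel_vec (xdim P)) (\<lambda>\<omega>. - noise P ?s \<omega>)) ?f"
    by (simp add: noise_sym)
  also have "\<dots> = expectation (\<lambda>\<omega>. ?f (- noise P ?s \<omega>))"
    by (rule integral_distr[OF neg f])
  also have "\<dots> = expectation (\<lambda>\<omega>. - ?f (noise P ?s \<omega>))"
  proof (rule Bochner_Integration.integral_cong)
    fix \<omega> assume "\<omega> \<in> space M"
    from noise_carrier[OF this, of ?s] j show "?f (- noise P ?s \<omega>) = - ?f (noise P ?s \<omega>)"
      by (simp add: sat_odd)
  qed simp
  finally have "expectation (\<lambda>\<omega>. ?f (noise P ?s \<omega>)) = 0" by simp
  then show ?thesis
    using c square_integrable_imp_integrable[OF noise_entries_measurable(2) evec_L2, OF c c]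
    by (simp add: has_bochner_integral_iff evec_index noises_def)
qed

section \<open>Expectations of the terms of the cost\<close>

lemma ack_noise_mult:
  assumes \<Phi>: "ack_local P \<Phi>" and g: "g \<in> borel_measurable noise_algebra" "has_mean g c"
  shows "has_mean (\<lambda>\<omega>. \<Phi> (acks P t \<omega>) * g \<omega>) (expectation (\<lambda>\<omega>. \<Phi> (acks P t \<omega>)) * c)"
  using indep_set_integral_mult[OF noise_ack_algebras g(1) _ ack_local_measurable[OF \<Phi> noise_ack_algebras(3) ack_algebra_measurable] ack_local_integrable[OF \<Phi>], of t] g(2)
  by (simp add: has_bochner_integral_iff mult.commute)

text \<open>The factor \<open>z\<close> is the noise or the saturated noise, and the other factors depend on the channel,
  which is independent of it.\<close>

lemma noise_form_mean_zero:
  assumes h: "ack_local P h" "\<And>n. h n \<in> carrier_vec k" and \<Phi>: "ack_local P \<Phi>" "\<And>n. \<Phi> n \<in> carrier_mat k k'"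
    and z: "\<And>\<omega>. z \<omega> \<in> carrier_vec k'" "\<And>j. j < k' \<Longrightarrow> (\<lambda>\<omega>. z \<omega> $ j) \<in> borel_measurable noise_algebra"
      "\<And>j. j < k' \<Longrightarrow> has_mean (\<lambda>\<omega>. z \<omega> $ j) 0"
  shows "has_mean (\<lambda>\<omega>. h (acks P t \<omega>) \<bullet> (\<Phi> (acks P t \<omega>) *\<^sub>v z \<omega>)) 0"
proof -
  have l: "ack_local P (\<lambda>n. h n $ i * \<Phi> n $$ (i, j))" for i j
    by (rule ack_local_comp2[OF h(1) \<Phi>(1)])
  have "has_mean (\<lambda>\<omega>. \<Sum>i<k. \<Sum>j<k'. h (acks P t \<omega>) $ i * \<Phi> (acks P t \<omega>) $$ (i, j) * z \<omega> $ j)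
      (\<Sum>i<k. \<Sum>j<k'. expectation (\<lambda>\<omega>. h (acks P t \<omega>) $ i * \<Phi> (acks P t \<omega>) $$ (i, j)) * 0)"
    by (intro has_bochner_integral_sum ack_noise_mult[OF l] z) simp_all
  then show ?thesis unfolding form_double_sum[OF \<Phi>(2) h(2) z(1)] by simp
qed

text \<open>Entry by entry, \<open>y \<bullet> X z\<close> is a sum of products of an entry of \<open>X\<close>, which depends on the channel, and
  an entry of \<open>z y\<^sup>T\<close>, which depends on the noise; independence separates the two means, and the sum of
  their products is the trace.\<close>

lemma noise_form_trace:
  assumes \<Phi>: "ack_local P \<Phi>" "\<And>n. \<Phi> n \<in> carrier_mat k k'"
    and y: "\<And>\<omega>. y \<omega> \<in> carrier_vec k" and z: "\<And>\<omega>. z \<omega> \<in> carrier_vec k'"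
    and yz: "\<And>i j. i < k \<Longrightarrow> j < k' \<Longrightarrow> (\<lambda>\<omega>. y \<omega> $ i * z \<omega> $ j) \<in> borel_measurable noise_algebra"
      "\<And>i j. i < k \<Longrightarrow> j < k' \<Longrightarrow> integrable M (\<lambda>\<omega>. y \<omega> $ i * z \<omega> $ j)"
  shows "has_mean (\<lambda>\<omega>. y \<omega> \<bullet> (\<Phi> (acks P t \<omega>) *\<^sub>v z \<omega>))
      (tr_mat (expect_mat P k k' (\<lambda>\<omega>. \<Phi> (acks P t \<omega>)) * expect_mat P k' k (\<lambda>\<omega>. outer (z \<omega>) (y \<omega>))))"
proof -
  have l: "ack_local P (\<lambda>n. \<Phi> n $$ (i, j))" for i j
    by (rule ack_local_comp[OF \<Phi>(1)])
  have "has_mean (\<lambda>\<omega>. \<Sum>i<k. \<Sum>j<k'. \<Phi> (acks P t \<omega>) $$ (i, j) * (y \<omega> $ i * z \<omega> $ j))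
      (\<Sum>i<k. \<Sum>j<k'. expectation (\<lambda>\<omega>. \<Phi> (acks P t \<omega>) $$ (i, j)) * expectation (\<lambda>\<omega>. y \<omega> $ i * z \<omega> $ j))"
    by (intro has_bochner_integral_sum ack_noise_mult[OF l] yz has_bochner_integral_integrable) simp_all
  also have "(\<lambda>\<omega>. \<Sum>i<k. \<Sum>j<k'. \<Phi> (acks P t \<omega>) $$ (i, j) * (y \<omega> $ i * z \<omega> $ j)) = (\<lambda>\<omega>. y \<omega> \<bullet> (\<Phi> (acks P t \<omega>) *\<^sub>v z \<omega>))"
    unfolding form_double_sum[OF \<Phi>(2) y z] by (simp add: mult_ac)
  also have "(\<Sum>i<k. \<Sum>j<k'. expectation (\<lambda>\<omega>. \<Phi> (acks P t \<omega>) $$ (i, j)) * expectation (\<lambda>\<omega>. y \<omega> $ i * z \<omega> $ j))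
      = tr_mat (expect_mat P k k' (\<lambda>\<omega>. \<Phi> (acks P t \<omega>)) * expect_mat P k' k (\<lambda>\<omega>. outer (z \<omega>) (y \<omega>)))"
  proof -
    have [simp]: "dim_vec (y \<omega>) = k" "dim_vec (z \<omega>) = k'" for \<omega> using y[of \<omega>] z[of \<omega>] by auto
    show ?thesis
      by (auto simp: tr_mat_def expect_mat_def scalar_prod_def outer_def lessThan_atLeast0 mult.commute intro!: sum.cong)
  qed
  finally show ?thesis .
qed

end

context stochastic_plant begin

lemma sandwich_mean:
  assumes X: "ack_local P X" "\<And>n. X n \<in> carrier_mat (usize P) (usize P)" and Y: "ack_local P Y" "\<And>n. Y n \<in> carrier_mat (usize P) (usize P)"
    and u: "u \<in> carrier_vec (usize P)" and v: "v \<in> carrier_vec (usize P)"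
  shows "has_mean (\<lambda>\<omega>. u \<bullet> (((X (acks P t \<omega>))\<^sup>T * alpha P * Y (acks P t \<omega>)) *\<^sub>v v))
    (u \<bullet> (expect_mat P (usize P) (usize P) (\<lambda>\<omega>. (X (acks P t \<omega>))\<^sup>T * alpha P * Y (acks P t \<omega>)) *\<^sub>v v))"
proof (rule expect_mat_form[OF ack_local_comp2[OF X(1) Y(1), of "\<lambda>X Y. X\<^sup>T * alpha P * Y"] _ u v])
  show "(X n)\<^sup>T * alpha P * Y n \<in> carrier_mat (usize P) (usize P)" for n
    using X(2)[of n] Y(2)[of n] by (intro carrier_matI) auto
qed

lemma ack_part_form_mean:
  assumes F: "F \<in> policy_class P"
  shows "has_mean (\<lambda>\<omega>. ack_part F (acks P t \<omega>) \<bullet> (alpha P *\<^sub>v ack_part F (acks P t \<omega>))) (Xi P F \<bullet> (calL P t *\<^sub>v Xi P F))"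
proof -
  note e = policy_classD(1)[OF F] and l = Lam_col_carrier[OF F]
  show ?thesis
    unfolding ack_part_form[OF F] calL_form[OF F] Sigma_G_def
    by (intro has_bochner_integral_add has_bochner_integral_mult_right has_bochner_integral_sum
        sandwich_mean[OF matrices_local(1) carriers(6) matrices_local(1) carriers(6) e e]
        sandwich_mean[OF matrices_local(1) carriers(6) matrices_local(3) carriers(8) e l]
        sandwich_mean[OF matrices_local(3) carriers(8) matrices_local(3) carriers(8) l l])
qed

lemma ack_part_linear_mean:
  assumes F: "F \<in> policy_class P" and a: "a \<in> carrier_vec (xsize P)"
  shows "has_mean (\<lambda>\<omega>. 2 * (a \<bullet> (calQ P *\<^sub>v (calB P *\<^sub>v ack_part F (acks P t \<omega>))))) ((calM P t *\<^sub>v a) \<bullet> Xi P F)"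
proof -
  let ?y = "(calB P)\<^sup>T *\<^sub>v (calQ P *\<^sub>v a)"
  note e = policy_classD(1)[OF F] and l = Lam_col_carrier[OF F]
  have y: "?y \<in> carrier_vec (usize P)" by (intro carrier_vecI) simp
  have "a \<bullet> (calQ P *\<^sub>v (calB P *\<^sub>v ack_part F n)) = ?y \<bullet> ack_part F n" for n
    using form_adjoint[of "(calB P)\<^sup>T" "calQ P *\<^sub>v a" "ack_part F n"] form_adjoint[of "calQ P" a "calB P *\<^sub>v ack_part F n"] a
    by simp
  then show ?thesis
    unfolding calM_form(1)[OF F a] mu_G_def ack_part_linear[OF F]
    by (simp only:) (intro has_bochner_integral_add has_bochner_integral_mult_right has_bochner_integral_sum
        expect_mat_form[OF matrices_local(1) carriers(6) y e] expect_mat_form[OF matrices_local(3) carriers(8) y l])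
qed

text \<open>The terms of \<open>cost_split\<close> correspond one by one to the terms of the program. Independence of channel
  and noise separates the expectations; the four cross terms have a single factor \<open>w\<close> or \<open>\<ee>(w)\<close> and
  vanish.\<close>

theorem expected_cost:
  assumes F: "F \<in> policy_class P" and v: "v \<in> carrier_vec (xdim P)"
  shows "has_mean (\<lambda>\<omega>. horizon_cost P v F (acks P t \<omega>) (noises P t \<omega>)) (qp_quadratic P t v F)"
proof -
  let ?a = "calA P *\<^sub>v v" and ?B = "calB P" and ?Q = "calQ P" and ?D = "calD P" and ?T = "Theta F" and ?A = "alpha P"
  let ?e = "\<lambda>\<omega>. evec P (noises P t \<omega>)" and ?w = "\<lambda>\<omega>. wvec P (noises P t \<omega>)"
  let ?h = "\<lambda>\<omega>. ack_part F (acks P t \<omega>)" and ?S = "\<lambda>\<omega>. Smat P (acks P t \<omega>)"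
  have a: "?a \<in> carrier_vec (xsize P)" and h: "ack_part F n \<in> carrier_vec (usize P)" for n
    by (auto intro: carrier_vecI)
  have locS: "ack_local P (\<lambda>n. f (Smat P n))" for f by (rule ack_local_comp[OF matrices_local(2)])
  have em: "i < esize P \<Longrightarrow> (\<lambda>\<omega>. ?e \<omega> $ i) \<in> borel_measurable noise_algebra"
    and wm: "i < wsize P \<Longrightarrow> (\<lambda>\<omega>. ?w \<omega> $ i) \<in> borel_measurable noise_algebra" for i
    by (rule noise_entry_measurable, auto intro: noise_algebra_measurable)+
  note mult = borel_measurable_times square_integrable_mult[OF noise_entries_measurable(2) noise_entries_measurable(1) evec_L2 wvec_L2]
    square_integrable_mult[OF noise_entries_measurable(1) noise_entries_measurable(1) wvec_L2 wvec_L2]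
    square_integrable_mult[OF noise_entries_measurable(2) noise_entries_measurable(2) evec_L2 evec_L2]
  have t4: "has_mean (\<lambda>\<omega>. ?e \<omega> \<bullet> ((?T\<^sup>T * (?S \<omega>)\<^sup>T * ?B\<^sup>T * ?Q * ?D) *\<^sub>v ?w \<omega>))
      (tr_mat (?T\<^sup>T * (mu_S P t)\<^sup>T * ?B\<^sup>T * ?Q * ?D * Sigma_e' P t))"
  proof -
    have c: "?T\<^sup>T * (Smat P n)\<^sup>T \<in> carrier_mat (esize P) (usize P)" "?T\<^sup>T * (Smat P n)\<^sup>T * ?B\<^sup>T \<in> carrier_mat (esize P) (xsize P)"
      "?T\<^sup>T * (Smat P n)\<^sup>T * ?B\<^sup>T * ?Q \<in> carrier_mat (esize P) (xsize P)" "?T\<^sup>T * (Smat P n)\<^sup>T * ?B\<^sup>T * ?Q * ?D \<in> carrier_mat (esize P) (wsize P)"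
      "?T\<^sup>T \<in> carrier_mat (esize P) (usize P)" "(Smat P n)\<^sup>T \<in> carrier_mat (usize P) (usize P)" "?B\<^sup>T \<in> carrier_mat (usize P) (xsize P)" for n
      using F by (auto intro: carrier_matI)
    have "expect_mat P (esize P) (wsize P) (\<lambda>\<omega>. ?T\<^sup>T * (?S \<omega>)\<^sup>T * ?B\<^sup>T * ?Q * ?D) = ?T\<^sup>T * (mu_S P t)\<^sup>T * ?B\<^sup>T * ?Q * ?D"
      using expect_mat_transpose[where \<Phi> = "Smat P", OF carriers(7), of t]
        expect_mat_mult_left[OF locS[of transpose_mat] c(6,5), of t]
        expect_mat_mult_right[OF locS[of "\<lambda>X. ?T\<^sup>T * X\<^sup>T"] c(1,7), of t]
        expect_mat_mult_right[OF locS[of "\<lambda>X. ?T\<^sup>T * X\<^sup>T * ?B\<^sup>T"] c(2) weight_carriers(1), of t]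
        expect_mat_mult_right[OF locS[of "\<lambda>X. ?T\<^sup>T * X\<^sup>T * ?B\<^sup>T * ?Q"] c(3) carriers(3), of t]
      by (simp only: mu_S_def)
    with noise_form_trace[where y = ?e and z = ?w and t = t, OF locS[of "\<lambda>X. ?T\<^sup>T * X\<^sup>T * ?B\<^sup>T * ?Q * ?D"] c(4) carriers(5,4)] mult em wm
    show ?thesis unfolding Sigma_e'_def wsize_def[symmetric] esize_def[symmetric] by simp
  qed
  have t5: "has_mean (\<lambda>\<omega>. ?w \<omega> \<bullet> ((?D\<^sup>T * ?Q * ?D) *\<^sub>v ?w \<omega>)) (tr_mat (?D\<^sup>T * ?Q * ?D * Sigma_W P t))"
  proof -
    have c: "?D\<^sup>T * ?Q * ?D \<in> carrier_mat (wsize P) (wsize P)" by (intro carrier_matI) simp_all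
    have "expect_mat P (wsize P) (wsize P) (\<lambda>\<omega>. ?D\<^sup>T * ?Q * ?D) = ?D\<^sup>T * ?Q * ?D"
      using c by (intro eq_matI) (auto simp: expect_mat_def prob_space)
    with noise_form_trace[where y = ?w and z = ?w and t = t, OF ack_local_const c carriers(4,4)] mult wm
    show ?thesis unfolding Sigma_W_def wsize_def[symmetric] by simp
  qed
  have t6: "has_mean (\<lambda>\<omega>. ?e \<omega> \<bullet> ((?T\<^sup>T * ((?S \<omega>)\<^sup>T * ?A * ?S \<omega>) * ?T) *\<^sub>v ?e \<omega>)) (tr_mat (?T\<^sup>T * Sigma_S P t * ?T * Sigma_e P t))"
  proof -
    have c: "(Smat P n)\<^sup>T * ?A * Smat P n \<in> carrier_mat (usize P) (usize P)" "?T\<^sup>T * ((Smat P n)\<^sup>T * ?A * Smat P n) \<in> carrier_mat (esize P) (usize P)"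
      "?T\<^sup>T * ((Smat P n)\<^sup>T * ?A * Smat P n) * ?T \<in> carrier_mat (esize P) (esize P)" "?T\<^sup>T \<in> carrier_mat (esize P) (usize P)" for n
      using F by (auto intro: carrier_matI)
    have "expect_mat P (esize P) (esize P) (\<lambda>\<omega>. ?T\<^sup>T * ((?S \<omega>)\<^sup>T * ?A * ?S \<omega>) * ?T) = ?T\<^sup>T * Sigma_S P t * ?T"
      using expect_mat_mult_left[OF locS[of "\<lambda>X. X\<^sup>T * ?A * X"] c(1,4), of t]
        expect_mat_mult_right[OF locS[of "\<lambda>X. ?T\<^sup>T * (X\<^sup>T * ?A * X)"] c(2) policy_classD(2)[OF F], of t]
      by (simp only: Sigma_S_def)
    with noise_form_trace[where y = ?e and z = ?e and t = t, OF locS[of "\<lambda>X. ?T\<^sup>T * (X\<^sup>T * ?A * X) * ?T"] c(3) carriers(5,5)] mult em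
    show ?thesis unfolding Sigma_e_def esize_def[symmetric] by simp
  qed
  have z1: "has_mean (\<lambda>\<omega>. ?a \<bullet> ((?Q * ?B * ?S \<omega> * ?T) *\<^sub>v ?e \<omega>)) 0"
    by (rule noise_form_mean_zero[OF ack_local_const a locS[of "\<lambda>X. ?Q * ?B * X * ?T"] _ carriers(5) em evec_mean]) (use F in \<open>auto intro: carrier_matI\<close>)
  have z2: "has_mean (\<lambda>\<omega>. ?a \<bullet> ((?Q * ?D) *\<^sub>v ?w \<omega>)) 0"
    by (rule noise_form_mean_zero[OF ack_local_const a ack_local_const _ carriers(4) wm wvec_mean]) (auto intro: carrier_matI)
  have z3: "has_mean (\<lambda>\<omega>. ?h \<omega> \<bullet> ((?A * ?S \<omega> * ?T) *\<^sub>v ?e \<omega>)) 0"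
    by (rule noise_form_mean_zero[OF matrices_local(4) h locS[of "\<lambda>X. ?A * X * ?T"] _ carriers(5) em evec_mean]) (use F in \<open>auto intro: carrier_matI\<close>)
  have z4: "has_mean (\<lambda>\<omega>. ?h \<omega> \<bullet> ((?B\<^sup>T * ?Q * ?D) *\<^sub>v ?w \<omega>)) 0"
    by (rule noise_form_mean_zero[OF matrices_local(4) h ack_local_const _ carriers(4) wm wvec_mean]) (auto intro: carrier_matI)
  have const: "has_mean (\<lambda>_. c) c" for c by (simp add: has_bochner_integral_iff prob_space)
  have "has_mean (\<lambda>\<omega>. horizon_cost P v F (acks P t \<omega>) (noises P t \<omega>))
    (?a \<bullet> (?Q *\<^sub>v ?a) + (calM P t *\<^sub>v ?a) \<bullet> Xi P F + Xi P F \<bullet> (calL P t *\<^sub>v Xi P F)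
      + 2 * tr_mat (?T\<^sup>T * (mu_S P t)\<^sup>T * ?B\<^sup>T * ?Q * ?D * Sigma_e' P t) + tr_mat (?D\<^sup>T * ?Q * ?D * Sigma_W P t)
      + tr_mat (?T\<^sup>T * Sigma_S P t * ?T * Sigma_e P t) + (2 * 0 + 2 * 0 + 2 * 0 + 2 * 0))"
    unfolding cost_split[OF F v]
    by (intro has_bochner_integral_add ack_part_linear_mean[OF F a] ack_part_form_mean[OF F]
        has_bochner_integral_mult_right t4 t5 t6 z1 z2 z3 z4 const)
  then show ?thesis unfolding qp_quadratic_def by (simp add: add_ac)
qed

text \<open>Convexity is inherited from the cost at fixed channel and noise values. This avoids showing directly
  that \<open>\<L>\<close> and the trace form are nonnegative definite.\<close>

lemma qp_quadratic_convex:
  assumes v: "v \<in> carrier_vec (xdim P)"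
  shows "dec_convex_fun (policy_class P) (qp_quadratic P t v)"
  unfolding dec_convex_fun_def
proof (intro ballI allI impI)
  fix F G and s :: real assume F: "F \<in> policy_class P" and G: "G \<in> policy_class P" and s: "0 \<le> s \<and> s \<le> 1"
  let ?c = "\<lambda>F \<omega>. horizon_cost P v F (acks P t \<omega>) (noises P t \<omega>)" and ?H = "dec_comb s F (1 - s) G"
  have H: "has_mean (?c ?H) (qp_quadratic P t v ?H)"
    by (rule expected_cost[OF policy_class_comb[OF F G] v])
  have FG: "has_mean (\<lambda>\<omega>. s * ?c F \<omega> + (1 - s) * ?c G \<omega>) (s * qp_quadratic P t v F + (1 - s) * qp_quadratic P t v G)"
    by (intro has_bochner_integral_add has_bochner_integral_mult_right expected_cost F G v)
  have "expectation (?c ?H) \<le> expectation (\<lambda>\<omega>. s * ?c F \<omega> + (1 - s) * ?c G \<omega>)"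
    using H FG horizon_cost_convex[OF F G] s by (intro integral_mono) (auto simp: has_bochner_integral_iff)
  then show "qp_quadratic P t v ?H \<le> s * qp_quadratic P t v F + (1 - s) * qp_quadratic P t v G"
    using H FG by (simp only: has_bochner_integral_integral_eq)
qed

end

section \<open>Conditional expectations that freeze a variable\<close>

text \<open>On an event of the smaller sigma-algebra the conditional expectation sees only the values of the
  function on that event. Conditional expectations of real functions are differences of conditional
  expectations of nonnegative functions, for which this is the rule for products with an indicator.\<close>

lemma (in finite_measure_subalgebra) real_cond_exp_localize:
  assumes A: "A \<in> sets F" and f [measurable]: "f \<in> borel_measurable M"
  shows "AE x in M. x \<in> A \<longrightarrow> real_cond_exp M F (\<lambda>x. indicator A x * f x) x = real_cond_exp M F f x"
proof -
  have nn: "AE x in M. x \<in> A \<longrightarrow> nn_cond_exp M F (\<lambda>x. ennreal (indicator A x * g x)) x = nn_cond_exp M F (\<lambda>x. ennreal (g x)) x"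
    if g [measurable]: "g \<in> borel_measurable M" for g :: "'a \<Rightarrow> real"
  proof -
    have ind [measurable]: "(indicator A :: 'a \<Rightarrow> ennreal) \<in> borel_measurable F" using A by simp
    have eq: "(\<lambda>x. ennreal (indicator A x * g x)) = (\<lambda>x. indicator A x * ennreal (g x))"
      by (auto simp: indicator_def)
    have "AE x in M. indicator A x * nn_cond_exp M F (\<lambda>x. ennreal (g x)) x = nn_cond_exp M F (\<lambda>x. indicator A x * ennreal (g x)) x"
      by (rule nn_cond_exp_prod) measurable
    then show ?thesis unfolding eq by eventually_elim (auto simp: indicator_def)
  qed
  have "AE x in M. x \<in> A \<longrightarrow> nn_cond_exp M F (\<lambda>x. ennreal (- (indicator A x * f x))) x = nn_cond_exp M F (\<lambda>x. ennreal (- f x)) x"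
    using nn[of "\<lambda>x. - f x"] by simp
  with nn[OF f] show ?thesis unfolding real_cond_exp_def by eventually_elim auto
qed

lemma (in prob_space) real_cond_exp_indep:
  fixes b :: "'a \<Rightarrow> real"
  assumes F: "subalgebra M F" and G: "subalgebra M G" and ind: "indep_set (sets F) (sets G)"
    and b: "b \<in> borel_measurable G" "integrable M b"
  shows "AE x in M. real_cond_exp M F b x = expectation b"
proof -
  interpret finite_measure_subalgebra M F by unfold_locales (rule F)
  show ?thesis
  proof (rule real_cond_exp_charact)
    fix A assume A: "A \<in> sets F"
    then have AM: "A \<in> events" using F by (auto simp: subalgebra_def)
    have i: "integrable M (indicator A :: 'a \<Rightarrow> real)" using AM by (simp add: emeasure_eq_measure)
    have "(\<integral>x\<in>A. b x \<partial>M) = expectation (\<lambda>x. indicator A x * b x)" by (simp add: set_lebesgue_integral_def)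
    also have "\<dots> = expectation (indicator A) * expectation b"
      using F G A by (intro indep_set_integral_mult[OF ind _ _ _ i b]) (auto simp: subalgebra_def)
    also have "\<dots> = (\<integral>x\<in>A. expectation b \<partial>M)" using AM by (simp add: set_lebesgue_integral_def)
    finally show "(\<integral>x\<in>A. b x \<partial>M) = (\<integral>x\<in>A. expectation b \<partial>M)" .
  qed (use b in auto)
qed

text \<open>The coefficients \<open>a k\<close> need not be integrable, and therefore neither need \<open>f\<close>. On the events \<open>A n\<close>,
  where all coefficients are bounded by \<open>n\<close>, the usual rules for products and sums apply; these events
  cover the space.\<close>

lemma (in prob_space) real_cond_exp_separable:
  fixes a b :: "'i \<Rightarrow> 'a \<Rightarrow> real"
  assumes F: "subalgebra M F" and G: "subalgebra M G" and ind: "indep_set (sets F) (sets G)"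
    and K: "finite K" and a: "\<And>k. k \<in> K \<Longrightarrow> a k \<in> borel_measurable F"
    and b: "\<And>k. k \<in> K \<Longrightarrow> b k \<in> borel_measurable G" "\<And>k. k \<in> K \<Longrightarrow> integrable M (b k)"
    and f: "\<And>\<omega>. \<omega> \<in> space M \<Longrightarrow> f \<omega> = (\<Sum>k\<in>K. a k \<omega> * b k \<omega>)"
  shows "AE \<omega> in M. real_cond_exp M F f \<omega> = (\<Sum>k\<in>K. a k \<omega> * expectation (b k))"
proof -
  interpret finite_measure_subalgebra M F by unfold_locales (rule F)
  have aM: "a k \<in> borel_measurable M" if "k \<in> K" for k using measurable_from_subalg[OF F a[OF that]] .
  have bM: "b k \<in> borel_measurable M" if "k \<in> K" for k using measurable_from_subalg[OF G b(1)[OF that]] .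
  have "(\<lambda>\<omega>. \<Sum>k\<in>K. a k \<omega> * b k \<omega>) \<in> borel_measurable M" using aM bM by (intro borel_measurable_sum borel_measurable_times)
  then have fM: "f \<in> borel_measurable M" using measurable_cong[of M f, OF f] by blast
  define A where "A n = {\<omega> \<in> space F. \<forall>k\<in>K. \<bar>a k \<omega>\<bar> \<le> real n}" for n :: nat
  define c where "c n k \<omega> = indicator (A n) \<omega> * a k \<omega>" for n k \<omega>
  have A: "A n \<in> sets F" for n
  proof -
    have "{\<omega> \<in> space F. \<bar>a k \<omega>\<bar> \<le> real n} \<in> sets F" if "k \<in> K" for k
      using a[OF that] by measurable
    then show ?thesis unfolding A_def using K by (rule sets.sets_Collect_finite_All)
  qed
  have sp: "space F = space M" using F by (simp add: subalgebra_def)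
  have bdd: "\<bar>c n k \<omega>\<bar> \<le> real n" if "k \<in> K" for n k \<omega>
    using that by (auto simp: c_def A_def indicator_def)
  have iaF: "c n k \<in> borel_measurable F" if "k \<in> K" for n k
    unfolding c_def using a[OF that] A by (intro borel_measurable_times borel_measurable_indicator)
  have int: "integrable M (\<lambda>\<omega>. c n k \<omega> * b k \<omega>)" if k: "k \<in> K" for n k
  proof (rule Bochner_Integration.integrable_bound)
    show "integrable M (\<lambda>\<omega>. real n * b k \<omega>)" using b(2)[OF k] by simp
    show "AE \<omega> in M. norm (c n k \<omega> * b k \<omega>) \<le> norm (real n * b k \<omega>)"
      using bdd[OF k, of n] by (intro AE_I2) (simp only: real_norm_def abs_mult abs_of_nat mult_right_mono abs_ge_zero)
    show "(\<lambda>\<omega>. c n k \<omega> * b k \<omega>) \<in> borel_measurable M"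
      using measurable_from_subalg[OF F iaF[OF k]] bM[OF k] by (rule borel_measurable_times)
  qed
  have *: "AE \<omega> in M. \<omega> \<in> A n \<longrightarrow> real_cond_exp M F f \<omega> = (\<Sum>k\<in>K. a k \<omega> * expectation (b k))" for n
  proof -
    have 1: "AE \<omega> in M. real_cond_exp M F (\<lambda>\<omega>. indicator (A n) \<omega> * f \<omega>) \<omega> = real_cond_exp M F (\<lambda>\<omega>. \<Sum>k\<in>K. c n k \<omega> * b k \<omega>) \<omega>"
    proof (rule real_cond_exp_cong)
      show "AE \<omega> in M. indicator (A n) \<omega> * f \<omega> = (\<Sum>k\<in>K. c n k \<omega> * b k \<omega>)"
        by (intro AE_I2) (simp add: f c_def sum_distrib_left mult.assoc)
      show "(\<lambda>\<omega>. indicator (A n) \<omega> * f \<omega>) \<in> borel_measurable M"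
        using fM A[of n] F by (intro borel_measurable_times borel_measurable_indicator) (auto simp: subalgebra_def)
      show "(\<lambda>\<omega>. \<Sum>k\<in>K. c n k \<omega> * b k \<omega>) \<in> borel_measurable M"
        using int by (intro borel_measurable_sum) auto
    qed
    have 2: "AE \<omega> in M. real_cond_exp M F (\<lambda>\<omega>. \<Sum>k\<in>K. c n k \<omega> * b k \<omega>) \<omega>
        = (\<Sum>k\<in>K. real_cond_exp M F (\<lambda>\<omega>. c n k \<omega> * b k \<omega>) \<omega>)"
    proof -
      let ?g = "\<lambda>k \<omega>. if k \<in> K then c n k \<omega> * b k \<omega> else 0"
      have "integrable M (?g k)" for k using int[of k n] by (cases "k \<in> K") simp_all
      from real_cond_exp_sum[of ?g K, OF this] show ?thesis by (simp cong: sum.cong)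
    qed
    have 3: "AE \<omega> in M. \<forall>k\<in>K. real_cond_exp M F (\<lambda>\<omega>. c n k \<omega> * b k \<omega>) \<omega> = c n k \<omega> * real_cond_exp M F (b k) \<omega>"
      using K by (intro AE_finite_allI real_cond_exp_mult iaF bM int)
    have 4: "AE \<omega> in M. \<forall>k\<in>K. real_cond_exp M F (b k) \<omega> = expectation (b k)"
      using K by (intro AE_finite_allI real_cond_exp_indep[OF F G ind] b)
    from 1 2 3 4 real_cond_exp_localize[OF A fM, of n] show ?thesis
    proof eventually_elim
      case (elim \<omega>)
      show ?case
      proof
        assume "\<omega> \<in> A n"
        then have "real_cond_exp M F f \<omega> = (\<Sum>k\<in>K. real_cond_exp M F (\<lambda>\<omega>. c n k \<omega> * b k \<omega>) \<omega>)"
          using elim by simp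
        also have "\<dots> = (\<Sum>k\<in>K. a k \<omega> * expectation (b k))"
          using elim \<open>\<omega> \<in> A n\<close> by (intro sum.cong) (auto simp: c_def)
        finally show "real_cond_exp M F f \<omega> = (\<Sum>k\<in>K. a k \<omega> * expectation (b k))" .
      qed
    qed
  qed
  then have "AE \<omega> in M. \<forall>n. \<omega> \<in> A n \<longrightarrow> real_cond_exp M F f \<omega> = (\<Sum>k\<in>K. a k \<omega> * expectation (b k))"
    by (intro AE_all_countable[THEN iffD2] allI)
  then show ?thesis
  proof (rule AE_mp, intro AE_I2 impI)
    fix \<omega> assume \<omega>: "\<omega> \<in> space M" and all: "\<forall>n. \<omega> \<in> A n \<longrightarrow> real_cond_exp M F f \<omega> = (\<Sum>k\<in>K. a k \<omega> * expectation (b k))"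
    obtain n where n: "(\<Sum>k\<in>K. \<bar>a k \<omega>\<bar>) \<le> real n" using real_arch_simple by blast
    have "\<bar>a k \<omega>\<bar> \<le> real n" if "k \<in> K" for k
      using member_le_sum[OF that, of "\<lambda>k. \<bar>a k \<omega>\<bar>"] K n by simp
    then have "\<omega> \<in> A n" using \<omega> by (simp add: A_def sp)
    with all show "real_cond_exp M F f \<omega> = (\<Sum>k\<in>K. a k \<omega> * expectation (b k))" by blast
  qed
qed

text \<open>Finite sums of products \<open>a \<omega>\<^sub>0 * b \<omega>\<close>. The first argument carries the variable that is to be frozen, and
  the set \<open>B\<close> records which functions of the second argument are admitted: square integrable ones for
  states and inputs, integrable ones for the cost.\<close>

inductive separable :: "'a set \<Rightarrow> 'a measure \<Rightarrow> ('a \<Rightarrow> real) set \<Rightarrow> ('a \<Rightarrow> 'a \<Rightarrow> real) \<Rightarrow> bool" for \<Omega> F B where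
  prod: "a \<in> borel_measurable F \<Longrightarrow> b \<in> B \<Longrightarrow> separable \<Omega> F B (\<lambda>\<omega>\<^sub>0 \<omega>. a \<omega>\<^sub>0 * b \<omega>)"
| add: "separable \<Omega> F B f \<Longrightarrow> separable \<Omega> F B g \<Longrightarrow> separable \<Omega> F B (\<lambda>\<omega>\<^sub>0 \<omega>. f \<omega>\<^sub>0 \<omega> + g \<omega>\<^sub>0 \<omega>)"
| cong: "separable \<Omega> F B f \<Longrightarrow> (\<And>\<omega>\<^sub>0 \<omega>. \<omega>\<^sub>0 \<in> \<Omega> \<Longrightarrow> \<omega> \<in> \<Omega> \<Longrightarrow> f \<omega>\<^sub>0 \<omega> = g \<omega>\<^sub>0 \<omega>) \<Longrightarrow> separable \<Omega> F B g"

lemma separable_cmult: "separable \<Omega> F B f \<Longrightarrow> separable \<Omega> F B (\<lambda>\<omega>\<^sub>0 \<omega>. c * f \<omega>\<^sub>0 \<omega>)"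
proof (induction rule: separable.induct)
  case (prod a b)
  then have "separable \<Omega> F B (\<lambda>\<omega>\<^sub>0 \<omega>. (c * a \<omega>\<^sub>0) * b \<omega>)" by (intro separable.prod) simp_all
  then show ?case by (simp add: mult.assoc)
next
  case (add f g)
  from separable.add[OF add.IH] show ?case by (simp add: distrib_left)
next
  case (cong f g)
  show ?case by (rule separable.cong[OF cong.IH]) (simp add: cong.hyps)
qed

lemma separable_mult_simple:
  assumes "separable \<Omega> F B f" "a \<in> borel_measurable F" "b \<in> B" and B: "\<And>b b'. b \<in> B \<Longrightarrow> b' \<in> B \<Longrightarrow> (\<lambda>\<omega>. b \<omega> * b' \<omega>) \<in> B'"
  shows "separable \<Omega> F B' (\<lambda>\<omega>\<^sub>0 \<omega>. f \<omega>\<^sub>0 \<omega> * (a \<omega>\<^sub>0 * b \<omega>))"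
  using assms(1)
proof (induction rule: separable.induct)
  case (prod a' b')
  have "separable \<Omega> F B' (\<lambda>\<omega>\<^sub>0 \<omega>. (a' \<omega>\<^sub>0 * a \<omega>\<^sub>0) * (b' \<omega> * b \<omega>))"
    by (intro separable.prod borel_measurable_times prod B assms)
  then show ?case by (simp add: mult_ac)
next
  case (add f g)
  from separable.add[OF add.IH] show ?case by (simp add: distrib_right)
next
  case (cong f g)
  show ?case by (rule separable.cong[OF cong.IH]) (simp add: cong.hyps)
qed

lemma separable_mult:
  assumes f: "separable \<Omega> F B f" and g: "separable \<Omega> F B g" and B: "\<And>b b'. b \<in> B \<Longrightarrow> b' \<in> B \<Longrightarrow> (\<lambda>\<omega>. b \<omega> * b' \<omega>) \<in> B'"
  shows "separable \<Omega> F B' (\<lambda>\<omega>\<^sub>0 \<omega>. f \<omega>\<^sub>0 \<omega> * g \<omega>\<^sub>0 \<omega>)"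
  using g
proof (induction rule: separable.induct)
  case (prod a b)
  show ?case by (rule separable_mult_simple[OF f prod B])
next
  case (add g h)
  from separable.add[OF add.IH] show ?case by (simp add: distrib_left)
next
  case (cong g h)
  show ?case by (rule separable.cong[OF cong.IH]) (simp add: cong.hyps)
qed

lemma separable_sum:
  assumes "finite I" "\<And>i. i \<in> I \<Longrightarrow> separable \<Omega> F B (f i)" "b0 \<in> B"
  shows "separable \<Omega> F B (\<lambda>\<omega>\<^sub>0 \<omega>. \<Sum>i\<in>I. f i \<omega>\<^sub>0 \<omega>)"
  using assms(1,2)
proof (induction I rule: finite_induct)
  case empty
  have "separable \<Omega> F B (\<lambda>\<omega>\<^sub>0 \<omega>. 0 * b0 \<omega>)" by (rule separable.prod) (use assms(3) in auto)
  then show ?case by simp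
next
  case (insert i I)
  then have "separable \<Omega> F B (\<lambda>\<omega>\<^sub>0 \<omega>. f i \<omega>\<^sub>0 \<omega> + (\<Sum>i\<in>I. f i \<omega>\<^sub>0 \<omega>))" by (intro separable.add) auto
  then show ?case using insert by simp
qed

lemma separable_list:
  "separable \<Omega> F B f \<Longrightarrow> \<exists>L. (\<forall>(a, b)\<in>set L. a \<in> borel_measurable F \<and> b \<in> B)
    \<and> (\<forall>\<omega>\<^sub>0\<in>\<Omega>. \<forall>\<omega>\<in>\<Omega>. f \<omega>\<^sub>0 \<omega> = (\<Sum>(a, b)\<leftarrow>L. a \<omega>\<^sub>0 * b \<omega>))"
proof (induction rule: separable.induct)
  case (prod a b)
  then show ?case by (intro exI[of _ "[(a, b)]"]) simp
next
  case (add f g)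
  then obtain L L' where "\<forall>(a, b)\<in>set L. a \<in> borel_measurable F \<and> b \<in> B" "\<forall>\<omega>\<^sub>0\<in>\<Omega>. \<forall>\<omega>\<in>\<Omega>. f \<omega>\<^sub>0 \<omega> = (\<Sum>(a, b)\<leftarrow>L. a \<omega>\<^sub>0 * b \<omega>)"
    "\<forall>(a, b)\<in>set L'. a \<in> borel_measurable F \<and> b \<in> B" "\<forall>\<omega>\<^sub>0\<in>\<Omega>. \<forall>\<omega>\<in>\<Omega>. g \<omega>\<^sub>0 \<omega> = (\<Sum>(a, b)\<leftarrow>L'. a \<omega>\<^sub>0 * b \<omega>)"
    by blast
  then show ?case by (intro exI[of _ "L @ L'"]) auto
next
  case (cong f g)
  then show ?case by simp
qed

text \<open>For independent variables the conditional expectation is computed with the conditioning variable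
  held fixed. Separability replaces the joint distribution of the two variables.\<close>

lemma (in prob_space) cond_exp_freeze:
  assumes F: "subalgebra M F" and G: "subalgebra M G" and ind: "indep_set (sets F) (sets G)"
    and sep: "separable (space M) F {b \<in> borel_measurable G. integrable M b} f"
  shows "AE \<omega> in M. real_cond_exp M F (\<lambda>\<omega>. f \<omega> \<omega>) \<omega> = expectation (f \<omega>)"
proof -
  obtain L where L: "\<And>a b. (a, b) \<in> set L \<Longrightarrow> a \<in> borel_measurable F \<and> b \<in> borel_measurable G \<and> integrable M b"
    and f: "\<And>\<omega>\<^sub>0 \<omega>. \<omega>\<^sub>0 \<in> space M \<Longrightarrow> \<omega> \<in> space M \<Longrightarrow> f \<omega>\<^sub>0 \<omega> = (\<Sum>(a, b)\<leftarrow>L. a \<omega>\<^sub>0 * b \<omega>)"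
    using separable_list[OF sep] by fast
  let ?K = "{..<length L}" let ?a = "\<lambda>k. fst (L ! k)" let ?b = "\<lambda>k. snd (L ! k)"
  have ab: "?a k \<in> borel_measurable F" "?b k \<in> borel_measurable G" "integrable M (?b k)" if "k \<in> ?K" for k
    using L[of "?a k" "?b k"] that nth_mem[of k L] by auto
  have fs: "f \<omega>\<^sub>0 \<omega> = (\<Sum>k\<in>?K. ?a k \<omega>\<^sub>0 * ?b k \<omega>)" if "\<omega>\<^sub>0 \<in> space M" "\<omega> \<in> space M" for \<omega>\<^sub>0 \<omega>
    unfolding f[OF that] by (simp add: sum_list_sum_nth lessThan_atLeast0 split_beta)
  have "AE \<omega> in M. real_cond_exp M F (\<lambda>\<omega>. f \<omega> \<omega>) \<omega> = (\<Sum>k\<in>?K. ?a k \<omega> * expectation (?b k))"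
    by (rule real_cond_exp_separable[OF F G ind]) (use ab fs in auto)
  then show ?thesis
  proof (rule AE_mp, intro AE_I2 impI)
    fix \<omega> assume \<omega>: "\<omega> \<in> space M" and eq: "real_cond_exp M F (\<lambda>\<omega>. f \<omega> \<omega>) \<omega> = (\<Sum>k\<in>?K. ?a k \<omega> * expectation (?b k))"
    have "expectation (f \<omega>) = expectation (\<lambda>\<omega>'. \<Sum>k\<in>?K. ?a k \<omega> * ?b k \<omega>')"
      by (rule Bochner_Integration.integral_cong) (simp_all add: fs \<omega>)
    also have "\<dots> = (\<Sum>k\<in>?K. ?a k \<omega> * expectation (?b k))" using ab by simp
    finally show "real_cond_exp M F (\<lambda>\<omega>. f \<omega> \<omega>) \<omega> = expectation (f \<omega>)" using eq by simp
  qed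
qed

context stochastic_plant begin

text \<open>The noise at time \<open>s\<close> has index \<open>Inl s\<close> and the channel at time \<open>s\<close> has index \<open>Inr s\<close>, so that both
  form one family of independent sources.\<close>

fun source_events :: "nat + nat \<Rightarrow> 'a set set" where
  "source_events (Inl s) = {noise P s -` A \<inter> space M | A. A \<in> sets (borel_vec (xdim P))}"
| "source_events (Inr s) = {ack P s -` A \<inter> space M | A. A \<in> sets borel}"

definition information :: "(nat + nat) set \<Rightarrow> 'a measure" where
  "information I = sigma (space M) (\<Union>i\<in>I. source_events i)"

lemma source_events_Pow: "source_events i \<subseteq> Pow (space M)" by (cases i) auto

lemma source_events_events: "source_events i \<subseteq> events" by (cases i) auto

lemma space_information [simp]: "space (information I) = space M"
  unfolding information_def using source_events_Pow by (intro space_measure_of) blast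

lemma sets_information: "sets (information I) = sigma_sets (space M) (\<Union>i\<in>I. source_events i)"
  unfolding information_def using source_events_Pow by (intro sets_measure_of) blast

lemma subalgebra_information: "subalgebra M (information I)"
  unfolding subalgebra_def sets_information
  using source_events_events by (auto intro!: sets.sigma_sets_subset)

lemma information_mono: 
  assumes "I \<subseteq> J" shows "f \<in> information I \<rightarrow>\<^sub>M N \<Longrightarrow> f \<in> information J \<rightarrow>\<^sub>M N"
proof (rule measurable_from_subalg)
  have "sigma_sets (space M) (\<Union>i\<in>I. source_events i) \<subseteq> sigma_sets (space M) (\<Union>i\<in>J. source_events i)"
    by (rule sigma_sets_mono') (use assms in blast)
  then show "subalgebra (information J) (information I)"
    by (simp add: subalgebra_def sets_information)
qed

lemma noise_information:
  assumes "Inl s \<in> I" shows "noise P s \<in> information I \<rightarrow>\<^sub>M borel_vec (xdim P)"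
proof (rule measurableI)
  fix A assume "A \<in> sets (borel_vec (xdim P))"
  then have "noise P s -` A \<inter> space M \<in> source_events (Inl s)" by auto
  then show "noise P s -` A \<inter> space (information I) \<in> sets (information I)"
    unfolding sets_information space_information using assms by (intro sigma_sets.Basic UN_I[of "Inl s"])
qed (simp add: noise_carrier)

lemma ack_information:
  assumes "Inr s \<in> I" shows "ack P s \<in> borel_measurable (information I)"
proof (rule measurableI)
  fix A :: "real set" assume "A \<in> sets borel"
  then have "ack P s -` A \<inter> space M \<in> source_events (Inr s)" by auto
  then show "ack P s -` A \<inter> space (information I) \<in> sets (information I)"
    unfolding sets_information space_information using assms by (intro sigma_sets.Basic UN_I[of "Inr s"])
qed simp

text \<open>A finite intersection splits into a noise event and a channel event. These are independent of each
  other, and each has the product of probabilities within its own family.\<close>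

lemma source_events_indep: "indep_sets source_events UNIV"
proof (rule indep_setsI)
  fix A J assume J: "J \<noteq> {}" "finite J" and A: "\<forall>j\<in>J. A j \<in> source_events j"
  define J1 where "J1 = {s. Inl s \<in> J}"
  define J2 where "J2 = {s. Inr s \<in> J}"
  have Jeq: "J = Inl ` J1 \<union> Inr ` J2" 
  proof (rule Set.set_eqI)
    fix j show "j \<in> J \<longleftrightarrow> j \<in> Inl ` J1 \<union> Inr ` J2" by (cases j) (auto simp: J1_def J2_def)
  qed
  have fin: "finite J1" "finite J2" unfolding J1_def J2_def
    using J(2) by (auto intro: finite_vimageI[of J Inl, unfolded vimage_def] finite_vimageI[of J Inr, unfolded vimage_def])
  define X1 where "X1 = space M \<inter> (\<Inter>s\<in>J1. A (Inl s))"
  define X2 where "X2 = space M \<inter> (\<Inter>s\<in>J2. A (Inr s))"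
  have sub: "A j \<subseteq> space M" if "j \<in> J" for j using A that source_events_Pow by blast
  have inter: "(\<Inter>j\<in>J. A j) = X1 \<inter> X2"
  proof -
    have "(\<Inter>j\<in>J. A j) = space M \<inter> (\<Inter>j\<in>J. A j)" using J(1) sub by blast
    then show ?thesis unfolding X1_def X2_def Jeq by auto
  qed
  have split: "prob (space M \<inter> (\<Inter>s\<in>K. B s)) = (\<Prod>s\<in>K. prob (B s))"
    if ind: "indep_sets E UNIV" and K: "finite K" "\<forall>s\<in>K. B s \<in> E s" for K :: "nat set" and B E
  proof (cases "K = {}")
    case False
    have "B s \<in> events" if "s \<in> K" for s using ind K(2) that unfolding indep_sets_def by blast
    then have "B s \<subseteq> space M" if "s \<in> K" for s using sets.sets_into_space that by blast
    then have "space M \<inter> (\<Inter>s\<in>K. B s) = (\<Inter>s\<in>K. B s)" using False by blast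
    then show ?thesis using indep_setsD[OF ind _ False K] by simp
  qed (simp add: prob_space)
  have P1: "prob X1 = (\<Prod>s\<in>J1. prob (A (Inl s)))"
    unfolding X1_def using A
    by (intro split[OF conjunct2[OF noise_indep[unfolded indep_vars_def2]] fin(1)]) (auto simp: J1_def)
  have P2: "prob X2 = (\<Prod>s\<in>J2. prob (A (Inr s)))"
    unfolding X2_def using A
    by (intro split[OF conjunct2[OF ack_indep[unfolded indep_vars_def2]] fin(2)]) (auto simp: J2_def)
  have "A (Inl s) \<in> sets noise_algebra" if "s \<in> J1" for s
  proof -
    have "A (Inl s) \<in> source_events (Inl s)" using A that unfolding J1_def by blast
    then obtain B where "B \<in> sets (borel_vec (xdim P))" "A (Inl s) = noise P s -` B \<inter> space M" by auto
    then show ?thesis using measurable_sets[OF noise_algebra_measurable, of B s] noise_ack_algebras(2) by simp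
  qed
  then have X1: "X1 \<in> sets noise_algebra" unfolding X1_def noise_ack_algebras(2)[symmetric]
    using fin(1) by (cases "J1 = {}") (auto intro!: sets.Int sets.finite_INT)
  have "A (Inr s) \<in> sets ack_algebra" if "s \<in> J2" for s
  proof -
    have "A (Inr s) \<in> source_events (Inr s)" using A that unfolding J2_def by blast
    then obtain B where "B \<in> sets borel" "A (Inr s) = ack P s -` B \<inter> space M" by auto
    then show ?thesis using measurable_sets[OF ack_algebra_measurable, of B s] noise_ack_algebras(3) by simp
  qed
  then have X2: "X2 \<in> sets ack_algebra" unfolding X2_def noise_ack_algebras(3)[symmetric]
    using fin(2) by (cases "J2 = {}") (auto intro!: sets.Int sets.finite_INT)
  have "prob (\<Inter>j\<in>J. A j) = prob X1 * prob X2" unfolding inter by (rule indep_setD[OF noise_ack_algebras(1) X1 X2])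
  also have "\<dots> = (\<Prod>j\<in>J. prob (A j))"
    unfolding P1 P2 Jeq using fin by (subst prod.union_disjoint) (auto simp: prod.reindex)
  finally show "prob (\<Inter>j\<in>J. A j) = (\<Prod>j\<in>J. prob (A j))" .
qed (rule source_events_events)

lemma information_indep:
  assumes "I \<inter> J = {}"
  shows "indep_set (sets (information I)) (sets (information J))"
proof -
  have "indep_sets (\<lambda>b. sigma_sets (space M) (\<Union>i\<in>case_bool I J b. source_events i)) UNIV"
  proof (rule indep_sets_collect_sigma)
    show "indep_sets source_events (\<Union>b\<in>UNIV. case_bool I J b)"
      by (rule indep_sets_mono_index[OF _ source_events_indep]) simp
    show "disjoint_family_on (case_bool I J) UNIV"
      using assms by (auto simp: disjoint_family_on_def split: bool.splits)
    show "Int_stable (source_events i)" for i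
    proof (cases i)
      case (Inl s)
      have "\<exists>C. (noise P s -` A \<inter> space M) \<inter> (noise P s -` B \<inter> space M) = noise P s -` C \<inter> space M \<and> C \<in> sets (borel_vec (xdim P))"
        if "A \<in> sets (borel_vec (xdim P))" "B \<in> sets (borel_vec (xdim P))" for A B
        using that by (intro exI[of _ "A \<inter> B"]) auto
      then show ?thesis unfolding Inl Int_stable_def by auto
    next
      case (Inr s)
      have "\<exists>C. (ack P s -` A \<inter> space M) \<inter> (ack P s -` B \<inter> space M) = ack P s -` C \<inter> space M \<and> C \<in> sets borel"
        if "A \<in> sets borel" "B \<in> sets borel" for A B
        using that by (intro exI[of _ "A \<inter> B"]) auto
      then show ?thesis unfolding Inr Int_stable_def by auto
    qed
  qed
  moreover have "(\<lambda>b. sigma_sets (space M) (\<Union>i\<in>case_bool I J b. source_events i))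
      = case_bool (sets (information I)) (sets (information J))"
    by (auto simp: sets_information fun_eq_iff split: bool.split)
  ultimately show ?thesis by (simp add: indep_set_def)
qed

definition past :: "nat \<Rightarrow> 'a measure" where "past t = information (Inl ` {..<t} \<union> Inr ` {..<t})"
definition future :: "nat \<Rightarrow> 'a measure" where "future t = information (Inl ` {t..} \<union> Inr ` {t..})"

lemma past_future_indep: "indep_set (sets (past t)) (sets (future t))"
  unfolding past_def future_def by (rule information_indep) auto

lemma past_mono: "s \<le> t \<Longrightarrow> f \<in> past s \<rightarrow>\<^sub>M N \<Longrightarrow> f \<in> past t \<rightarrow>\<^sub>M N"
  unfolding past_def by (erule information_mono[rotated]) auto

lemma space_past_future [simp]: "space (past t) = space M" "space (future t) = space M"
  by (simp_all add: past_def future_def)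

lemma decision_rule_measurable:
  assumes y: "y \<in> N \<rightarrow>\<^sub>M borel_vec (xdim P)" and \<kappa>: "decision_rule P \<kappa>" and i: "i < usize P"
  shows "(\<lambda>\<omega>. eta (\<kappa> (y \<omega>)) $ i) \<in> borel_measurable N"
    "c < esize P \<Longrightarrow> (\<lambda>\<omega>. Theta (\<kappa> (y \<omega>)) $$ (i, c)) \<in> borel_measurable N"
    "c < horizon P - 1 \<Longrightarrow> (\<lambda>\<omega>. Lam (\<kappa> (y \<omega>)) $$ (i, c)) \<in> borel_measurable N"
  using \<kappa> i measurable_compose[OF y, of "\<lambda>v. eta (\<kappa> v) $ i"] measurable_compose[OF y, of "\<lambda>v. Theta (\<kappa> v) $$ (i, c)"]
    measurable_compose[OF y, of "\<lambda>v. Lam (\<kappa> v) $$ (i, c)"]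
  by (auto simp: decision_rule_def esize_def)

text \<open>The block of the input that is applied at step \<open>l\<close> of a horizon uses only information available after
  that step, because of \<open>applied_causal_index\<close>.\<close>

lemma input_measurable:
  assumes y: "y \<in> past t \<rightarrow>\<^sub>M borel_vec (xdim P)" and \<kappa>: "decision_rule P \<kappa>" and l: "l < recalc P" and i: "i < usize P" "i div udim P = l"
  shows "(\<lambda>\<omega>. applied P (\<kappa> (y \<omega>)) (acks P t \<omega>) (evec P (noises P t \<omega>)) $ i) \<in> borel_measurable (past (Suc (t + l)))"
proof -
  let ?N = "past (Suc (t + l))"
  have y': "y \<in> ?N \<rightarrow>\<^sub>M borel_vec (xdim P)" by (rule past_mono[OF _ y]) simp
  have pol: "\<kappa> (y \<omega>) \<in> policy_class P" if "\<omega> \<in> space M" for \<omega>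
    using \<kappa> measurable_space[OF y'] that by (auto simp: decision_rule_def)
  have ackm: "ack P (t + s) \<in> borel_measurable ?N" if "s \<le> l" for s
    unfolding past_def using that by (intro ack_information) auto
  have rec: "(\<lambda>\<omega>. received (acks P t \<omega>) l) \<in> borel_measurable ?N"
    unfolding received_eq acks_def using ackm
    by (intro borel_measurable_diff borel_measurable_const borel_measurable_prod) auto
  have em: "(\<lambda>\<omega>. evec P (noises P t \<omega>) $ c) \<in> borel_measurable ?N" if c: "c < esize P" "c div xdim P < l" for c
  proof -
    have "noise P (t + c div xdim P) \<in> ?N \<rightarrow>\<^sub>M borel_vec (xdim P)"
      unfolding past_def using c by (intro noise_information) auto
    from measurable_compose[OF measurable_compose[OF this measurable_borel_vec_index] sat_meas] show ?thesis
      using c dims by (simp add: evec_index esize_def noises_def)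
  qed
  let ?u = "\<lambda>\<omega>. received (acks P t \<omega>) l * eta (\<kappa> (y \<omega>)) $ i
    + ack P (t + l) \<omega> * ((\<Sum>c | c < esize P \<and> c div xdim P < l. Theta (\<kappa> (y \<omega>)) $$ (i, c) * evec P (noises P t \<omega>) $ c)
                    + (\<Sum>c | c < horizon P - 1 \<and> c < l. Lam (\<kappa> (y \<omega>)) $$ (i, c) * ack P (t + c) \<omega>))"
  have "?u \<in> borel_measurable ?N"
    using rec ackm em decision_rule_measurable[OF y' \<kappa> i(1)]
    by (intro borel_measurable_add borel_measurable_times borel_measurable_sum) auto
  moreover have "applied P (\<kappa> (y \<omega>)) (acks P t \<omega>) (evec P (noises P t \<omega>)) $ i = ?u \<omega>" if "\<omega> \<in> space ?N" for \<omega>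
    using that pol i l applied_causal_index[OF pol horizon(3) dims(2) carriers(5) i(1), of \<omega> "acks P t \<omega>" "noises P t \<omega>"]
    by (simp add: offset_gain_def feedback_gain_def acks_def)
  ultimately show ?thesis by (subst measurable_cong)
qed

text \<open>The state at time \<open>s\<close> is determined by the noise and the channel before \<open>s\<close>. The decision of the
  current horizon depends on an earlier state, and hence the induction is over all smaller times.\<close>

lemma state_measurable:
  assumes rules: "\<And>k. decision_rule P (\<pi> k)" and loop: "closed_loop P \<pi> x"
  shows "x s \<in> past s \<rightarrow>\<^sub>M borel_vec (xdim P)"
proof (induction s rule: less_induct)
  case (less s)
  show ?case
  proof (cases s)
    case 0
    have "x 0 \<omega> = xinit P" if "\<omega> \<in> space (past 0)" for \<omega> using loop that by (simp add: closed_loop_def)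
    moreover have "(\<lambda>_. xinit P) \<in> past 0 \<rightarrow>\<^sub>M borel_vec (xdim P)" using plant by (intro measurable_const) simp
    ultimately show ?thesis unfolding 0 by (subst measurable_cong)
  next
    case (Suc r)
    (* The horizon that covers time r began at s0, and r is its step number l. *)
    define l where "l = r mod recalc P"
    define s0 where "s0 = r - l"
    have l: "l < recalc P" using horizon by (simp add: l_def)
    have s0: "s0 \<le> r" "s0 + l = r" by (simp_all add: s0_def l_def)
    let ?ua = "\<lambda>\<omega>. applied P (\<pi> s0 (x s0 \<omega>)) (acks P s0 \<omega>) (evec P (noises P s0 \<omega>))"
    have step: "x (Suc r) \<omega> = sysA P *\<^sub>v x r \<omega> + sysB P *\<^sub>v vblock (udim P) (?ua \<omega>) l + noise P r \<omega>" if "\<omega> \<in> space M" for \<omega>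
      using loop that unfolding closed_loop_def Let_def s0_def l_def by blast
    have xr: "x r \<in> past (Suc r) \<rightarrow>\<^sub>M borel_vec (xdim P)" by (rule past_mono[OF _ less.IH]) (simp_all add: Suc)
    have u: "(\<lambda>\<omega>. ?ua \<omega> $ (l * udim P + j)) \<in> borel_measurable (past (Suc r))" if j: "j < udim P" for j
    proof -
      have "l * udim P + j < usize P" using block_index_less[OF _ j] l horizon(3) by simp
      from input_measurable[OF less.IH[of s0] rules l this] show ?thesis using s0 j by (simp add: Suc)
    qed
    have nr: "noise P r \<in> past (Suc r) \<rightarrow>\<^sub>M borel_vec (xdim P)" unfolding past_def by (intro noise_information) auto
    show ?thesis unfolding Suc
    proof (rule measurable_borel_vecI)
      fix \<omega> assume "\<omega> \<in> space (past (Suc r))"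
      then have \<omega>: "\<omega> \<in> space M" by simp
      show "x (Suc r) \<omega> \<in> carrier_vec (xdim P)" unfolding step[OF \<omega>] using noise_carrier[OF \<omega>, of r] by (intro carrier_vecI) simp
    next
      fix i assume i: "i < xdim P"
      have eq: "x (Suc r) \<omega> $ i = (\<Sum>j<xdim P. sysA P $$ (i, j) * x r \<omega> $ j) + (\<Sum>j<udim P. sysB P $$ (i, j) * ?ua \<omega> $ (l * udim P + j)) + noise P r \<omega> $ i"
        if "\<omega> \<in> space (past (Suc r))" for \<omega>
      proof -
        have \<omega>: "\<omega> \<in> space M" using that by simp
        have "x r \<omega> \<in> carrier_vec (xdim P)" using measurable_space[OF xr that] by simp
        then show ?thesis unfolding step[OF \<omega>] using noise_carrier[OF \<omega>, of r] i plant
          by (auto simp: scalar_prod_def lessThan_atLeast0 vblock_def)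
      qed
      have "(\<lambda>\<omega>. (\<Sum>j<xdim P. sysA P $$ (i, j) * x r \<omega> $ j) + (\<Sum>j<udim P. sysB P $$ (i, j) * ?ua \<omega> $ (l * udim P + j)) + noise P r \<omega> $ i) \<in> borel_measurable (past (Suc r))"
        using u i by (intro borel_measurable_add borel_measurable_sum borel_measurable_times borel_measurable_const
          measurable_compose[OF xr measurable_borel_vec_index] measurable_compose[OF nr measurable_borel_vec_index]) auto
      then show "(\<lambda>\<omega>. x (Suc r) \<omega> $ i) \<in> borel_measurable (past (Suc r))"
        by (subst measurable_cong[OF eq])
    qed
  qed
qed

section \<open>The conditional expectation of the cost\<close>

definition L2_future :: "nat \<Rightarrow> ('a \<Rightarrow> real) set" where "L2_future t = {b \<in> borel_measurable (future t). integrable M (\<lambda>\<omega>. (b \<omega>)\<^sup>2)}"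

lemma L2_future_mult:
  assumes "b \<in> L2_future t" "b' \<in> L2_future t"
  shows "(\<lambda>\<omega>. b \<omega> * b' \<omega>) \<in> {b \<in> borel_measurable (future t). integrable M b}"
proof -
  have m: "b \<in> borel_measurable M" "b' \<in> borel_measurable M"
    using assms measurable_from_subalg[OF subalgebra_information] by (auto simp: L2_future_def future_def)
  then show ?thesis using assms square_integrable_mult[OF m] by (auto simp: L2_future_def)
qed

lemma L2_future_bounded:
  fixes b :: "'a \<Rightarrow> real"
  assumes b: "b \<in> borel_measurable (future t)" and B: "\<And>\<omega>. \<omega> \<in> space M \<Longrightarrow> \<bar>b \<omega>\<bar> \<le> B"
  shows "b \<in> L2_future t"
proof -
  have m: "b \<in> borel_measurable M" using b measurable_from_subalg[OF subalgebra_information] by (auto simp: future_def)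
  have "integrable M (\<lambda>\<omega>. (b \<omega>)\<^sup>2)"
  proof (rule integrable_const_bound[of _ "B\<^sup>2"])
    have "(b \<omega>)\<^sup>2 \<le> B\<^sup>2" if "\<omega> \<in> space M" for \<omega>
      using power_mono[OF B[OF that], of 2] by simp
    then show "AE \<omega> in M. norm ((b \<omega>)\<^sup>2) \<le> B\<^sup>2" by (intro AE_I2) simp
  qed (use m in measurable)
  with b show ?thesis by (simp add: L2_future_def)
qed

lemma ack_future: "ack P (t + l) \<in> borel_measurable (future t)"
  unfolding future_def by (intro ack_information) auto

lemma noise_future: "noise P (t + l) \<in> future t \<rightarrow>\<^sub>M borel_vec (xdim P)"
  unfolding future_def by (intro noise_information) auto

lemma L2_future_ack: "ack_local P \<Phi> \<Longrightarrow> (\<lambda>\<omega>. \<Phi> (acks P t \<omega>)) \<in> L2_future t"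
  using ack_local_bounded[of \<Phi> t] ack_local_measurable[OF _ space_past_future(2) ack_future, of \<Phi> t] L2_future_bounded by metis

lemma L2_future_wvec: "c < wsize P \<Longrightarrow> (\<lambda>\<omega>. wvec P (noises P t \<omega>) $ c) \<in> L2_future t"
  using noise_entry_measurable(1)[OF noise_future] wvec_L2 by (auto simp: L2_future_def)

text \<open>The saturated noise is bounded, so that its product with a function of the channel is square
  integrable as well.\<close>

lemma L2_future_gain_evec:
  assumes i: "i < usize P" and c: "c < esize P"
  shows "(\<lambda>\<omega>. feedback_gain P (acks P t \<omega>) i * evec P (noises P t \<omega>) $ c) \<in> L2_future t"
proof (rule L2_future_bounded)
  note l = gains_local(2)[OF i]
  show "(\<lambda>\<omega>. feedback_gain P (acks P t \<omega>) i * evec P (noises P t \<omega>) $ c) \<in> borel_measurable (future t)"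
    by (intro borel_measurable_times ack_local_measurable[OF l space_past_future(2) ack_future] noise_entry_measurable(2)[OF noise_future c])
  fix \<omega> assume \<omega>: "\<omega> \<in> space M"
  have "feedback_gain P (acks P t \<omega>) i \<in> {0, 1}" using ack_01[OF \<omega>] by (auto simp: feedback_gain_def acks_def)
  then show "\<bar>feedback_gain P (acks P t \<omega>) i * evec P (noises P t \<omega>) $ c\<bar> \<le> phimax P"
    using evec_bound[OF \<omega> c, of t] phimax_nonneg by auto
qed

text \<open>State and input are sums of products of a function of \<open>x\<^sub>t\<close> and a square integrable function of
  the future; the cost is quadratic in them. The state is independent of the future, so that it can be held
  fixed, which leaves the unconditional expectation of \<open>expected_cost\<close>.\<close>

theorem conditional_cost:
  assumes rules: "\<And>k. decision_rule P (\<pi> k)" and loop: "closed_loop P \<pi> x" and \<kappa>: "decision_rule P \<kappa>"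
  shows "AE \<omega> in M. real_cond_exp M (vimage_algebra (space M) (x t) (borel_vec (xdim P)))
       (\<lambda>\<omega>. horizon_cost P (x t \<omega>) (\<kappa> (x t \<omega>)) (acks P t \<omega>) (noises P t \<omega>)) \<omega>
     = qp_quadratic P t (x t \<omega>) (\<kappa> (x t \<omega>))"
proof -
  let ?F = "vimage_algebra (space M) (x t) (borel_vec (xdim P))"
  note xm = state_measurable[OF rules loop, of t]
  have xc: "x t \<omega> \<in> carrier_vec (xdim P)" if "\<omega> \<in> space M" for \<omega>
    using measurable_space[OF xm] that by simp
  have pol: "\<kappa> (x t \<omega>) \<in> policy_class P" if "\<omega> \<in> space M" for \<omega>
    using \<kappa> xc[OF that] by (simp add: decision_rule_def)
  have xF: "x t \<in> ?F \<rightarrow>\<^sub>M borel_vec (xdim P)" using xc by (intro measurable_vimage_algebra1) auto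
  have F_past: "sets ?F \<subseteq> sets (past t)"
  proof -
    have "x t \<in> space M \<rightarrow> space (borel_vec (xdim P))" using xc by auto
    then show ?thesis using measurable_sets[OF xm] by (auto simp: sets_vimage_algebra2)
  qed
  have sub: "subalgebra M ?F" "subalgebra M (future t)"
    using F_past subalgebra_information[of "Inl ` {..<t} \<union> Inr ` {..<t}"] subalgebra_information
    by (auto simp: subalgebra_def past_def future_def)
  have ind: "indep_set (sets ?F) (sets (future t))"
    using past_future_indep[of t] F_past unfolding indep_sets2_eq by blast
  let ?S = "separable (space M) ?F (L2_future t)"
  let ?ua = "\<lambda>\<omega>\<^sub>0 \<omega>. applied P (\<kappa> (x t \<omega>\<^sub>0)) (acks P t \<omega>) (evec P (noises P t \<omega>))"
  let ?X = "\<lambda>\<omega>\<^sub>0 \<omega>. trajectory (x t \<omega>\<^sub>0) (?ua \<omega>\<^sub>0 \<omega>) (noises P t \<omega>)"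
  have one: "(\<lambda>_. 1) \<in> L2_future t" by (rule L2_future_bounded[of _ _ 1]) auto
  note rule_F = decision_rule_measurable[OF xF \<kappa>]
  have ua: "?S (\<lambda>\<omega>\<^sub>0 \<omega>. ?ua \<omega>\<^sub>0 \<omega> $ i)" if i: "i < usize P" for i
  proof -
    let ?f = "\<lambda>\<omega>\<^sub>0 \<omega>. eta (\<kappa> (x t \<omega>\<^sub>0)) $ i * offset_gain P (acks P t \<omega>) i
        + ((\<Sum>c<esize P. Theta (\<kappa> (x t \<omega>\<^sub>0)) $$ (i, c) * (feedback_gain P (acks P t \<omega>) i * evec P (noises P t \<omega>) $ c))
          + (\<Sum>c<horizon P - 1. Lam (\<kappa> (x t \<omega>\<^sub>0)) $$ (i, c) * (feedback_gain P (acks P t \<omega>) i * acks P t \<omega> c)))"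
    have pn: "ack_local P (\<lambda>n. feedback_gain P n i * n c)" if "c < horizon P - 1" for c
      using gains_local(2)[OF i] that by (auto simp: ack_local_def)
    have "?S ?f"
      using i by (intro separable.add separable_sum[OF _ _ one] separable.prod rule_F
          L2_future_ack[OF gains_local(1)] L2_future_gain_evec L2_future_ack[OF pn]) auto
    moreover have "?f \<omega>\<^sub>0 \<omega> = ?ua \<omega>\<^sub>0 \<omega> $ i" if "\<omega>\<^sub>0 \<in> space M" for \<omega>\<^sub>0 \<omega>
      unfolding applied_index[OF pol[OF that] horizon(3) dims(2) carriers(5) i]
      by (simp add: distrib_left sum_distrib_left mult_ac)
    ultimately show ?thesis by (rule separable.cong)
  qed
  have X: "?S (\<lambda>\<omega>\<^sub>0 \<omega>. ?X \<omega>\<^sub>0 \<omega> $ r)" if r: "r < xsize P" for r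
  proof -
    let ?f = "\<lambda>\<omega>\<^sub>0 \<omega>. (\<Sum>j<xdim P. calA P $$ (r, j) * (x t \<omega>\<^sub>0 $ j * 1)) + (\<Sum>j<usize P. calB P $$ (r, j) * ?ua \<omega>\<^sub>0 \<omega> $ j)
        + (\<Sum>j<wsize P. calD P $$ (r, j) * wvec P (noises P t \<omega>) $ j)"
    have "?S ?f"
      using one by (intro separable.add separable_sum[OF _ _ one] separable_cmult[OF ua] separable_cmult[OF separable.prod]
          separable.prod borel_measurable_const L2_future_wvec measurable_compose[OF xF measurable_borel_vec_index]) auto
    moreover have "?f \<omega>\<^sub>0 \<omega> = ?X \<omega>\<^sub>0 \<omega> $ r" if "\<omega>\<^sub>0 \<in> space M" for \<omega>\<^sub>0 \<omega>
      using r carrier_vecD[OF xc[OF that]] by (simp add: trajectory_def scalar_prod_def lessThan_atLeast0)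
    ultimately show ?thesis by (rule separable.cong)
  qed
  let ?B1 = "{b \<in> borel_measurable (future t). integrable M b}"
  have cost: "separable (space M) ?F ?B1 (\<lambda>\<omega>\<^sub>0 \<omega>. horizon_cost P (x t \<omega>\<^sub>0) (\<kappa> (x t \<omega>\<^sub>0)) (acks P t \<omega>) (noises P t \<omega>))"
  proof -
    let ?f = "\<lambda>\<omega>\<^sub>0 \<omega>. (\<Sum>i<xsize P. \<Sum>j<xsize P. calQ P $$ (i, j) * (?X \<omega>\<^sub>0 \<omega> $ i * ?X \<omega>\<^sub>0 \<omega> $ j))
      + (\<Sum>i<usize P. \<Sum>j<usize P. calR P $$ (i, j) * (?ua \<omega>\<^sub>0 \<omega> $ i * ?ua \<omega>\<^sub>0 \<omega> $ j))"
    have zero: "(\<lambda>_. 0) \<in> ?B1" by simp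
    have "separable (space M) ?F ?B1 ?f"
      by (intro separable.add separable_sum[OF _ _ zero] separable_cmult separable_mult[OF X X L2_future_mult] separable_mult[OF ua ua L2_future_mult]) auto
    moreover have "?f \<omega>\<^sub>0 \<omega> = horizon_cost P (x t \<omega>\<^sub>0) (\<kappa> (x t \<omega>\<^sub>0)) (acks P t \<omega>) (noises P t \<omega>)" for \<omega>\<^sub>0 \<omega>
      unfolding horizon_cost_trajectory Let_def form_double_sum[OF weight_carriers(1) trajectory_carrier trajectory_carrier]
        form_double_sum[OF weight_carriers(3) carrier_vecI[OF applied_dim] carrier_vecI[OF applied_dim]]
      by (simp add: mult_ac)
    ultimately show ?thesis by (rule separable.cong)
  qed
  from cond_exp_freeze[OF sub ind cost] show ?thesis
  proof (rule AE_mp, intro AE_I2 impI)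
    fix \<omega> assume \<omega>: "\<omega> \<in> space M" and "real_cond_exp M ?F (\<lambda>\<omega>. horizon_cost P (x t \<omega>) (\<kappa> (x t \<omega>)) (acks P t \<omega>) (noises P t \<omega>)) \<omega>
      = expectation (\<lambda>\<omega>'. horizon_cost P (x t \<omega>) (\<kappa> (x t \<omega>)) (acks P t \<omega>') (noises P t \<omega>'))"
    then show "real_cond_exp M ?F (\<lambda>\<omega>. horizon_cost P (x t \<omega>) (\<kappa> (x t \<omega>)) (acks P t \<omega>) (noises P t \<omega>)) \<omega> = qp_quadratic P t (x t \<omega>) (\<kappa> (x t \<omega>))"
      using expected_cost[OF pol[OF \<omega>] xc[OF \<omega>], of t] by (simp add: has_bochner_integral_iff)
  qed
qed

end

section \<open>Quadratic and linear dependence on the decision\<close>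

lemma dec_linear_cong:
  assumes "dec_linear D f" "\<And>F G a b. F \<in> D \<Longrightarrow> G \<in> D \<Longrightarrow> dec_comb a F b G \<in> D" "\<And>F. F \<in> D \<Longrightarrow> f F = g F"
  shows "dec_linear D g"
  using assms by (simp add: dec_linear_def)

lemma dec_linear_mult_const: "dec_linear D f \<Longrightarrow> dec_linear D (\<lambda>F. f F * k)"
  by (simp add: dec_linear_def algebra_simps)

lemma dec_linear_stack:
  assumes "\<And>F l. F \<in> D \<Longrightarrow> l \<in> set ls \<Longrightarrow> v F l \<in> carrier_vec (c l)"
    "\<And>l j. l \<in> set ls \<Longrightarrow> j < c l \<Longrightarrow> dec_linear D (\<lambda>F. v F l $ j)"
    "\<And>F G a b. F \<in> D \<Longrightarrow> G \<in> D \<Longrightarrow> dec_comb a F b G \<in> D"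
    "j < (\<Sum>l\<leftarrow>ls. c l)"
  shows "dec_linear D (\<lambda>F. stack (map (v F) ls) $ j)"
  using assms(1,2,4)
proof (induction ls arbitrary: j)
  case Nil then show ?case by simp
next
  case (Cons l ls)
  have s: "stack (map (v F) ls) \<in> carrier_vec (\<Sum>l\<leftarrow>ls. c l)" if "F \<in> D" for F
    by (rule stack_carrier) (use Cons.prems(1)[OF that] in auto)
  have "dec_linear D (\<lambda>F. if j < c l then v F l $ j else stack (map (v F) ls) $ (j - c l))"
  proof (cases "j < c l")
    case True then show ?thesis using Cons.prems(2)[of l j] by simp
  next
    case False
    then have "j - c l < (\<Sum>l\<leftarrow>ls. c l)" using Cons.prems(3) by simp
    from Cons.IH[OF _ _ this] Cons.prems(1,2) False show ?thesis by simp
  qed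
  then show ?case
  proof (rule dec_linear_cong[OF _ assms(3)])
    fix F assume F: "F \<in> D"
    have "v F l \<in> carrier_vec (c l)" using Cons.prems(1)[OF F] by simp
    then show "(if j < c l then v F l $ j else stack (map (v F) ls) $ (j - c l)) = stack (map (v F) (l # ls)) $ j"
      using s[OF F] Cons.prems(3) by auto
  qed
qed

lemma tr_mat_mult:
  assumes "X \<in> carrier_mat r k" "Y \<in> carrier_mat k r"
  shows "tr_mat (X * Y) = (\<Sum>i<r. \<Sum>j<k. X $$ (i, j) * Y $$ (j, i))"
  using assms by (auto simp: tr_mat_def scalar_prod_def lessThan_atLeast0 intro!: sum.cong)

context plant begin

lemma dec_linear_form:
  assumes M: "X \<in> carrier_mat k k'" and u: "\<And>F. F \<in> policy_class P \<Longrightarrow> u F \<in> carrier_vec k" "\<And>i. i < k \<Longrightarrow> dec_linear (policy_class P) (\<lambda>F. u F $ i)"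
    and y: "y \<in> carrier_vec k'"
  shows "dec_linear (policy_class P) (\<lambda>F. u F \<bullet> (X *\<^sub>v y))"
  by (rule dec_linear_cong[OF _ policy_class_comb, where f = "\<lambda>F. \<Sum>i<k. \<Sum>j<k'. u F $ i * X $$ (i, j) * y $ j"])
    (auto intro!: dec_linear_sum dec_linear_mult_const u simp: form_double_sum[OF M u(1) y])

lemma dec_linear_form_right:
  assumes M: "X \<in> carrier_mat k' k" and u: "\<And>F. F \<in> policy_class P \<Longrightarrow> u F \<in> carrier_vec k" "\<And>i. i < k \<Longrightarrow> dec_linear (policy_class P) (\<lambda>F. u F $ i)"
    and y: "y \<in> carrier_vec k'"
  shows "dec_linear (policy_class P) (\<lambda>F. y \<bullet> (X *\<^sub>v u F))"
  by (rule dec_linear_cong[OF _ policy_class_comb, where f = "\<lambda>F. \<Sum>i<k'. \<Sum>j<k. y $ i * X $$ (i, j) * u F $ j"])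
    (auto intro!: dec_linear_sum dec_linear_cmult u simp: form_double_sum[OF M y u(1)])

text \<open>The vector \<open>\<Xi>\<close> is linear in the decision: its entries are sums of entries of \<open>\<eta>\<close> and \<open>\<Lambda>\<close>.\<close>

lemma dec_linear_Xi:
  assumes "i < usize P + tsize"
  shows "dec_linear (policy_class P) (\<lambda>F. Xi P F $ i)"
proof -
  let ?D = "policy_class P"
  have lc: "dec_linear ?D (\<lambda>F. ((Cl P l)\<^sup>T *\<^sub>v Lam_col F l) $ j)" if l: "l \<in> {1..<horizon P}" and j: "j < udim P * (horizon P - l)" for l j
  proof (rule dec_linear_cong[OF _ policy_class_comb])
    show "dec_linear ?D (\<lambda>F. \<Sum>i<usize P. Cl P l $$ (i, j) * Lam F $$ (i, l - 1))"
      using l by (intro dec_linear_sum dec_linear_cmult dec_linear_Lam) auto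
    fix F assume F: "F \<in> ?D"
    have C: "Cl P l \<in> carrier_mat (usize P) (udim P * (horizon P - l))" using l by simp
    show "(\<Sum>i<usize P. Cl P l $$ (i, j) * Lam F $$ (i, l - 1)) = ((Cl P l)\<^sup>T *\<^sub>v Lam_col F l) $ j"
      using carrier_matD[OF C] policy_classD(3)[OF F] l j by (auto simp: Lam_col_def scalar_prod_def lessThan_atLeast0)
  qed
  have lt: "dec_linear ?D (\<lambda>F. Lam_tilde P F $ j)" if "j < tsize" for j
    unfolding Lam_tilde_stack
  proof (rule dec_linear_stack[OF _ _ policy_class_comb that])
    show "(Cl P l)\<^sup>T *\<^sub>v Lam_col F l \<in> carrier_vec (udim P * (horizon P - l))" if "F \<in> ?D" "l \<in> set [1..<horizon P]" for F l
      using that by (intro carrier_vecI) (simp add: Cl_eq)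
  qed (use lc in auto)
  have "dec_linear ?D (\<lambda>F. if i < usize P then eta F $ i else Lam_tilde P F $ (i - usize P))"
    using lt[of "i - usize P"] assms by (cases "i < usize P") (auto simp: dec_linear_eta)
  then show ?thesis
  proof (rule dec_linear_cong[OF _ policy_class_comb])
    fix F assume F: "F \<in> ?D"
    show "(if i < usize P then eta F $ i else Lam_tilde P F $ (i - usize P)) = Xi P F $ i"
      using policy_classD(1)[OF F] Lam_tilde_carrier[OF F] assms by (auto simp: Xi_def)
  qed
qed

lemma dec_linear_trace:
  assumes K: "K \<in> carrier_mat (usize P) (esize P)"
  shows "dec_linear (policy_class P) (\<lambda>F. tr_mat ((Theta F)\<^sup>T * K))"
proof (rule dec_linear_cong[OF _ policy_class_comb])
  show "dec_linear (policy_class P) (\<lambda>F. \<Sum>i<esize P. \<Sum>j<usize P. Theta F $$ (j, i) * K $$ (j, i))"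
    by (intro dec_linear_sum dec_linear_mult_const dec_linear_Theta) (auto simp: esize_def)
  fix F assume F: "F \<in> policy_class P"
  note T = policy_classD(2)[OF F]
  have "tr_mat ((Theta F)\<^sup>T * K) = (\<Sum>i<esize P. \<Sum>j<usize P. (Theta F)\<^sup>T $$ (i, j) * K $$ (j, i))"
    using T by (intro tr_mat_mult[OF _ K]) simp
  also have "\<dots> = (\<Sum>i<esize P. \<Sum>j<usize P. Theta F $$ (j, i) * K $$ (j, i))"
    using T by (intro sum.cong) auto
  finally show "(\<Sum>i<esize P. \<Sum>j<usize P. Theta F $$ (j, i) * K $$ (j, i)) = tr_mat ((Theta F)\<^sup>T * K)" ..
qed

lemma dec_linear_trace_right:
  assumes K: "K \<in> carrier_mat (esize P) (usize P)" and E: "E \<in> carrier_mat (esize P) (esize P)"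
  shows "dec_linear (policy_class P) (\<lambda>F. tr_mat (K * Theta F * E))"
proof (rule dec_linear_cong[OF _ policy_class_comb])
  show "dec_linear (policy_class P) (\<lambda>F. \<Sum>i<esize P. \<Sum>j<esize P. (\<Sum>l<usize P. K $$ (i, l) * Theta F $$ (l, j)) * E $$ (j, i))"
    by (intro dec_linear_sum dec_linear_mult_const dec_linear_cmult dec_linear_Theta) (auto simp: esize_def)
  fix F assume F: "F \<in> policy_class P"
  note T = policy_classD(2)[OF F]
  have "tr_mat (K * Theta F * E) = (\<Sum>i<esize P. \<Sum>j<esize P. (K * Theta F) $$ (i, j) * E $$ (j, i))"
    by (rule tr_mat_mult[OF mult_carrier_mat[OF K T] E])
  also have "\<dots> = (\<Sum>i<esize P. \<Sum>j<esize P. (\<Sum>l<usize P. K $$ (i, l) * Theta F $$ (l, j)) * E $$ (j, i))"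
    using T K by (intro sum.cong) (auto simp: scalar_prod_def lessThan_atLeast0)
  finally show "(\<Sum>i<esize P. \<Sum>j<esize P. (\<Sum>l<usize P. K $$ (i, l) * Theta F $$ (l, j)) * E $$ (j, i)) = tr_mat (K * Theta F * E)" ..
qed

text \<open>The bilinear part consists of the form of \<open>\<L>\<close> in \<open>\<Xi>\<close> and of the last trace, the linear part of the
  terms with \<open>\<M>\<close> and with the cross moment of noise and saturated noise.\<close>

lemma qp_quadratic_quadratic:
  assumes v: "v \<in> carrier_vec (xdim P)"
  shows "dec_quadratic (policy_class P) (qp_quadratic P t v)"
proof -
  let ?D = "policy_class P" and ?a = "calA P *\<^sub>v v" and ?E = "Sigma_e P t" and ?E' = "Sigma_e' P t"
  let ?b = "\<lambda>F G. Xi P F \<bullet> (calL P t *\<^sub>v Xi P G) + tr_mat ((Theta F)\<^sup>T * Sigma_S P t * Theta G * ?E)"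
  let ?l = "\<lambda>F. (calM P t *\<^sub>v ?a) \<bullet> Xi P F + 2 * tr_mat ((Theta F)\<^sup>T * (mu_S P t)\<^sup>T * (calB P)\<^sup>T * calQ P * calD P * ?E')"
  let ?c = "?a \<bullet> (calQ P *\<^sub>v ?a) + tr_mat ((calD P)\<^sup>T * calQ P * calD P * Sigma_W P t)"
  have a: "?a \<in> carrier_vec (xsize P)" by (intro carrier_vecI) simp
  have [simp]: "dim_row (Sigma_S P t) = usize P" "dim_col (Sigma_S P t) = usize P" "dim_row (mu_S P t) = usize P" "dim_col (mu_S P t) = usize P"
    "dim_row ?E = esize P" "dim_col ?E = esize P" "dim_row ?E' = wsize P" "dim_col ?E' = esize P"
    by (simp_all add: Sigma_S_def mu_S_def Sigma_e_def Sigma_e'_def esize_def wsize_def)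
  have left: "dec_linear ?D (\<lambda>F. ?b F G)" if G: "G \<in> ?D" for G
  proof (intro dec_linear_add)
    show "dec_linear ?D (\<lambda>F. Xi P F \<bullet> (calL P t *\<^sub>v Xi P G))"
      by (rule dec_linear_form[OF calL_carrier Xi_carrier dec_linear_Xi Xi_carrier[OF G]])
    show "dec_linear ?D (\<lambda>F. tr_mat ((Theta F)\<^sup>T * Sigma_S P t * Theta G * ?E))"
      by (rule dec_linear_cong[OF dec_linear_trace[of "Sigma_S P t * (Theta G * ?E)"] policy_class_comb])
        (use G in \<open>auto intro: carrier_matI simp: mat_assoc\<close>)
  qed
  have right: "dec_linear ?D (?b F)" if F: "F \<in> ?D" for F
    by (intro dec_linear_add dec_linear_form_right[OF calL_carrier Xi_carrier dec_linear_Xi Xi_carrier[OF F]]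
      dec_linear_trace_right carrier_matI) (use F in simp_all)
  have lin: "dec_linear ?D ?l"
  proof (intro dec_linear_add dec_linear_cmult)
    show "dec_linear ?D (\<lambda>F. (calM P t *\<^sub>v ?a) \<bullet> Xi P F)"
    proof (rule dec_linear_cong[OF _ policy_class_comb])
      show "dec_linear ?D (\<lambda>F. \<Sum>i<usize P + tsize. (calM P t *\<^sub>v ?a) $ i * Xi P F $ i)"
        by (intro dec_linear_sum dec_linear_cmult dec_linear_Xi) simp
      show "(\<Sum>i<usize P + tsize. (calM P t *\<^sub>v ?a) $ i * Xi P F $ i) = (calM P t *\<^sub>v ?a) \<bullet> Xi P F" if "F \<in> ?D" for F
        using Xi_carrier[OF that] by (simp add: scalar_prod_def lessThan_atLeast0 del: index_mult_mat_vec)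
    qed
    show "dec_linear ?D (\<lambda>F. tr_mat ((Theta F)\<^sup>T * (mu_S P t)\<^sup>T * (calB P)\<^sup>T * calQ P * calD P * ?E'))"
      by (rule dec_linear_cong[OF dec_linear_trace[of "(mu_S P t)\<^sup>T * ((calB P)\<^sup>T * (calQ P * (calD P * ?E')))"] policy_class_comb])
        (auto intro: carrier_matI simp: mat_assoc)
  qed
  have "\<forall>F\<in>?D. qp_quadratic P t v F = ?b F F + ?l F + ?c" by (simp add: qp_quadratic_def)
  with left right lin show ?thesis unfolding dec_quadratic_def
    by (intro exI[of _ ?b] exI[of _ ?l] exI[of _ ?c]) simp
qed

lemma decision_rule_comb:
  assumes "decision_rule P \<kappa>" "decision_rule P \<kappa>'"
  shows "decision_rule P (\<lambda>v. dec_comb s (\<kappa> v) r (\<kappa>' v))"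
proof -
  have pol: "\<kappa> v \<in> policy_class P" "\<kappa>' v \<in> policy_class P" if "v \<in> carrier_vec (xdim P)" for v
    using assms that by (auto simp: decision_rule_def)
  have meas: "(\<lambda>v. f (dec_comb s (\<kappa> v) r (\<kappa>' v))) \<in> borel_measurable (borel_vec (xdim P))"
    if f: "dec_linear (policy_class P) f" "(\<lambda>v. f (\<kappa> v)) \<in> borel_measurable (borel_vec (xdim P))"
      "(\<lambda>v. f (\<kappa>' v)) \<in> borel_measurable (borel_vec (xdim P))" for f
  proof -
    have "(\<lambda>v. s * f (\<kappa> v) + r * f (\<kappa>' v)) \<in> borel_measurable (borel_vec (xdim P))"
      by (intro borel_measurable_add borel_measurable_times borel_measurable_const f)
    moreover have "f (dec_comb s (\<kappa> v) r (\<kappa>' v)) = s * f (\<kappa> v) + r * f (\<kappa>' v)" if "v \<in> space (borel_vec (xdim P))" for v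
      using f(1) pol[of v] that by (simp add: dec_linear_def)
    ultimately show ?thesis by (subst measurable_cong)
  qed
  show ?thesis unfolding decision_rule_def
  proof (intro conjI ballI allI impI)
    show "dec_comb s (\<kappa> v) r (\<kappa>' v) \<in> policy_class P" if "v \<in> carrier_vec (xdim P)" for v
      by (rule policy_class_comb[OF pol[OF that]])
  qed (rule meas, auto intro: dec_linear_eta dec_linear_Theta dec_linear_Lam simp: assms[unfolded decision_rule_def] esize_def)+
qed

end

theorem theorem1:
  fixes P :: "'a system" and p :: real
    and \<pi> :: "nat \<Rightarrow> real vec \<Rightarrow> decision" and x :: "nat \<Rightarrow> 'a \<Rightarrow> real vec" and t :: nat
  assumes dims: "0 < xdim P" "0 < udim P"
    and horizon: "1 \<le> horizon P" "1 \<le> recalc P" "recalc P \<le> horizon P"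
    and plant: "sysA P \<in> carrier_mat (xdim P) (xdim P)" "sysB P \<in> carrier_mat (xdim P) (udim P)"
      "xinit P \<in> carrier_vec (xdim P)" "0 < Umax P"
    and weights: "sym_nonneg_def (xdim P) (wgtQ P)" "sym_nonneg_def (xdim P) (wgtQf P)"
      "sym_pos_def (udim P) (wgtR P)" "0 \<le> regmu P"
    and prob: "prob_space (prob P)"
    and channel: "0 < p" "p \<le> 1"
      "prob_space.indep_vars (prob P) (\<lambda>_. borel) (ack P) UNIV"
      "\<And>s \<omega>. \<omega> \<in> space (prob P) \<Longrightarrow> ack P s \<omega> \<in> {0, 1}"
      "\<And>s. prob_space.expectation (prob P) (ack P s) = p"
    and noise: "prob_space.indep_vars (prob P) (\<lambda>_. borel_vec (xdim P)) (noise P) UNIV"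
      "\<And>s. distr (prob P) (borel_vec (xdim P)) (noise P s) = distr (prob P) (borel_vec (xdim P)) (noise P 0)"
      "\<And>s. distr (prob P) (borel_vec (xdim P)) (\<lambda>\<omega>. - noise P s \<omega>)
             = distr (prob P) (borel_vec (xdim P)) (noise P s)"
      "\<And>s i. i < xdim P \<Longrightarrow> integrable (prob P) (\<lambda>\<omega>. (noise P s \<omega> $ i)\<^sup>2)"
      "\<And>s i. i < xdim P \<Longrightarrow> prob_space.expectation (prob P) (\<lambda>\<omega>. noise P s \<omega> $ i) = 0"
    and noise_channel: "prob_space.indep_set (prob P)
      (sets (vimage_algebra (space (prob P)) (\<lambda>\<omega> s. noise P s \<omega>) (\<Pi>\<^sub>M s\<in>UNIV. borel_vec (xdim P))))
      (sets (vimage_algebra (space (prob P)) (\<lambda>\<omega> s. ack P s \<omega>) (\<Pi>\<^sub>M s\<in>UNIV. borel)))"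
    and saturation: "\<And>i j. sat P i j \<in> borel_measurable borel"
      "\<And>i j r. sat P i j (- r) = - sat P i j r"
      "\<And>s \<omega>. \<omega> \<in> space (prob P) \<Longrightarrow> linf (evec P (noises P s \<omega>)) \<le> phimax P"
    and past_rules: "\<And>k. decision_rule P (\<pi> k)"
      "\<And>k v. v \<in> carrier_vec (xdim P) \<Longrightarrow> \<pi> k v \<in> feasible_set P"
    and loop: "closed_loop P \<pi> x"
    and t: "recalc P dvd t"
  shows
    "dec_convex_set (feasible_set P)
   \<and> (\<forall>\<kappa> \<kappa>' s. decision_rule P \<kappa> \<longrightarrow> decision_rule P \<kappa>' \<longrightarrow> 0 \<le> s \<longrightarrow> s \<le> 1 \<longrightarrow>
       (AE \<omega> in prob P. objective P x t (\<lambda>v. dec_comb s (\<kappa> v) (1 - s) (\<kappa>' v)) \<omega>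
         \<le> s * objective P x t \<kappa> \<omega> + (1 - s) * objective P x t \<kappa>' \<omega>))
   \<and> feasible_set P \<noteq> {}
   \<and> (\<forall>\<kappa>. decision_rule P \<kappa> \<longrightarrow>
       (AE \<omega> in prob P. objective P x t \<kappa> \<omega>
         = qp_quadratic P t (x t \<omega>) (\<kappa> (x t \<omega>)) + regmu P * regularizer P (\<kappa> (x t \<omega>))))
   \<and> feasible_set P
       = {F \<in> policy_class P. \<forall>i\<in>{..<udim P * horizon P}. qp_constraint P i F \<le> Umax P}
   \<and> (\<forall>v\<in>carrier_vec (xdim P).
       convex_quadratic_program (policy_class P) (qp_quadratic P t v) (\<lambda>F. regmu P * regularizer P F)
         {..<udim P * horizon P} (qp_constraint P))"
proof -
  interpret prob_space "system.prob P" by (rule prob)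
  interpret stochastic_plant P
    by unfold_locales (fact dims horizon plant weights channel noise noise_channel saturation)+
  let ?D = "policy_class P" and ?obj = "objective P x t"
  let ?qp = "\<lambda>v F. qp_quadratic P t v F + regmu P * regularizer P F"
  note comb = policy_class_comb[of _ P]
  note set = feasible_set_eq[OF horizon(3) dims(2) plant(4) phimax_nonneg]
  have reg: "dec_convex_pwl ?D (\<lambda>F. regmu P * regularizer P F)"
    by (rule regularizer_pwl[OF dims(2) weights(4)])
  have obj: "AE \<omega> in system.prob P. ?obj \<kappa> \<omega> = ?qp (x t \<omega>) (\<kappa> (x t \<omega>))" if "decision_rule P \<kappa>" for \<kappa>
    using conditional_cost[OF past_rules(1) loop that, of t] by eventually_elim (simp add: objective_def)
  have conv: "AE \<omega> in system.prob P. ?obj (\<lambda>v. dec_comb s (\<kappa> v) (1 - s) (\<kappa>' v)) \<omega> \<le> s * ?obj \<kappa> \<omega> + (1 - s) * ?obj \<kappa>' \<omega>"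
    if k: "decision_rule P \<kappa>" "decision_rule P \<kappa>'" and s: "0 \<le> s" "s \<le> 1" for \<kappa> \<kappa>' and s :: real
    using obj[OF decision_rule_comb[OF k, of s "1 - s"]] obj[OF k(1)] obj[OF k(2)] AE_space
  proof eventually_elim
    case (elim \<omega>)
    have xc: "x t \<omega> \<in> carrier_vec (xdim P)"
      using measurable_space[OF state_measurable[OF past_rules(1) loop, of t], of \<omega>] elim by simp
    have F: "\<kappa> (x t \<omega>) \<in> ?D" "\<kappa>' (x t \<omega>) \<in> ?D" using k xc by (auto simp: decision_rule_def)
    have "qp_quadratic P t (x t \<omega>) (dec_comb s (\<kappa> (x t \<omega>)) (1 - s) (\<kappa>' (x t \<omega>)))
        \<le> s * qp_quadratic P t (x t \<omega>) (\<kappa> (x t \<omega>)) + (1 - s) * qp_quadratic P t (x t \<omega>) (\<kappa>' (x t \<omega>))"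
      using qp_quadratic_convex[OF xc, of t] F s by (simp add: dec_convex_fun_def)
    moreover have "regmu P * regularizer P (dec_comb s (\<kappa> (x t \<omega>)) (1 - s) (\<kappa>' (x t \<omega>)))
        \<le> s * (regmu P * regularizer P (\<kappa> (x t \<omega>))) + (1 - s) * (regmu P * regularizer P (\<kappa>' (x t \<omega>)))"
      using dec_convex_pwl_convex[OF reg comb] F s by (simp add: dec_convex_fun_def)
    ultimately show ?case using elim by (simp add: algebra_simps)
  qed
  have qp: "convex_quadratic_program ?D (qp_quadratic P t v) (\<lambda>F. regmu P * regularizer P F) {..<usize P} (qp_constraint P)"
    if v: "v \<in> carrier_vec (xdim P)" for v
    unfolding convex_quadratic_program_def
    using zero_policy[of P] comb qp_quadratic_quadratic[OF v] qp_quadratic_convex[OF v] reg qp_constraint_pwl[OF _ phimax_nonneg]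
    by auto
  show ?thesis
    using feasible_convex[OF horizon(3) dims(2) plant(4) phimax_nonneg] conv
      feasible_nonempty[OF horizon(3) dims(2) plant(4) phimax_nonneg] obj set qp
    by (intro conjI allI impI ballI)
qed

end
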